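(* Let $\epsilon,\delta\in(0,1)$. Suppose that the Lipschitz control model assumption, the sampling distribution assumption (with function $g$) and the measurable unique optimizer assumption (all given in the context) hold. If $u_1\equiv1$ and $\theta>\frac{1}{(1-\gamma)\,\mathrm{leb}(\mathcal X\times\mathcal A)}$, where $\mathrm{leb}$ denotes Lebesgue measure, then for every $$N\ge\mathrm N\!\left(n_c+n_u+1,\ g\!\left(\tfrac{\epsilon}{L_\Lambda}\right),\ \delta\right),\qquad L_\Lambda:=\theta\sqrt{n_c}\,L_c+\theta\sqrt{n_u}\,(L_uL_{\mathsf P}+L_u),$$ with probability at least $1-\delta$ (over the i.i.d. samples $(x^{(\ell)},a^{(\ell)})_{\ell=1}^N\sim\mathbb P^N$) it holds that $\tilde c_N\in\mathcal C^{\tilde\varepsilon_N+\epsilon}(\pi_{\mathrm E})$.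
   Context: Function spaces. For a metric space $(X,\rho)$ and $u:X\to\mathbb R$, let $\|u\|_\infty=\sup_x|u(x)|$, $|u|_{\mathrm L}=\sup_{x\ne x'}|u(x)-u(x')|/\rho(x,x')$, $\|u\|_{\mathrm L}=\|u\|_\infty+|u|_{\mathrm L}$. $\operatorname{Lip}(X)$ is the Banach space of bounded Lipschitz functions $X\to\mathbb R$ with norm $\|\cdot\|_{\mathrm L}$. For a finite signed Borel measure $\mu$ on $X$, $\langle\mu,u\rangle=\int_X u\,d\mu$. On $\mathcal X\times\mathcal A$ the metric is $\|x-y\|_2+\|a-b\|_2$; $B_r(x,a)$ is the open ball in $\mathcal X\times\mathcal A$; $d(x,a)$ in integrals denotes Lebesgue measure. MDP. State space $\mathcal X$ and action space $\mathcal A$ (Borel spaces), transition law $\mathsf P$ (a stochastic kernel on $\mathcal X$ given $\mathcal X\times\mathcal A$), discount factor $\gamma\in(0,1)$, initial distribution $\nu_0$ (a Borel probability measure on $\mathcal X$). $\pi_{\mathrm E}$ is a fixed expert policy (possibly randomized, nonstationary, history-dependent). $\mathbb P_{\nu_0}^\pi$ is the law of the trajectory $(x_t,a_t)_{t\ge0}$ under policy $\pi$ with $x_0\sim\nu_0$. The occupancy measure of $\pi$ is $\mu_{\nu_0}^\pi(E)=\sum_{t\ge0}\gamma^t\mathbb P_{\nu_0}^\pi[(x_t,a_t)\in E]$ for Borel $E\subset\mathcal X\times\mathcal A$. For $u\in\operatorname{Lip}(\mathcal X)$, $\mathsf Pu(x,a)=\int_{\mathcal X}u(y)\,\mathsf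 P(dy|x,a)$ and $(T_\gamma^*u)(x,a)=u(x)-\gamma\,\mathsf Pu(x,a)$. Lipschitz control model assumption. (A1) $\mathcal X$ and $\mathcal A$ are compact subsets of Euclidean spaces. (A2) $\mathsf P$ is weakly continuous ($\mathsf Pu$ is continuous on $\mathcal X\times\mathcal A$ for every continuous $u:\mathcal X\to\mathbb R$) and there is $L_{\mathsf P}>0$ with $|\mathsf Pu(x,a)-\mathsf Pu(y,b)|\le L_{\mathsf P}|u|_{\mathrm L}(\|x-y\|_2+\|a-b\|_2)$ for all $(x,a),(y,b)\in\mathcal X\times\mathcal A$ and $u\in\operatorname{Lip}(\mathcal X)$. (A3) Cost functions are in $\operatorname{Lip}(\mathcal X\times\mathcal A)$. $\varepsilon$-inverse feasibility set. For $\varepsilon\ge0$, $\mathcal C^\varepsilon(\pi_{\mathrm E})$ is the set of $c\in\operatorname{Lip}(\mathcal X\times\mathcal A)$ for which there exists $u\in\operatorname{Lip}(\mathcal X)$ with $\langle\mu_{\nu_0}^{\pi_{\mathrm E}},c-T_\gamma^*u\rangle\le\varepsilon$ and $c-T_\gamma^*u\ge-\varepsilon$ on $\mathcal X\times\mathcal A$. Function classes. Let $c_1,\dots,c_{n_c}\in\operatorname{Lip}(\mathcal X\times\mathcal A)$ be linearly independent with Lipschitz constant $L_c>0$, let $u_1,\dots,u_{n_u}\in\operatorname{Lip}(\mathcal X)$ be linearly independent with Lipschitz constant $L_u>0$, and let $\theta>0$. Set $\mathbf C_{n_c}=\{\sum_{i=1}^{n_c}\alpha_ic_i:\alpha\in\mathbb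 R^{n_c},\|\alpha\|_1\le\theta\}$ and $\mathbf U_{n_u}=\{\sum_{i=1}^{n_u}\beta_iu_i:\beta\in\mathbb R^{n_u},\|\beta\|_1\le\theta\}$. Sampling distribution assumption. $\mathbb P$ is a Borel probability measure on $\mathcal X\times\mathcal A$ for which there exists a strictly increasing $g:\mathbb R_+\to[0,1]$ with $\mathbb P(B_r(x,a))>g(r)$ for all $(x,a)\in\mathcal X\times\mathcal A$ and $r>0$. Sampled inverse program (SIP$_N$). Given i.i.d. samples $(x^{(\ell)},a^{(\ell)})_{\ell=1}^N$ from $\mathbb P$, minimize $\varepsilon$ over $(\alpha,\beta,\varepsilon)$ with $c=\sum_i\alpha_ic_i\in\mathbf C_{n_c}$, $u=\sum_i\beta_iu_i\in\mathbf U_{n_u}$ and $\varepsilon\ge0$, subject to $\langle\mu_{\nu_0}^{\pi_{\mathrm E}},c-T_\gamma^*u\rangle\le\varepsilon$; $c(x^{(\ell)},a^{(\ell)})-T_\gamma^*u(x^{(\ell)},a^{(\ell)})\ge-\varepsilon$ for $\ell=1,\dots,N$; and $\int_{\mathcal X\times\mathcal A}(c-T_\gamma^*u)(x,a)\,d(x,a)=1$. Measurable unique optimizer assumption. The SIP$_N$ optimizer generates a Borel measurable mapping that associates to each multi-sample $(x^{(\ell)},a^{(\ell)})_{\ell=1}^N$ a uniquely defined optimizer $(\tilde\alpha_N,\tilde\beta_N,\tilde\varepsilon_N)$ (e.g. via a tie-break rule selecting the minimum $\|\cdot\|_2$-norm solution). The extracted cost is $\tilde c_N=\sum_{i=1}^{n_c}\tilde\alpha_{N,i}c_i$.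 For $n\in\mathbb N$ and $\epsilon,\delta\in(0,1)$: $\mathrm N(n,\epsilon,\delta)=\min\{N\in\mathbb N:\sum_{i=0}^n\binom Ni\epsilon^i(1-\epsilon)^{N-i}\le\delta\}$.
   Formalization: The uniquely defined optimizer must come from a fixed strict preference order whose sets of preferred solutions are convex (includes literal uniqueness and the minimum-norm rule); for arbitrary measurable selections or non-convex tie-break rules the claim fails. *)

theory Defs
  imports "HOL-Probability.Probability"
begin

section \<open>Lipschitz functions\<close>

text \<open>
  Functions on a subset \<open>S\<close> of a type are rendered as total functions; every notion below
  depends only on their values on \<open>S\<close>.  The metric is an explicit parameter because the metric
  on the product of state and action space is the sum metric, not the Euclidean one that the
  type class instance for pairs provides.
\<close>

definition sum_dist :: "'x::metric_space \<times> 'a::metric_space \<Rightarrow> 'x \<times> 'a \<Rightarrow> real" where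
  "sum_dist z w = dist (fst z) (fst w) + dist (snd z) (snd w)"

definition Lip :: "('s \<Rightarrow> 's \<Rightarrow> real) \<Rightarrow> 's set \<Rightarrow> ('s \<Rightarrow> real) set" where
  "Lip \<rho> S = {u. (\<exists>B. \<forall>z\<in>S. \<bar>u z\<bar> \<le> B) \<and> (\<exists>L. \<forall>z\<in>S. \<forall>w\<in>S. \<bar>u z - u w\<bar> \<le> L * \<rho> z w)}"

text \<open>
  The element 0 only matters when \<open>S\<close> has at most one point: the supremum of the empty set of
  reals is unspecified.  It is meant to be used for members of \<open>Lip \<rho> S\<close> only, where the set
  is bounded.
\<close>

definition lip_seminorm :: "('s \<Rightarrow> 's \<Rightarrow> real) \<Rightarrow> 's set \<Rightarrow> ('s \<Rightarrow> real) \<Rightarrow> real" where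
  "lip_seminorm \<rho> S u =
    Sup (insert 0 {\<bar>u z - u w\<bar> / \<rho> z w | z w. z \<in> S \<and> w \<in> S \<and> z \<noteq> w})"

definition lin_indep_on :: "'s set \<Rightarrow> ('n::finite \<Rightarrow> 's \<Rightarrow> real) \<Rightarrow> bool" where
  "lin_indep_on S f \<longleftrightarrow>
    (\<forall>\<alpha> :: real ^ 'n. (\<forall>z\<in>S. (\<Sum>i\<in>UNIV. \<alpha> $ i * f i z) = 0) \<longrightarrow> \<alpha> = 0)"

definition l1_norm :: "real ^ 'n::finite \<Rightarrow> real" where
  "l1_norm \<alpha> = (\<Sum>i\<in>UNIV. \<bar>\<alpha> $ i\<bar>)"

definition lincomb :: "('n::finite \<Rightarrow> 's \<Rightarrow> real) \<Rightarrow> real ^ 'n \<Rightarrow> 's \<Rightarrow> real" where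
  "lincomb f \<alpha> z = (\<Sum>i\<in>UNIV. \<alpha> $ i * f i z)"


section \<open>Markov decision processes on subsets of Euclidean spaces\<close>

abbreviation borel_on :: "'s::topological_space set \<Rightarrow> 's measure" where
  "borel_on S \<equiv> restrict_space borel S"

definition stochastic_kernel ::
  "'x::euclidean_space set \<Rightarrow> 'a::euclidean_space set \<Rightarrow> ('x \<times> 'a \<Rightarrow> 'x measure) \<Rightarrow> bool" where
  "stochastic_kernel X A P \<longleftrightarrow> P \<in> borel_on (X \<times> A) \<rightarrow>\<^sub>M prob_algebra (borel_on X)"

definition initial_distribution :: "'x::euclidean_space set \<Rightarrow> 'x measure \<Rightarrow> bool" where
  "initial_distribution X \<nu> \<longleftrightarrow> \<nu> \<in> space (prob_algebra (borel_on X))"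

text \<open>
  \<open>\<pi> t h x\<close> is the distribution of the action at time \<open>t\<close>, given the state-action pairs \<open>h 0\<close>,
  \dots, \<open>h (t - 1)\<close> of the past and the current state \<open>x\<close>.
\<close>

definition policy ::
  "'x::euclidean_space set \<Rightarrow> 'a::euclidean_space set
    \<Rightarrow> (nat \<Rightarrow> (nat \<Rightarrow> 'x \<times> 'a) \<Rightarrow> 'x \<Rightarrow> 'a measure) \<Rightarrow> bool" where
  "policy X A \<pi> \<longleftrightarrow>
    (\<forall>t. (\<lambda>(h, x). \<pi> t h x) \<in>
       (\<Pi>\<^sub>M s\<in>{0..<t}. borel_on (X \<times> A)) \<Otimes>\<^sub>M borel_on X \<rightarrow>\<^sub>M prob_algebra (borel_on A))"

definition step_kernel ::
  "'x::euclidean_space set \<Rightarrow> 'a::euclidean_space set \<Rightarrow> ('x \<times> 'a \<Rightarrow> 'x measure) \<Rightarrow> 'x measure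
    \<Rightarrow> (nat \<Rightarrow> (nat \<Rightarrow> 'x \<times> 'a) \<Rightarrow> 'x \<Rightarrow> 'a measure)
    \<Rightarrow> nat \<Rightarrow> (nat \<Rightarrow> 'x \<times> 'a) \<Rightarrow> ('x \<times> 'a) measure" where
  "step_kernel X A P \<nu> \<pi> t h =
    (case t of 0 \<Rightarrow> \<nu> | Suc s \<Rightarrow> P (h s)) \<bind>
      (\<lambda>x. distr (\<pi> t h x) (borel_on (X \<times> A)) (\<lambda>a. (x, a)))"

text \<open>The Ionescu-Tulcea measure on infinite trajectories.\<close>

definition trajectory_law ::
  "'x::euclidean_space set \<Rightarrow> 'a::euclidean_space set \<Rightarrow> ('x \<times> 'a \<Rightarrow> 'x measure) \<Rightarrow> 'x measure
    \<Rightarrow> (nat \<Rightarrow> (nat \<Rightarrow> 'x \<times> 'a) \<Rightarrow> 'x \<Rightarrow> 'a measure) \<Rightarrow> (nat \<Rightarrow> 'x \<times> 'a) measure" where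
  "trajectory_law X A P \<nu> \<pi> =
    projective_family.lim UNIV
      (Ionescu_Tulcea.CI (step_kernel X A P \<nu> \<pi>) (\<lambda>_. borel_on (X \<times> A)))
      (\<lambda>_. borel_on (X \<times> A))"

definition occupancy_measure ::
  "'x::euclidean_space set \<Rightarrow> 'a::euclidean_space set \<Rightarrow> ('x \<times> 'a \<Rightarrow> 'x measure) \<Rightarrow> real
    \<Rightarrow> 'x measure \<Rightarrow> (nat \<Rightarrow> (nat \<Rightarrow> 'x \<times> 'a) \<Rightarrow> 'x \<Rightarrow> 'a measure) \<Rightarrow> ('x \<times> 'a) measure" where
  "occupancy_measure X A P \<gamma> \<nu> \<pi> =
    measure_of (X \<times> A) (sets (borel_on (X \<times> A)))
      (\<lambda>E. \<Sum>t. ennreal (\<gamma> ^ t) *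
         emeasure (trajectory_law X A P \<nu> \<pi>)
           {\<omega> \<in> space (trajectory_law X A P \<nu> \<pi>). \<omega> t \<in> E})"

definition kernel_op :: "('x \<times> 'a \<Rightarrow> 'x measure) \<Rightarrow> ('x \<Rightarrow> real) \<Rightarrow> 'x \<times> 'a \<Rightarrow> real" where
  "kernel_op P u z = (\<integral>y. u y \<partial>P z)"

definition T_adj :: "('x \<times> 'a \<Rightarrow> 'x measure) \<Rightarrow> real \<Rightarrow> ('x \<Rightarrow> real) \<Rightarrow> 'x \<times> 'a \<Rightarrow> real" where
  "T_adj P \<gamma> u z = u (fst z) - \<gamma> * kernel_op P u z"

text \<open>
  Conditions on the spaces and on the transition law; the condition that cost functions be
  Lipschitz is part of the definitions and hypotheses in which cost functions occur.
\<close>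

definition lipschitz_control_model ::
  "'x::euclidean_space set \<Rightarrow> 'a::euclidean_space set \<Rightarrow> ('x \<times> 'a \<Rightarrow> 'x measure) \<Rightarrow> real \<Rightarrow> bool"
  where
  "lipschitz_control_model X A P L\<^sub>P \<longleftrightarrow>
    compact X \<and> compact A \<and>
    (\<forall>u. continuous_on X u \<longrightarrow> continuous_on (X \<times> A) (kernel_op P u)) \<and>
    L\<^sub>P > 0 \<and>
    (\<forall>u\<in>Lip dist X. \<forall>z\<in>X \<times> A. \<forall>w\<in>X \<times> A.
       \<bar>kernel_op P u z - kernel_op P u w\<bar> \<le> L\<^sub>P * lip_seminorm dist X u * sum_dist z w)"

definition inverse_feasibility_set ::
  "'x::euclidean_space set \<Rightarrow> 'a::euclidean_space set \<Rightarrow> ('x \<times> 'a \<Rightarrow> 'x measure) \<Rightarrow> real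
    \<Rightarrow> 'x measure \<Rightarrow> (nat \<Rightarrow> (nat \<Rightarrow> 'x \<times> 'a) \<Rightarrow> 'x \<Rightarrow> 'a measure) \<Rightarrow> real
    \<Rightarrow> ('x \<times> 'a \<Rightarrow> real) set" where
  "inverse_feasibility_set X A P \<gamma> \<nu> \<pi> \<epsilon> =
    {c \<in> Lip sum_dist (X \<times> A). \<exists>u \<in> Lip dist X.
       (\<integral>z. c z - T_adj P \<gamma> u z \<partial>occupancy_measure X A P \<gamma> \<nu> \<pi>) \<le> \<epsilon> \<and>
       (\<forall>z\<in>X \<times> A. c z - T_adj P \<gamma> u z \<ge> - \<epsilon>)}"


section \<open>The sampled inverse program\<close>

definition sampling_distribution ::
  "'x::euclidean_space set \<Rightarrow> 'a::euclidean_space set \<Rightarrow> ('x \<times> 'a) measure \<Rightarrow> (real \<Rightarrow> real) \<Rightarrow> bool"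
  where
  "sampling_distribution X A Q g \<longleftrightarrow>
    prob_space Q \<and> sets Q = sets (borel_on (X \<times> A)) \<and>
    g \<in> {0..} \<rightarrow> {0..1} \<and> strict_mono_on {0..} g \<and>
    (\<forall>z\<in>X \<times> A. \<forall>r>0. measure Q {w \<in> X \<times> A. sum_dist z w < r} > g r)"

text \<open>
  Decision variables are triples of the coefficients \<open>\<alpha>\<close> of the cost, the coefficients \<open>\<beta>\<close> of
  the value function and the slack \<open>e\<close>; the multi-sample is \<open>s 1\<close>, \dots, \<open>s N\<close>.
\<close>

definition sip_feasible ::
  "'x::euclidean_space set \<Rightarrow> 'a::euclidean_space set \<Rightarrow> ('x \<times> 'a \<Rightarrow> 'x measure) \<Rightarrow> real
    \<Rightarrow> 'x measure \<Rightarrow> (nat \<Rightarrow> (nat \<Rightarrow> 'x \<times> 'a) \<Rightarrow> 'x \<Rightarrow> 'a measure)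
    \<Rightarrow> ('nc::finite \<Rightarrow> 'x \<times> 'a \<Rightarrow> real) \<Rightarrow> ('nu::finite \<Rightarrow> 'x \<Rightarrow> real) \<Rightarrow> real
    \<Rightarrow> nat \<Rightarrow> (nat \<Rightarrow> 'x \<times> 'a) \<Rightarrow> ((real ^ 'nc) \<times> (real ^ 'nu) \<times> real) set" where
  "sip_feasible X A P \<gamma> \<nu> \<pi> cs us \<theta> N s =
    {(\<alpha>, \<beta>, e). l1_norm \<alpha> \<le> \<theta> \<and> l1_norm \<beta> \<le> \<theta> \<and> e \<ge> 0 \<and>
       (let f = (\<lambda>z. lincomb cs \<alpha> z - T_adj P \<gamma> (lincomb us \<beta>) z) in
          (\<integral>z. f z \<partial>occupancy_measure X A P \<gamma> \<nu> \<pi>) \<le> e \<and>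
          (\<forall>l\<in>{1..N}. f (s l) \<ge> - e) \<and>
          (LINT z:X \<times> A|lborel. f z) = 1)}"

definition sip_optimal ::
  "'x::euclidean_space set \<Rightarrow> 'a::euclidean_space set \<Rightarrow> ('x \<times> 'a \<Rightarrow> 'x measure) \<Rightarrow> real
    \<Rightarrow> 'x measure \<Rightarrow> (nat \<Rightarrow> (nat \<Rightarrow> 'x \<times> 'a) \<Rightarrow> 'x \<Rightarrow> 'a measure)
    \<Rightarrow> ('nc::finite \<Rightarrow> 'x \<times> 'a \<Rightarrow> real) \<Rightarrow> ('nu::finite \<Rightarrow> 'x \<Rightarrow> real) \<Rightarrow> real
    \<Rightarrow> nat \<Rightarrow> (nat \<Rightarrow> 'x \<times> 'a) \<Rightarrow> ((real ^ 'nc) \<times> (real ^ 'nu) \<times> real) set" where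
  "sip_optimal X A P \<gamma> \<nu> \<pi> cs us \<theta> N s =
    {p \<in> sip_feasible X A P \<gamma> \<nu> \<pi> cs us \<theta> N s.
       \<forall>q \<in> sip_feasible X A P \<gamma> \<nu> \<pi> cs us \<theta> N s. snd (snd p) \<le> snd (snd q)}"

text \<open>
  A tie-break rule is a strict preference order between decisions that is fixed in advance, with
  \<open>better q p\<close> meaning that \<open>q\<close> is preferred to \<open>p\<close>.  Convexity is what the scenario approach
  requires of tie-break rules; an arbitrary preference among the optimizers could favour those
  violating the unseen constraints most.  The empty relation covers programs whose optimizer is
  unique, \<open>\<lambda>q p. norm q < norm p\<close> is the selection of the minimum-norm solution, and
  lexicographic minimization of finitely many convex functions is a further instance.
\<close>

definition tie_break_rule :: "('z::real_vector \<Rightarrow> 'z \<Rightarrow> bool) \<Rightarrow> bool" where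
  "tie_break_rule better \<longleftrightarrow>
    irreflp better \<and> transp better \<and> (\<forall>p. convex {q. better q p})"

definition unique_optimizer_map ::
  "('s \<Rightarrow> 'z::euclidean_space) \<Rightarrow> 's measure \<Rightarrow> ('s \<Rightarrow> 'z set) \<Rightarrow> bool" where
  "unique_optimizer_map sel M Opt \<longleftrightarrow>
    sel \<in> M \<rightarrow>\<^sub>M borel \<and>
    (\<exists>better. tie_break_rule better \<and>
      (\<forall>s\<in>space M. sel s \<in> Opt s \<and> (\<forall>p\<in>Opt s. p \<noteq> sel s \<longrightarrow> better (sel s) p)))"

definition sample_size :: "nat \<Rightarrow> real \<Rightarrow> real \<Rightarrow> nat" where
  "sample_size n \<epsilon> \<delta> =
    (LEAST N. (\<Sum>i=0..n. real (N choose i) * \<epsilon> ^ i * (1 - \<epsilon>) ^ (N - i)) \<le> \<delta>)"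


section \<open>Adequacy of the definitions\<close>

lemma tie_break_rule_empty: "tie_break_rule (\<lambda>q p. False)"
  by (simp add: tie_break_rule_def irreflp_def transp_def)

lemma tie_break_rule_convex_on:
  fixes \<phi> :: "'z::real_vector \<Rightarrow> real"
  assumes "convex_on UNIV \<phi>"
  shows "tie_break_rule (\<lambda>q p. \<phi> q < \<phi> p)"
proof -
  have "convex {q. \<phi> q < c}" for c
  proof (rule convexI)
    fix x y :: 'z and u v :: real
    assume *: "x \<in> {q. \<phi> q < c}" "y \<in> {q. \<phi> q < c}" "0 \<le> u" "0 \<le> v" "u + v = 1"
    have "\<phi> (u *\<^sub>R x + v *\<^sub>R y) \<le> u * \<phi> x + v * \<phi> y"
      using assms * by (simp add: convex_on_def)
    also have "\<dots> < c"
      using * by (intro convex_bound_lt) auto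
    finally show "u *\<^sub>R x + v *\<^sub>R y \<in> {q. \<phi> q < c}" by simp
  qed
  then show ?thesis
    by (auto simp: tie_break_rule_def irreflp_def transp_def)
qed

lemma tie_break_rule_norm: "tie_break_rule (\<lambda>q p :: 'z::real_normed_vector. norm q < norm p)"
  by (rule tie_break_rule_convex_on) (use convex_on_dist[of UNIV 0] in simp)

lemma sets_borel_on_Times:
  fixes X :: "'x::euclidean_space set" and A :: "'a::euclidean_space set"
  assumes "X \<in> sets borel" "A \<in> sets borel"
  shows "sets (borel_on X \<Otimes>\<^sub>M borel_on A) = sets (borel_on (X \<times> A))"
proof
  have XA: "X \<times> A \<in> sets borel"
    using assms by (rule borel_Times)
  show "sets (borel_on X \<Otimes>\<^sub>M borel_on A) \<subseteq> sets (borel_on (X \<times> A))"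
  proof -
    have "{a \<times> b | a b. a \<in> sets (borel_on X) \<and> b \<in> sets (borel_on A)}
            \<subseteq> sets (borel_on (X \<times> A))"
      using assms XA by (auto simp: sets_restrict_space_iff intro!: borel_Times)
    from sets.sigma_sets_subset[OF this] show ?thesis
      by (simp add: sets_pair_measure space_restrict_space)
  qed
  have [measurable]: "(\<lambda>x. x) \<in> borel_on X \<rightarrow>\<^sub>M borel" "(\<lambda>a. a) \<in> borel_on A \<rightarrow>\<^sub>M borel"
    by (auto intro: measurable_restrict_space1)
  have "(\<lambda>z. (fst z, snd z)) \<in> borel_on X \<Otimes>\<^sub>M borel_on A \<rightarrow>\<^sub>M borel \<Otimes>\<^sub>M borel"
    by (intro measurable_Pair
          measurable_compose[OF measurable_fst \<open>(\<lambda>x. x) \<in> borel_on X \<rightarrow>\<^sub>M borel\<close>]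
          measurable_compose[OF measurable_snd \<open>(\<lambda>a. a) \<in> borel_on A \<rightarrow>\<^sub>M borel\<close>])
  then have id: "(\<lambda>z. z) \<in> borel_on X \<Otimes>\<^sub>M borel_on A \<rightarrow>\<^sub>M borel"
    by (simp add: borel_prod)
  show "sets (borel_on (X \<times> A)) \<subseteq> sets (borel_on X \<Otimes>\<^sub>M borel_on A)"
  proof
    fix S assume "S \<in> sets (borel_on (X \<times> A))"
    then have S: "S \<in> sets borel" "S \<subseteq> X \<times> A"
      using XA by (auto simp: sets_restrict_space_iff)
    have "(\<lambda>z. z) -` S \<inter> space (borel_on X \<Otimes>\<^sub>M borel_on A) = S"
      using S by (auto simp: space_pair_measure space_restrict_space)
    then show "S \<in> sets (borel_on X \<Otimes>\<^sub>M borel_on A)"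
      using measurable_sets[OF id S(1)] by simp
  qed
qed

lemma Ionescu_Tulcea_step_kernel:
  fixes X :: "'x::euclidean_space set" and A :: "'a::euclidean_space set"
  assumes "X \<in> sets borel" "A \<in> sets borel"
    and "stochastic_kernel X A P" "initial_distribution X \<nu>" "policy X A \<pi>"
  shows "Ionescu_Tulcea (step_kernel X A P \<nu> \<pi>) (\<lambda>_. borel_on (X \<times> A))"
proof -
  let ?M = "borel_on (X \<times> A)"
  let ?H = "\<lambda>t. \<Pi>\<^sub>M s\<in>{0..<t}. ?M"
  have "step_kernel X A P \<nu> \<pi> t \<in> ?H t \<rightarrow>\<^sub>M prob_algebra ?M" for t
  proof -
    have state: "(\<lambda>h. case t of 0 \<Rightarrow> \<nu> | Suc s \<Rightarrow> P (h s)) \<in> ?H t \<rightarrow>\<^sub>M prob_algebra (borel_on X)"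
    proof (cases t)
      case 0
      then show ?thesis
        using assms(4) by (simp add: initial_distribution_def)
    next
      case (Suc s)
      have "(\<lambda>h. h s) \<in> ?H t \<rightarrow>\<^sub>M ?M"
        using Suc by (intro measurable_component_singleton) auto
      then have "(\<lambda>h. P (h s)) \<in> ?H t \<rightarrow>\<^sub>M prob_algebra (borel_on X)"
        using assms(3) unfolding stochastic_kernel_def by (rule measurable_compose)
      then show ?thesis
        using Suc by simp
    qed
    have pair: "(\<lambda>(hx, a). (snd hx, a)) \<in> (?H t \<Otimes>\<^sub>M borel_on X) \<Otimes>\<^sub>M borel_on A \<rightarrow>\<^sub>M ?M"
      unfolding measurable_cong_sets[OF refl sets_borel_on_Times[OF assms(1,2), symmetric]]
      by measurable
    have "(\<lambda>(h, x). \<pi> t h x) \<in> ?H t \<Otimes>\<^sub>M borel_on X \<rightarrow>\<^sub>M prob_algebra (borel_on A)"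
      using assms(5) by (simp add: policy_def)
    from measurable_distr_prob_space2[OF this, of "\<lambda>hx a. (snd hx, a)" ?M] pair
    have "(\<lambda>(h, x). distr (\<pi> t h x) ?M (\<lambda>a. (x, a))) \<in> ?H t \<Otimes>\<^sub>M borel_on X \<rightarrow>\<^sub>M prob_algebra ?M"
      by (simp add: case_prod_beta')
    from measurable_bind_prob_space2[OF state this] show ?thesis
      by (simp add: step_kernel_def[abs_def])
  qed
  note kernel = this
  show ?thesis
  proof (rule Ionescu_Tulcea.intro)
    show "step_kernel X A P \<nu> \<pi> t \<in> ?H t \<rightarrow>\<^sub>M subprob_algebra ?M" for t
      using kernel by (rule measurable_prob_algebraD)
    fix t :: nat and h :: "nat \<Rightarrow> 'x \<times> 'a"
    assume "h \<in> space (?H t)"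
    from measurable_space[OF kernel this] show "prob_space (step_kernel X A P \<nu> \<pi> t h)"
      by (simp add: space_prob_algebra)
  qed
qed

lemma emeasure_occupancy_measure:
  fixes X :: "'x::euclidean_space set" and A :: "'a::euclidean_space set"
  assumes "X \<in> sets borel" "A \<in> sets borel"
    and "stochastic_kernel X A P" "initial_distribution X \<nu>" "policy X A \<pi>"
    and E: "E \<in> sets (borel_on (X \<times> A))"
  shows "emeasure (occupancy_measure X A P \<gamma> \<nu> \<pi>) E =
    (\<Sum>t. ennreal (\<gamma> ^ t) * emeasure (trajectory_law X A P \<nu> \<pi>)
       {\<omega> \<in> space (trajectory_law X A P \<nu> \<pi>). \<omega> t \<in> E})"
proof -
  let ?M = "borel_on (X \<times> A)"
  let ?T = "trajectory_law X A P \<nu> \<pi>"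
  interpret IT: Ionescu_Tulcea "step_kernel X A P \<nu> \<pi>" "\<lambda>_. ?M"
    using assms(1-5) by (rule Ionescu_Tulcea_step_kernel)
  have sets_T: "sets ?T = sets (\<Pi>\<^sub>M t\<in>UNIV. ?M)"
    by (simp add: trajectory_law_def)
  have coord: "(\<lambda>\<omega>. \<omega> t) \<in> ?T \<rightarrow>\<^sub>M ?M" for t
    unfolding measurable_cong_sets[OF sets_T refl] by (rule measurable_component_singleton) simp
  let ?mu = "\<lambda>E. \<Sum>t. ennreal (\<gamma> ^ t) * emeasure ?T {\<omega> \<in> space ?T. \<omega> t \<in> E}"
  have eq: "?mu E = (\<Sum>t. ennreal (\<gamma> ^ t) * emeasure (distr ?T ?M (\<lambda>\<omega>. \<omega> t)) E)"
    if "E \<in> sets ?M" for E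
    using that by (simp add: emeasure_distr[OF coord] vimage_def Int_def conj_commute)
  have "countably_additive (sets ?M) ?mu"
  proof (rule countably_additiveI)
    fix F :: "nat \<Rightarrow> ('x \<times> 'a) set"
    assume F: "range F \<subseteq> sets ?M" "disjoint_family F" "(\<Union>i. F i) \<in> sets ?M"
    have "(\<Sum>i. ?mu (F i)) =
        (\<Sum>i. \<Sum>t. ennreal (\<gamma> ^ t) * emeasure (distr ?T ?M (\<lambda>\<omega>. \<omega> t)) (F i))"
      using F by (intro suminf_cong eq) auto
    also have "\<dots> = (\<Sum>t. \<Sum>i. ennreal (\<gamma> ^ t) * emeasure (distr ?T ?M (\<lambda>\<omega>. \<omega> t)) (F i))"
      using nn_integral_suminf[of "\<lambda>i t. ennreal (\<gamma> ^ t) * emeasure (distr ?T ?M (\<lambda>\<omega>. \<omega> t)) (F i)"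
          "count_space UNIV"]
      by (simp only: nn_integral_count_space_nat measurable_count_space_eq1) simp
    also have "\<dots> = (\<Sum>t. ennreal (\<gamma> ^ t) * emeasure (distr ?T ?M (\<lambda>\<omega>. \<omega> t)) (\<Union>i. F i))"
      using F by (intro suminf_cong) (simp add: suminf_emeasure)
    also have "\<dots> = ?mu (\<Union>i. F i)"
      by (rule eq[OF F(3), symmetric])
    finally show "(\<Sum>i. ?mu (F i)) = ?mu (\<Union>i. F i)" .
  qed
  moreover have "positive (sets ?M) ?mu"
    by (simp add: positive_def)
  moreover have "sigma_algebra (X \<times> A) (sets ?M)"
    using sets.sigma_algebra_axioms[of ?M] by (simp add: space_restrict_space)
  ultimately show ?thesis
    unfolding occupancy_measure_def
    using E by (intro emeasure_measure_of_sigma)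
qed

end

theory Submission
  imports Defs "HOL-Complex_Analysis.Great_Picard" "HOL-Real_Asymp.Real_Asymp"
begin

text \<open>
  In the decision variables \<open>(\<alpha>, \<beta>, e)\<close>, which form a Euclidean space of dimension \<open>d = n\<^sub>c + n\<^sub>u + 1\<close>,
  every sampled constraint is a half-space and all other constraints are convex. Let \<open>V\<close> be the
  probability that a fresh constraint excludes the computed optimizer. The scenario bound of Campi and
  Garatti (\<open>violation_prob_le\<close>) says that \<open>V > \<rho>\<close> has probability at most that of fewer than \<open>d\<close> successes
  in \<open>N\<close> trials with success probability \<open>\<rho>\<close>. Take \<open>\<rho> = g (\<epsilon> / L\<^sub>\<Lambda>)\<close>. If \<open>V \<le> \<rho>\<close>, then every ball of radius
  \<open>\<epsilon> / L\<^sub>\<Lambda>\<close> contains a point at which the constraint holds, and as the residual \<open>c - T\<^sub>\<gamma>\<^sup>* u\<close> is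
  \<open>L\<^sub>\<Lambda>\<close>-Lipschitz, it is at least \<open>- (e + \<epsilon>)\<close> everywhere.

  The scenario bound is proved by counting. In a sample of size \<open>N + K\<close>, consider all subsamples of size
  \<open>N\<close>. For nondegenerate programs every subsample has a unique smallest subset of at most \<open>d\<close> constraints
  with the same optimizer, and the subsamples with a given such basis form an interval in the inclusion
  order: they contain the basis and avoid the constraints that its optimizer violates. Programs may be
  degenerate here, and the tie-break is only known to have convex lower sets. Still, a generic
  perturbation of the constraints partitions the subsamples with a given optimizer into intervals with
  bottoms of size at most \<open>d\<close> and tops that avoid all violated constraints
  (\<open>empty_intersections_interval_partition\<close>). A dual certificate for the sizes of intervals
  (\<open>card_small_top_sets_le\<close>) then bounds the number of subsamples whose optimizer violates many constraints
  of the whole sample (\<open>card_violating_subsamples_le\<close>). Exchangeability turns this into a probability bound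
  (\<open>many_violated_prob_le\<close>). Hoeffding's inequality relates the number of violated constraints
  among the \<open>K\<close> remaining ones to \<open>V\<close> (\<open>many_violated_prob_ge\<close>), and \<open>K\<close> tends to infinity.

  For more than \<open>N\<close> constraints, the existence of an optimizer is not among the hypotheses. It follows from
  \<open>N > d\<close> (\<open>optimum_exists\<close>), which holds for every admissible \<open>N\<close> (\<open>sample_size_spec\<close>).
\<close>


section \<open>Convex sets and generic half-spaces\<close>

lemma independent_prescribe_inner:
  fixes w :: "'i \<Rightarrow> 'z::euclidean_space"
  assumes "inj_on w A" "independent (w ` A)"
  shows "\<exists>u. \<forall>i\<in>A. w i \<bullet> u = r i"
proof -
  obtain f where f: "linear f" "\<And>v. v \<in> w ` A \<Longrightarrow> f v = r (inv_into A w v)"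
    using linear_independent_extend[OF assms(2), of "\<lambda>v. r (inv_into A w v)"] by blast
  have "w i \<bullet> adjoint f 1 = r i" if "i \<in> A" for i
    using f that assms(1) by (simp add: adjoint_works)
  then show ?thesis by blast
qed

lemma dependent_family_relation:
  fixes w :: "'i \<Rightarrow> 'z::euclidean_space"
  assumes "finite A" and dep: "\<not> (inj_on w A \<and> independent (w ` A))"
  shows "\<exists>\<mu>. (\<exists>i\<in>A. \<mu> i \<noteq> 0) \<and> (\<Sum>i\<in>A. \<mu> i *\<^sub>R w i) = 0"
proof (cases "inj_on w A")
  case False
  then obtain i j where ij: "i \<in> A" "j \<in> A" "i \<noteq> j" "w i = w j"
    by (auto simp: inj_on_def)
  let ?\<mu> = "\<lambda>k. if k = i then 1 else if k = j then - 1 else 0 :: real"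
  have "(\<Sum>k\<in>A. ?\<mu> k *\<^sub>R w k) = (\<Sum>k\<in>{i, j}. ?\<mu> k *\<^sub>R w k)"
    using assms(1) ij by (intro sum.mono_neutral_right) auto
  also have "\<dots> = 0" using ij by simp
  finally show ?thesis using ij by (intro exI[of _ ?\<mu>]) auto
next
  case True
  then have "dependent (w ` A)" using dep by simp
  then obtain c where c: "(\<Sum>v\<in>w ` A. c v *\<^sub>R v) = 0" "\<exists>v\<in>w ` A. c v \<noteq> 0"
    using assms(1) by (auto simp: dependent_finite)
  then show ?thesis
    using True by (intro exI[of _ "\<lambda>i. c (w i)"]) (auto simp: sum.reindex)
qed

text \<open>
  Relaxing the \<open>i\<close>-th inequality by \<open>s ^ Suc (n i)\<close> with distinct exponents makes the inequalities
  generic for all but finitely many \<open>s\<close>: a linear relation between the normals of inequalities that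
  are tight at a common point would make \<open>s\<close> a root of a nonzero polynomial.
\<close>

lemma generic_relaxation:
  fixes w :: "'i \<Rightarrow> 'z::euclidean_space" and b :: "'i \<Rightarrow> real"
  assumes "finite F" and "\<tau> > 0"
  obtains \<eta> where "\<And>i. i \<in> F \<Longrightarrow> 0 < \<eta> i \<and> \<eta> i \<le> \<tau>"
    and "\<And>A q. A \<subseteq> F \<Longrightarrow> (\<And>i. i \<in> A \<Longrightarrow> w i \<bullet> q + (b i + \<eta> i) = 0)
          \<Longrightarrow> inj_on w A \<and> independent (w ` A)"
proof -
  obtain n :: "'i \<Rightarrow> nat" where n: "inj_on n F"
    using assms(1) by (metis finite_imp_inj_to_nat_seg)
  let ?dep = "{A. A \<subseteq> F \<and> \<not> (inj_on w A \<and> independent (w ` A))}"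
  have "\<forall>A\<in>?dep. \<exists>\<mu>. (\<exists>i\<in>A. \<mu> i \<noteq> 0) \<and> (\<Sum>i\<in>A. \<mu> i *\<^sub>R w i) = 0"
    using assms(1) by (auto intro!: dependent_family_relation dest: finite_subset)
  then obtain \<mu> where \<mu>: "\<And>A. A \<in> ?dep \<Longrightarrow> (\<exists>i\<in>A. \<mu> A i \<noteq> 0) \<and> (\<Sum>i\<in>A. \<mu> A i *\<^sub>R w i) = 0"
    using bchoice[of ?dep "\<lambda>A \<mu>. (\<exists>i\<in>A. \<mu> i \<noteq> 0) \<and> (\<Sum>i\<in>A. \<mu> i *\<^sub>R w i) = 0"] by blast
  define P where "P A = [:\<Sum>i\<in>A. \<mu> A i * b i:] + (\<Sum>i\<in>A. monom (\<mu> A i) (Suc (n i)))" for A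
  have P0: "P A \<noteq> 0" if A: "A \<in> ?dep" for A
  proof -
    obtain i where i: "i \<in> A" "\<mu> A i \<noteq> 0" using \<mu>[OF A] by blast
    have fin: "finite A" using A assms(1) by (auto dest: finite_subset)
    have "j = i" if "j \<in> A" "n j = n i" for j
      using inj_onD[OF n that(2)] that(1) A i(1) by blast
    then have "(\<Sum>j\<in>A. coeff (monom (\<mu> A j) (Suc (n j))) (Suc (n i))) = (\<Sum>j\<in>A. if j = i then \<mu> A j else 0)"
      by (intro sum.cong) auto
    then have "coeff (P A) (Suc (n i)) = (\<Sum>j\<in>A. if j = i then \<mu> A j else 0)"
      by (simp add: P_def coeff_sum)
    also have "\<dots> = \<mu> A i" using i fin by simp
    finally show ?thesis using i by auto
  qed
  have fin: "finite (\<Union>A\<in>?dep. {s. poly (P A) s = 0})"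
    using assms(1) P0 by (intro finite_UN_I) (auto simp: poly_roots_finite)
  have "infinite {0<..<min 1 \<tau>}"
    using assms(2) by (intro infinite_Ioo) auto
  then obtain s where s: "s \<in> {0<..<min 1 \<tau>}" "s \<notin> (\<Union>A\<in>?dep. {s. poly (P A) s = 0})"
    using fin by (meson finite_subset subsetI)
  show ?thesis
  proof (rule that[of "\<lambda>i. s ^ Suc (n i)"])
    fix i assume "i \<in> F"
    have "s ^ n i \<le> 1" using s by (intro power_le_one) auto
    then have "s ^ Suc (n i) \<le> s" using s by (simp add: mult_left_le)
    moreover have "0 < s" "s \<le> \<tau>" using s by auto
    ultimately show "0 < s ^ Suc (n i) \<and> s ^ Suc (n i) \<le> \<tau>"
      by (meson order_trans zero_less_power)
  next
    fix A q assume A: "A \<subseteq> F" and tight: "\<And>i. i \<in> A \<Longrightarrow> w i \<bullet> q + (b i + s ^ Suc (n i)) = 0"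
    show "inj_on w A \<and> independent (w ` A)"
    proof (rule ccontr)
      assume "\<not> ?thesis"
      then have dep: "A \<in> ?dep" using A by blast
      have "0 = (\<Sum>i\<in>A. \<mu> A i * (w i \<bullet> q + (b i + s ^ Suc (n i))))"
        using tight by simp
      also have "\<dots> = (\<Sum>i\<in>A. \<mu> A i *\<^sub>R w i) \<bullet> q + poly (P A) s"
        by (simp add: P_def inner_sum_left poly_sum poly_monom sum.distrib distrib_left)
      also have "\<dots> = poly (P A) s" using \<mu>[OF dep] by simp
      finally show False using s(2) dep by auto
    qed
  qed
qed

text \<open>
  Convex functions between two quadratics, with \<open>grad\<close> the gradient. Only these inequalities are used,
  so no notion of derivative is needed.
\<close>

locale smooth_strongly_convex =
  fixes \<phi> :: "'z::euclidean_space \<Rightarrow> real" and grad :: "'z \<Rightarrow> 'z" and \<kappa> \<Lambda> :: real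
  assumes \<kappa>_pos: "\<kappa> > 0"
    and below: "\<And>q h. \<phi> q + grad q \<bullet> h + \<kappa> * (norm h)\<^sup>2 \<le> \<phi> (q + h)"
    and above: "\<And>q h. \<phi> (q + h) \<le> \<phi> q + grad q \<bullet> h + \<Lambda> * (norm h)\<^sup>2"
    and coercive: "\<And>q. \<kappa> * (norm q)\<^sup>2 \<le> \<phi> q"
begin

text \<open>
  Minimality on a convex set \<open>Y\<close>, expressed by the first-order condition. In this form it passes
  between sets \<open>Y\<close> that look alike near \<open>q\<close>.
\<close>

definition minimizes_on :: "'z set \<Rightarrow> 'z \<Rightarrow> bool" where
  "minimizes_on Y q \<longleftrightarrow> q \<in> Y \<and> (\<forall>y\<in>Y. 0 \<le> grad q \<bullet> (y - q))"

lemma minimizes_on_le: "minimizes_on Y q \<Longrightarrow> y \<in> Y \<Longrightarrow> \<phi> q + \<kappa> * (norm (y - q))\<^sup>2 \<le> \<phi> y"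
  using below[of q "y - q"] by (fastforce simp: minimizes_on_def)

lemma minimizes_on_unique:
  assumes "minimizes_on Y q" "minimizes_on Y q'"
  shows "q = q'"
proof -
  have "q \<in> Y" "q' \<in> Y" using assms by (auto simp: minimizes_on_def)
  with assms have "\<phi> q + \<kappa> * (norm (q' - q))\<^sup>2 \<le> \<phi> q'" "\<phi> q' + \<kappa> * (norm (q - q'))\<^sup>2 \<le> \<phi> q"
    by (auto intro: minimizes_on_le)
  then have "\<kappa> * (norm (q - q'))\<^sup>2 \<le> 0"
    using zero_le_mult_iff[of \<kappa> "(norm (q - q'))\<^sup>2"] \<kappa>_pos by (auto simp: norm_minus_commute)
  then show ?thesis using \<kappa>_pos by (auto simp: mult_le_0_iff)
qed

lemma continuous: "continuous_on UNIV \<phi>"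
proof (rule continuous_at_imp_continuous_on, rule ballI)
  fix q
  have *: "((\<lambda>y. \<phi> q + grad q \<bullet> (y - q) + c * (norm (y - q))\<^sup>2) \<longlongrightarrow> \<phi> q) (at q)" for c
    by (auto intro!: tendsto_eq_intros)
  show "isCont \<phi> q"
    unfolding isCont_def
  proof (rule tendsto_sandwich[OF _ _ *[of \<kappa>] *[of \<Lambda>]])
    show "\<forall>\<^sub>F y in at q. \<phi> q + grad q \<bullet> (y - q) + \<kappa> * (norm (y - q))\<^sup>2 \<le> \<phi> y"
      using below[of q "y - q" for y] by (intro always_eventually) simp
    show "\<forall>\<^sub>F y in at q. \<phi> y \<le> \<phi> q + grad q \<bullet> (y - q) + \<Lambda> * (norm (y - q))\<^sup>2"
      using above[of q "y - q" for y] by (intro always_eventually) simp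
  qed
qed

lemma minimizes_on_ex:
  assumes "closed Y" "convex Y" "Y \<noteq> {}"
  shows "\<exists>q. minimizes_on Y q"
proof -
  obtain y0 where y0: "y0 \<in> Y" using assms(3) by blast
  \<comment> \<open>By coercivity, the sublevel set of \<open>y0\<close> lies in the ball of radius \<open>R\<close>.\<close>
  define R where "R = sqrt (\<phi> y0 / \<kappa>)"
  have "compact (Y \<inter> cball 0 R)" using assms(1) by (intro closed_Int_compact) auto
  have inR: "y \<in> cball 0 R" if "\<phi> y \<le> \<phi> y0" for y
  proof -
    have "\<kappa> * (norm y)\<^sup>2 \<le> \<phi> y0" using coercive[of y] that by linarith
    then have "(norm y)\<^sup>2 \<le> \<phi> y0 / \<kappa>" using \<kappa>_pos by (simp add: field_simps)
    then have "norm y \<le> R" unfolding R_def by (rule real_le_rsqrt)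
    then show ?thesis by simp
  qed
  have ne: "Y \<inter> cball 0 R \<noteq> {}" using y0 inR[of y0] by blast
  obtain q where q: "q \<in> Y \<inter> cball 0 R" "\<And>y. y \<in> Y \<inter> cball 0 R \<Longrightarrow> \<phi> q \<le> \<phi> y"
    using continuous_attains_inf[OF \<open>compact (Y \<inter> cball 0 R)\<close> ne
        continuous_on_subset[OF continuous subset_UNIV]] by blast
  have min: "\<phi> q \<le> \<phi> y" if "y \<in> Y" for y
  proof (cases "\<phi> y \<le> \<phi> y0")
    case True then show ?thesis using q(2)[of y] that inR by blast
  next
    case False
    moreover have "\<phi> q \<le> \<phi> y0" using q(2)[of y0] y0 inR[of y0] by blast
    ultimately show ?thesis by linarith
  qed
  have "0 \<le> grad q \<bullet> (y - q)" if y: "y \<in> Y" for y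
  proof (rule ccontr)
    define h where "h = y - q"
    assume neg: "\<not> 0 \<le> grad q \<bullet> (y - q)"
    have step: "0 \<le> grad q \<bullet> h + t * (\<Lambda> * (norm h)\<^sup>2)" if t: "t \<in> {0<..<1}" for t
    proof -
      have "q + t *\<^sub>R h = (1 - t) *\<^sub>R q + t *\<^sub>R y" by (simp add: h_def algebra_simps)
      then have "q + t *\<^sub>R h \<in> Y"
        using assms(2) q(1) y t by (auto simp: convex_alt)
      then have "\<phi> q \<le> \<phi> (q + t *\<^sub>R h)" by (rule min)
      also have "\<dots> \<le> \<phi> q + t * (grad q \<bullet> h + t * (\<Lambda> * (norm h)\<^sup>2))"
        using above[of q "t *\<^sub>R h"] by (simp add: power2_eq_square distrib_left mult_ac)
      finally show ?thesis using t by (simp add: zero_le_mult_iff)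
    qed
    have "((\<lambda>t. grad q \<bullet> h + t * (\<Lambda> * (norm h)\<^sup>2)) \<longlongrightarrow> grad q \<bullet> h + 0 * (\<Lambda> * (norm h)\<^sup>2)) (at_right 0)"
      by (intro tendsto_intros)
    moreover have "\<forall>\<^sub>F t in at_right 0. 0 \<le> grad q \<bullet> h + t * (\<Lambda> * (norm h)\<^sup>2)"
      unfolding eventually_at_right_field by (rule exI[of _ 1]) (use step in auto)
    ultimately have "0 \<le> grad q \<bullet> h + 0 * (\<Lambda> * (norm h)\<^sup>2)"
      by (rule tendsto_lowerbound) simp
    with neg show False by (simp add: h_def)
  qed
  then show ?thesis using q(1) by (auto simp: minimizes_on_def)
qed

end

text \<open>
  The polyhedron cut out by the inequalities \<open>0 \<le> w i \<bullet> q + b i\<close> with index in \<open>S\<close>.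
\<close>

definition halfspaces :: "('i \<Rightarrow> 'z::real_inner) \<Rightarrow> ('i \<Rightarrow> real) \<Rightarrow> 'i set \<Rightarrow> 'z set" where
  "halfspaces w b S = {q. \<forall>i\<in>S. 0 \<le> w i \<bullet> q + b i}"

lemma closed_halfspaces: "closed (halfspaces w b S)"
proof -
  have "halfspaces w b S = (\<Inter>i\<in>S. {q. 0 \<le> w i \<bullet> q + b i})"
    by (auto simp: halfspaces_def)
  moreover have "closed {q. 0 \<le> w i \<bullet> q + b i}" for i
    by (intro closed_Collect_le continuous_intros)
  ultimately show ?thesis by auto
qed

lemma convex_halfspaces: "convex (halfspaces w b S)"
proof (rule convexI)
  fix x y and u v :: real
  assume *: "x \<in> halfspaces w b S" "y \<in> halfspaces w b S" "0 \<le> u" "0 \<le> v" "u + v = 1"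
  have "0 \<le> w i \<bullet> (u *\<^sub>R x + v *\<^sub>R y) + b i" if "i \<in> S" for i
  proof -
    have "w i \<bullet> (u *\<^sub>R x + v *\<^sub>R y) + b i = u * (w i \<bullet> x + b i) + v * (w i \<bullet> y + b i) + (1 - (u + v)) * b i"
      by (simp add: algebra_simps)
    also have "\<dots> \<ge> 0" using * that by (simp add: halfspaces_def)
    finally show ?thesis .
  qed
  then show "u *\<^sub>R x + v *\<^sub>R y \<in> halfspaces w b S" by (simp add: halfspaces_def)
qed

text \<open>
  For generic inequalities, the index sets whose polyhedron is minimized at a given point \<open>q\<close> form an
  interval in the inclusion order. They are closed under supersets that \<open>q\<close> satisfies, they do not
  depend on the inequalities that are slack at \<open>q\<close>, and since the normals of the tight ones are linearly
  independent, they are closed under intersection. The least such set consists of tight inequalities,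
  hence has at most as many elements as the dimension.
\<close>

lemma (in smooth_strongly_convex) minimizing_sets_interval:
  fixes w :: "'i \<Rightarrow> 'z" and b :: "'i \<Rightarrow> real"
  assumes "finite F"
    and generic: "\<And>A q. A \<subseteq> F \<Longrightarrow> (\<And>i. i \<in> A \<Longrightarrow> w i \<bullet> q + b i = 0)
          \<Longrightarrow> inj_on w A \<and> independent (w ` A)"
    and "S0 \<subseteq> F" "minimizes_on (halfspaces w b S0) q"
  shows "\<exists>B C. B \<subseteq> S0 \<and> S0 \<subseteq> C \<and> C \<subseteq> F \<and> card B \<le> DIM('z) \<and>
    {S. S \<subseteq> F \<and> minimizes_on (halfspaces w b S) q} = {S. B \<subseteq> S \<and> S \<subseteq> C}"
proof -
  define T where "T = {i\<in>F. w i \<bullet> q + b i = 0}"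
  define C where "C = {i\<in>F. 0 \<le> w i \<bullet> q + b i}"
  define \<S> where "\<S> = {S. S \<subseteq> F \<and> minimizes_on (halfspaces w b S) q}"
  have finS: "finite \<S>" using assms(1) by (auto simp: \<S>_def)
  have "inj_on w T \<and> independent (w ` T)"
    by (rule generic) (auto simp: T_def)
  then have T: "inj_on w T" "independent (w ` T)" by auto
  have sub_C: "S \<subseteq> C" if "S \<in> \<S>" for S
    using that by (auto simp: \<S>_def C_def minimizes_on_def halfspaces_def)
  \<comment> \<open>Directions that respect the tight inequalities are feasible for a short time.\<close>
  have cone: "0 \<le> grad q \<bullet> v" if S: "S \<in> \<S>" and v: "\<And>i. i \<in> S \<inter> T \<Longrightarrow> 0 \<le> w i \<bullet> v" for S v
  proof -
    have "\<exists>t>0. \<forall>i\<in>S. 0 \<le> w i \<bullet> (q + t *\<^sub>R v) + b i"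
    proof -
      have "\<forall>\<^sub>F t in at_right 0. 0 \<le> w i \<bullet> (q + t *\<^sub>R v) + b i" if i: "i \<in> S" for i
      proof (cases "i \<in> T")
        case True
        then have "w i \<bullet> (q + t *\<^sub>R v) + b i = t * (w i \<bullet> v)" for t
          by (simp add: T_def algebra_simps)
        then show ?thesis
          using v[of i] True i unfolding eventually_at_right_field
          by (auto intro!: exI[of _ 1])
      next
        case False
        have "i \<in> C" using sub_C[OF S] i by blast
        with False have "0 < w i \<bullet> q + b i" by (auto simp: T_def C_def)
        moreover have "((\<lambda>t. w i \<bullet> (q + t *\<^sub>R v) + b i) \<longlongrightarrow> w i \<bullet> (q + 0 *\<^sub>R v) + b i) (at_right 0)"
          by (intro tendsto_intros)
        ultimately have "\<forall>\<^sub>F t in at_right 0. 0 < w i \<bullet> (q + t *\<^sub>R v) + b i"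
          by (auto dest: order_tendstoD(1))
        then show ?thesis by eventually_elim simp
      qed
      moreover have "finite S" using S assms(1) by (auto simp: \<S>_def dest: finite_subset)
      ultimately have "\<forall>\<^sub>F t in at_right 0. \<forall>i\<in>S. 0 \<le> w i \<bullet> (q + t *\<^sub>R v) + b i"
        by (simp add: eventually_ball_finite)
      moreover have "\<forall>\<^sub>F t :: real in at_right 0. 0 < t"
        by (simp add: eventually_at_right_less)
      ultimately have "\<forall>\<^sub>F t in at_right 0. 0 < t \<and> (\<forall>i\<in>S. 0 \<le> w i \<bullet> (q + t *\<^sub>R v) + b i)"
        by eventually_elim simp
      from eventually_happens[OF this] show ?thesis by auto
    qed
    then obtain t where t: "t > 0" "q + t *\<^sub>R v \<in> halfspaces w b S"
      by (auto simp: halfspaces_def)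
    then have "0 \<le> grad q \<bullet> (t *\<^sub>R v)"
      using S by (fastforce simp: \<S>_def minimizes_on_def)
    then show ?thesis using t by (simp add: zero_le_mult_iff)
  qed
  have memI: "S \<in> \<S>" if "S \<subseteq> C" and "\<And>v. (\<And>i. i \<in> S \<inter> T \<Longrightarrow> 0 \<le> w i \<bullet> v) \<Longrightarrow> 0 \<le> grad q \<bullet> v" for S
  proof -
    have "0 \<le> grad q \<bullet> (y - q)" if y: "y \<in> halfspaces w b S" for y
    proof (rule \<open>\<And>v. (\<And>i. i \<in> S \<inter> T \<Longrightarrow> 0 \<le> w i \<bullet> v) \<Longrightarrow> 0 \<le> grad q \<bullet> v\<close>)
      fix i assume "i \<in> S \<inter> T"
      then have "0 \<le> w i \<bullet> y + b i" "w i \<bullet> q + b i = 0" using y by (auto simp: halfspaces_def T_def)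
      then show "0 \<le> w i \<bullet> (y - q)" by (simp add: inner_diff_right)
    qed
    then show ?thesis using that(1) by (auto simp: \<S>_def C_def minimizes_on_def halfspaces_def)
  qed
  have inter: "S1 \<inter> S2 \<in> \<S>" if S: "S1 \<in> \<S>" "S2 \<in> \<S>" for S1 S2
  proof (rule memI)
    show "S1 \<inter> S2 \<subseteq> C" using sub_C[OF S(1)] by blast
    fix v assume v: "\<And>i. i \<in> S1 \<inter> S2 \<inter> T \<Longrightarrow> 0 \<le> w i \<bullet> v"
    \<comment> \<open>Split \<open>v = (v + u) + (- u)\<close> with \<open>v + u\<close> feasible for \<open>S1\<close> and \<open>- u\<close> feasible for \<open>S2\<close>;
      this is possible by linear independence.\<close>
    obtain u where u: "\<And>i. i \<in> T \<Longrightarrow> w i \<bullet> u = (if i \<in> S2 then 0 else - (w i \<bullet> v))"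
      using independent_prescribe_inner[OF T, of "\<lambda>i. if i \<in> S2 then 0 else - (w i \<bullet> v)"] by blast
    have "0 \<le> grad q \<bullet> (v + u)"
      using v u by (intro cone[OF S(1)]) (auto simp: inner_add_right)
    moreover have "0 \<le> grad q \<bullet> (- u)"
      using u by (intro cone[OF S(2)]) auto
    ultimately show "0 \<le> grad q \<bullet> v" by (simp add: inner_add_right)
  qed
  have S0: "S0 \<in> \<S>" using assms by (simp add: \<S>_def)
  define B where "B = \<Inter>\<S>"
  have B: "B \<in> \<S>"
  proof -
    have "\<Inter>\<T> \<in> \<S>" if "finite \<T>" "\<T> \<noteq> {}" "\<T> \<subseteq> \<S>" for \<T>
      using that by (induction rule: finite_ne_induct) (auto intro: inter)
    then show ?thesis using finS S0 by (auto simp: B_def)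
  qed
  have "B \<inter> T \<in> \<S>"
    by (rule memI) (use sub_C[OF B] cone[OF B] in auto)
  then have "B \<subseteq> T" by (auto simp: B_def)
  have "card B \<le> DIM('z)"
  proof -
    have "finite T" using assms(1) by (simp add: T_def)
    then have "card B \<le> card T" using \<open>B \<subseteq> T\<close> by (rule card_mono)
    also have "\<dots> = card (w ` T)" using T(1) by (simp add: card_image)
    also have "\<dots> \<le> DIM('z)" using T(2) independent_bound by blast
    finally show ?thesis .
  qed
  moreover have "\<S> = {S. B \<subseteq> S \<and> S \<subseteq> C}"
  proof (intro equalityI subsetI CollectI conjI)
    fix S assume "S \<in> {S. B \<subseteq> S \<and> S \<subseteq> C}"
    then show "S \<in> \<S>" using cone[OF B] by (intro memI) auto
  qed (use sub_C in \<open>auto simp: B_def\<close>)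
  ultimately show ?thesis
    using S0 sub_C by (intro exI[of _ B] exI[of _ C]) (auto simp: B_def \<S>_def C_def)
qed

text \<open>
  A hyperplane strictly separates the hull of \<open>W\<close> from each member of the family; normalized, its affine
  function is at most 0 on \<open>W\<close> and at least 1 on that member. The sum of the squared positive parts plus
  a small multiple of the squared norm is the required function.
\<close>

lemma separating_strongly_convex:
  fixes W :: "'z::euclidean_space set" and \<Y> :: "'z set set"
  assumes "finite W" "W \<noteq> {}" "finite \<Y>"
    and Y: "\<And>Y. Y \<in> \<Y> \<Longrightarrow> closed Y \<and> convex Y \<and> convex hull W \<inter> Y = {}"
  obtains \<phi> grad \<kappa> \<Lambda> where "smooth_strongly_convex \<phi> grad \<kappa> \<Lambda>"
    and "\<And>p. p \<in> W \<Longrightarrow> \<phi> p < 1" and "\<And>Y y. Y \<in> \<Y> \<Longrightarrow> y \<in> Y \<Longrightarrow> 1 \<le> \<phi> y"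
proof -
  have "\<exists>a c. (\<forall>p\<in>W. a \<bullet> p \<le> c) \<and> (\<forall>y\<in>Y. c + 1 \<le> a \<bullet> y)" if Y_in: "Y \<in> \<Y>" for Y
  proof -
    obtain a b where ab: "\<And>x. x \<in> convex hull W \<Longrightarrow> a \<bullet> x < b" "\<And>y. y \<in> Y \<Longrightarrow> b < a \<bullet> y"
      using separating_hyperplane_compact_closed[of "convex hull W" Y] Y[OF Y_in] assms(1,2)
      by (auto simp: finite_imp_compact_convex_hull)
    define m where "m = Max ((\<lambda>p. a \<bullet> p) ` W)"
    have "m \<in> (\<lambda>p. a \<bullet> p) ` W" unfolding m_def using assms by (intro Max_in) auto
    then have mb: "m < b" using ab(1) hull_inc[of _ W] by auto
    have "a \<bullet> p \<le> m" if "p \<in> W" for p unfolding m_def using assms that by auto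
    then have "\<forall>p\<in>W. (a \<bullet> p) / (b - m) \<le> m / (b - m)"
      using mb by (auto intro!: divide_right_mono)
    then have "\<forall>p\<in>W. (a /\<^sub>R (b - m)) \<bullet> p \<le> m / (b - m)"
      by (simp add: divide_inverse_commute)
    moreover have "\<forall>y\<in>Y. m / (b - m) + 1 \<le> (a /\<^sub>R (b - m)) \<bullet> y"
    proof
      fix y assume "y \<in> Y"
      have "m / (b - m) + 1 = b / (b - m)" using mb by (simp add: field_simps)
      also have "\<dots> \<le> (a \<bullet> y) / (b - m)" using ab(2)[OF \<open>y \<in> Y\<close>] mb by (intro divide_right_mono) auto
      finally show "m / (b - m) + 1 \<le> (a /\<^sub>R (b - m)) \<bullet> y" by (simp add: field_simps)
    qed
    ultimately show ?thesis by blast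
  qed
  then obtain a c where ac: "\<And>Y p. Y \<in> \<Y> \<Longrightarrow> p \<in> W \<Longrightarrow> a Y \<bullet> p \<le> c Y"
      "\<And>Y y. Y \<in> \<Y> \<Longrightarrow> y \<in> Y \<Longrightarrow> c Y + 1 \<le> a Y \<bullet> y"
    by metis
  obtain R where R: "\<And>p. p \<in> W \<Longrightarrow> norm p \<le> R"
    using finite_imp_bounded[OF assms(1)] by (auto simp: bounded_iff)
  define \<kappa> where "\<kappa> = 1 / (1 + R\<^sup>2)"
  define pos where "pos x = max 0 x" for x :: real
  define \<phi> where "\<phi> q = (\<Sum>Y\<in>\<Y>. (pos (a Y \<bullet> q - c Y))\<^sup>2) + \<kappa> * (norm q)\<^sup>2" for q
  define grad where "grad q = (\<Sum>Y\<in>\<Y>. (2 * pos (a Y \<bullet> q - c Y)) *\<^sub>R a Y) + (2 * \<kappa>) *\<^sub>R q" for q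
  define \<Lambda> where "\<Lambda> = (\<Sum>Y\<in>\<Y>. (norm (a Y))\<^sup>2) + \<kappa>"
  have \<kappa>: "\<kappa> > 0" by (auto simp: \<kappa>_def intro!: divide_pos_pos add_pos_nonneg)
  have pos_below: "(pos x)\<^sup>2 + 2 * pos x * t \<le> (pos (x + t))\<^sup>2" for x t
  proof (cases "x \<le> 0")
    case False
    have "0 \<le> (pos (x + t))\<^sup>2 - x\<^sup>2 - 2 * x * t"
    proof (cases "x + t \<ge> 0")
      case True
      then have "(pos (x + t))\<^sup>2 - x\<^sup>2 - 2 * x * t = t\<^sup>2"
        by (simp add: pos_def power2_eq_square algebra_simps)
      then show ?thesis by simp
    next
      case F: False
      then have "x * (- x - 2 * t) \<ge> 0" using False by (intro mult_nonneg_nonneg) auto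
      then show ?thesis using F by (simp add: pos_def power2_eq_square algebra_simps)
    qed
    then show ?thesis using False by (simp add: pos_def)
  qed (simp add: pos_def)
  have pos_above: "(pos (x + t))\<^sup>2 \<le> (pos x)\<^sup>2 + 2 * pos x * t + t\<^sup>2" for x t
  proof -
    have "(pos x)\<^sup>2 + 2 * pos x * t + t\<^sup>2 = (pos x + t)\<^sup>2"
      by (simp add: power2_eq_square algebra_simps)
    moreover have "\<bar>pos (x + t)\<bar> \<le> \<bar>pos x + t\<bar>" by (auto simp: pos_def)
    then have "(pos (x + t))\<^sup>2 \<le> (pos x + t)\<^sup>2" by (rule abs_le_square_iff[THEN iffD1])
    ultimately show ?thesis by simp
  qed
  have norm_expand: "(norm (q + h))\<^sup>2 = (norm q)\<^sup>2 + 2 * (q \<bullet> h) + (norm h)\<^sup>2" for q h :: 'z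
    unfolding power2_norm_eq_inner by (simp add: inner_add inner_commute)
  have grad_inner: "grad q \<bullet> h = (\<Sum>Y\<in>\<Y>. 2 * pos (a Y \<bullet> q - c Y) * (a Y \<bullet> h)) + \<kappa> * (2 * (q \<bullet> h))" for q h
    by (simp add: grad_def inner_add_left inner_sum_left)
  have shift: "a Y \<bullet> (q + h) - c Y = (a Y \<bullet> q - c Y) + a Y \<bullet> h" for Y q h
    by (simp add: inner_add_right)
  show ?thesis
  proof (rule that[of \<phi> grad \<kappa> \<Lambda>])
    show "smooth_strongly_convex \<phi> grad \<kappa> \<Lambda>"
    proof
      show "\<kappa> > 0" by (rule \<kappa>)
      fix q h
      have "\<phi> q + grad q \<bullet> h + \<kappa> * (norm h)\<^sup>2 =
          (\<Sum>Y\<in>\<Y>. (pos (a Y \<bullet> q - c Y))\<^sup>2 + 2 * pos (a Y \<bullet> q - c Y) * (a Y \<bullet> h)) + \<kappa> * (norm (q + h))\<^sup>2"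
        unfolding \<phi>_def grad_inner sum.distrib norm_expand by (simp add: algebra_simps)
      also have "\<dots> \<le> \<phi> (q + h)"
        unfolding \<phi>_def shift by (intro add_right_mono sum_mono pos_below)
      finally show "\<phi> q + grad q \<bullet> h + \<kappa> * (norm h)\<^sup>2 \<le> \<phi> (q + h)" .
      have "\<phi> (q + h) \<le> (\<Sum>Y\<in>\<Y>. (pos (a Y \<bullet> q - c Y))\<^sup>2 + 2 * pos (a Y \<bullet> q - c Y) * (a Y \<bullet> h)
          + (norm (a Y) * norm h)\<^sup>2) + \<kappa> * (norm (q + h))\<^sup>2"
        unfolding \<phi>_def shift
      proof (intro add_right_mono sum_mono order_trans[OF pos_above] add_left_mono)
        fix Y
        show "(a Y \<bullet> h)\<^sup>2 \<le> (norm (a Y) * norm h)\<^sup>2"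
          using Cauchy_Schwarz_ineq2[of "a Y" h] by (intro power2_le_iff_abs_le[THEN iffD2]) auto
      qed
      also have "\<dots> = \<phi> q + grad q \<bullet> h + \<Lambda> * (norm h)\<^sup>2"
        unfolding \<phi>_def grad_inner sum.distrib norm_expand \<Lambda>_def power_mult_distrib
        by (simp add: algebra_simps sum_distrib_left)
      finally show "\<phi> (q + h) \<le> \<phi> q + grad q \<bullet> h + \<Lambda> * (norm h)\<^sup>2" .
      show "\<kappa> * (norm q)\<^sup>2 \<le> \<phi> q"
        by (simp add: \<phi>_def sum_nonneg)
    qed
    show "\<phi> p < 1" if p: "p \<in> W" for p
    proof -
      have "(\<Sum>Y\<in>\<Y>. (pos (a Y \<bullet> p - c Y))\<^sup>2) = 0"
        using ac(1)[OF _ p] by (intro sum.neutral) (auto simp: pos_def)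
      moreover have "(norm p)\<^sup>2 \<le> R\<^sup>2" using R[OF p] by (intro power_mono) auto
      then have "(norm p)\<^sup>2 < 1 + R\<^sup>2" by simp
      then have "\<kappa> * (norm p)\<^sup>2 < 1"
        unfolding \<kappa>_def by (simp add: field_simps add_pos_nonneg)
      ultimately show ?thesis by (simp add: \<phi>_def)
    qed
    show "1 \<le> \<phi> y" if "Y \<in> \<Y>" "y \<in> Y" for Y y
    proof -
      have "1 \<le> pos (a Y \<bullet> y - c Y)" using ac(2)[OF that] by (simp add: pos_def)
      then have "1 \<le> (pos (a Y \<bullet> y - c Y))\<^sup>2" by (simp add: one_le_power)
      also have "\<dots> \<le> (\<Sum>Y\<in>\<Y>. (pos (a Y \<bullet> y - c Y))\<^sup>2)"
        using assms(3) that(1) by (intro member_le_sum) auto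
      also have "\<dots> \<le> \<phi> y" using \<kappa> by (simp add: \<phi>_def)
      finally show ?thesis .
    qed
  qed
qed

text \<open>
  By compactness, finitely many polyhedra that are disjoint from \<open>K\<close> stay so after a small relaxation.
\<close>

lemma uniform_relaxation:
  fixes w :: "'i \<Rightarrow> 'z::euclidean_space" and K :: "'z set"
  assumes "compact K" "finite \<T>" and disj: "\<And>S. S \<in> \<T> \<Longrightarrow> K \<inter> halfspaces w b S = {}"
  obtains \<tau> where "\<tau> > 0" "\<And>S. S \<in> \<T> \<Longrightarrow> K \<inter> halfspaces w (\<lambda>i. b i + \<tau>) S = {}"
proof -
  define U where "U S n = (\<Union>i\<in>S. {q. w i \<bullet> q + b i + 1 / Suc n < 0})" for S and n :: nat
  have openU: "open (U S n)" for S n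
    unfolding U_def by (intro open_UN ballI open_Collect_less continuous_intros)
  have U_mono: "U S m \<subseteq> U S n" if "m \<le> n" for S m n
  proof
    fix q assume "q \<in> U S m"
    then obtain i where i: "i \<in> S" "w i \<bullet> q + b i + 1 / Suc m < 0" by (auto simp: U_def)
    have "1 / real (Suc n) \<le> 1 / real (Suc m)" using that by (intro divide_left_mono) auto
    with i show "q \<in> U S n" by (auto simp: U_def intro!: bexI[of _ i])
  qed
  have "\<exists>n. K \<subseteq> U S n" if S: "S \<in> \<T>" for S
  proof -
    have "K \<subseteq> (\<Union>n. U S n)"
    proof
      fix q assume "q \<in> K"
      then obtain i where i: "i \<in> S" "w i \<bullet> q + b i < 0"
        using disj[OF S] by (force simp: halfspaces_def)
      then obtain n where "1 / real (Suc n) < - (w i \<bullet> q + b i)"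
        using nat_approx_posE[of "- (w i \<bullet> q + b i)"] by auto
      then show "q \<in> (\<Union>n. U S n)" using i(1) by (auto simp: U_def intro!: exI[of _ n] bexI[of _ i])
    qed
    then obtain D where D: "finite D" "K \<subseteq> (\<Union>n\<in>D. U S n)"
      using compactE_image[OF assms(1), of UNIV "U S"] openU by metis
    have "U S n \<subseteq> U S (Max D)" if "n \<in> D" for n
      using D(1) that by (intro U_mono) auto
    then show ?thesis using D(2) by blast
  qed
  then obtain n where n: "\<And>S. S \<in> \<T> \<Longrightarrow> K \<subseteq> U S (n S)" by metis
  define m where "m = Max (insert 0 (n ` \<T>))"
  have "K \<subseteq> U S m" if "S \<in> \<T>" for S
  proof -
    have "n S \<le> m" unfolding m_def using assms(2) that by auto
    then show ?thesis using n[OF that] U_mono by blast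
  qed
  then show ?thesis
    by (intro that[of "1 / Suc m"]) (force simp: U_def halfspaces_def)+
qed

text \<open>
  The combinatorial heart of the argument. The index sets \<open>S\<close> whose polyhedron misses the convex set
  \<open>G\<close> are partitioned into intervals \<open>{S'. B S \<subseteq> S' \<and> S' \<subseteq> C S}\<close> whose bottoms have at most
  as many elements as the dimension. This resembles the collapsibility of nerves of convex sets.
  
  Only finitely many points of \<open>G\<close> matter, one witness for every polyhedron that meets \<open>G\<close>. Relax the
  inequalities a little and generically, so that the hull of the witnesses still misses the same
  polyhedra, and choose a smooth strongly convex \<open>\<phi>\<close> that is less than 1 on the witnesses and at least 1
  on these polyhedra. Two index sets are in the same class when \<open>\<phi>\<close> has the same minimizer on the two
  relaxed polyhedra; the value at the minimizer tells whether the original polyhedron misses \<open>G\<close>.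
\<close>

theorem empty_intersections_interval_partition:
  fixes w :: "'i \<Rightarrow> 'z::euclidean_space" and b :: "'i \<Rightarrow> real" and G :: "'z set"
  assumes "finite F" "convex G" and p: "p \<in> halfspaces w b F"
  obtains B C :: "'i set \<Rightarrow> 'i set" where
    "\<And>S. S \<subseteq> F \<Longrightarrow> G \<inter> halfspaces w b S = {} \<Longrightarrow>
       B S \<subseteq> S \<and> S \<subseteq> C S \<and> C S \<subseteq> F \<and> card (B S) \<le> DIM('z)"
    "\<And>S S'. S \<subseteq> F \<Longrightarrow> G \<inter> halfspaces w b S = {} \<Longrightarrow> B S \<subseteq> S' \<Longrightarrow> S' \<subseteq> C S \<Longrightarrow>
       G \<inter> halfspaces w b S' = {} \<and> B S' = B S \<and> C S' = C S"
proof -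
  define \<T> where "\<T> = {S. S \<subseteq> F \<and> G \<inter> halfspaces w b S = {}}"
  define \<N> where "\<N> = {S. S \<subseteq> F \<and> G \<inter> halfspaces w b S \<noteq> {}}"
  have fin: "finite \<T>" "finite \<N>" using assms(1) by (auto simp: \<T>_def \<N>_def)
  obtain wit where wit: "\<And>S. S \<in> \<N> \<Longrightarrow> wit S \<in> G \<inter> halfspaces w b S"
  proof -
    have "\<forall>S\<in>\<N>. \<exists>x. x \<in> G \<inter> halfspaces w b S" by (auto simp: \<N>_def)
    from bchoice[OF this] that show ?thesis by blast
  qed
  define W where "W = wit ` \<N>"
  show ?thesis
  proof (cases "\<N> = {}")
    case True
    then show ?thesis
      by (intro that[of "\<lambda>_. {}" "\<lambda>_. F"]) (auto simp: \<N>_def)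
  next
    case False
    have W: "finite W" "W \<noteq> {}" "W \<subseteq> G" using fin False wit by (auto simp: W_def)
    have hullW: "convex hull W \<subseteq> G" using W(3) assms(2) by (simp add: hull_minimal)
    obtain \<tau> where \<tau>: "\<tau> > 0"
        "\<And>S. S \<in> \<T> \<Longrightarrow> convex hull W \<inter> halfspaces w (\<lambda>i. b i + \<tau>) S = {}"
    proof (rule uniform_relaxation[of "convex hull W" \<T> w b])
      show "convex hull W \<inter> halfspaces w b S = {}" if "S \<in> \<T>" for S
        using that hullW by (auto simp: \<T>_def)
    qed (use W(1) fin(1) in \<open>auto simp: finite_imp_compact_convex_hull\<close>)
    obtain \<eta> where \<eta>: "\<And>i. i \<in> F \<Longrightarrow> 0 < \<eta> i \<and> \<eta> i \<le> \<tau>"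
      and generic: "\<And>A q. A \<subseteq> F \<Longrightarrow> (\<And>i. i \<in> A \<Longrightarrow> w i \<bullet> q + (b i + \<eta> i) = 0)
          \<Longrightarrow> inj_on w A \<and> independent (w ` A)"
      using generic_relaxation[OF assms(1) \<tau>(1), of w b] by blast
    define Y where "Y = halfspaces w (\<lambda>i. b i + \<eta> i)"
    obtain \<phi> grad \<kappa> \<Lambda> where ssc: "smooth_strongly_convex \<phi> grad \<kappa> \<Lambda>"
      and low: "\<And>p. p \<in> W \<Longrightarrow> \<phi> p < 1"
      and high: "\<And>Y y. Y \<in> halfspaces w (\<lambda>i. b i + \<tau>) ` \<T> \<Longrightarrow> y \<in> Y \<Longrightarrow> 1 \<le> \<phi> y"
    proof (rule separating_strongly_convex[of W "halfspaces w (\<lambda>i. b i + \<tau>) ` \<T>"])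
      show "closed Y \<and> convex Y \<and> convex hull W \<inter> Y = {}"
        if "Y \<in> halfspaces w (\<lambda>i. b i + \<tau>) ` \<T>" for Y
        using that \<tau>(2) by (auto simp: closed_halfspaces convex_halfspaces)
    qed (use W(1,2) fin(1) in simp_all)
    interpret smooth_strongly_convex \<phi> grad \<kappa> \<Lambda> by (rule ssc)
    have Y_sub: "Y S \<subseteq> halfspaces w (\<lambda>i. b i + \<tau>) S" if "S \<subseteq> F" for S
      using that \<eta> by (force simp: Y_def halfspaces_def)
    have sub_Y: "halfspaces w b S \<subseteq> Y S" if "S \<subseteq> F" for S
      using that \<eta> by (force simp: Y_def halfspaces_def)
    have "\<exists>q. minimizes_on (Y S) q" if "S \<subseteq> F" for S
    proof (rule minimizes_on_ex)
      have "p \<in> halfspaces w b S" using p that by (auto simp: halfspaces_def)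
      then show "Y S \<noteq> {}" using sub_Y[OF that] by blast
    qed (simp_all add: Y_def closed_halfspaces convex_halfspaces)
    then obtain q where q: "\<And>S. S \<subseteq> F \<Longrightarrow> minimizes_on (Y S) (q S)" by metis
    have T_iff: "S \<in> \<T> \<longleftrightarrow> 1 \<le> \<phi> (q S)" if S: "S \<subseteq> F" for S
    proof
      assume "S \<in> \<T>"
      moreover have "q S \<in> Y S" using q[OF S] by (simp add: minimizes_on_def)
      ultimately show "1 \<le> \<phi> (q S)" using high Y_sub[OF S] by blast
    next
      assume ge: "1 \<le> \<phi> (q S)"
      show "S \<in> \<T>"
      proof (rule ccontr)
        assume "S \<notin> \<T>"
        then have "S \<in> \<N>" using S by (auto simp: \<T>_def \<N>_def)
        then have "wit S \<in> W" "wit S \<in> Y S" using wit sub_Y[OF S] by (auto simp: W_def)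
        then have "\<phi> (q S) + \<kappa> * (norm (wit S - q S))\<^sup>2 < 1"
          using minimizes_on_le[OF q[OF S]] low by (meson le_less_trans)
        moreover have "0 \<le> \<kappa> * (norm (wit S - q S))\<^sup>2" using \<kappa>_pos by simp
        ultimately show False using ge by linarith
      qed
    qed
    define good where "good x BC \<longleftrightarrow> card (fst BC) \<le> DIM('z) \<and> snd BC \<subseteq> F \<and>
        {S'. S' \<subseteq> F \<and> minimizes_on (Y S') x} = {S'. fst BC \<subseteq> S' \<and> S' \<subseteq> snd BC}" for x BC
    have "\<exists>BC. good (q S) BC" if S: "S \<subseteq> F" for S
    proof -
      have "minimizes_on (halfspaces w (\<lambda>i. b i + \<eta> i) S) (q S)"
        using q[OF S] by (simp add: Y_def)
      then have "\<exists>B C. B \<subseteq> S \<and> S \<subseteq> C \<and> C \<subseteq> F \<and> card B \<le> DIM('z) \<and>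
          {S'. S' \<subseteq> F \<and> minimizes_on (Y S') (q S)} = {S'. B \<subseteq> S' \<and> S' \<subseteq> C}"
        unfolding Y_def by (intro minimizing_sets_interval[OF assms(1) _ S] generic)
      then obtain B C where "B \<subseteq> S \<and> S \<subseteq> C \<and> C \<subseteq> F \<and> card B \<le> DIM('z) \<and>
          {S'. S' \<subseteq> F \<and> minimizes_on (Y S') (q S)} = {S'. B \<subseteq> S' \<and> S' \<subseteq> C}"
        by (elim exE) (rule that)
      then show ?thesis by (intro exI[of _ "(B, C)"]) (simp add: good_def)
    qed
    then have "\<forall>x\<in>q ` {S. S \<subseteq> F}. \<exists>BC. good x BC" by auto
    from bchoice[OF this] obtain I where I: "\<forall>x\<in>q ` {S. S \<subseteq> F}. good x (I x)" ..
    have I: "card (fst (I (q S))) \<le> DIM('z) \<and> snd (I (q S)) \<subseteq> F \<and>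
        {S'. S' \<subseteq> F \<and> minimizes_on (Y S') (q S)} = {S'. fst (I (q S)) \<subseteq> S' \<and> S' \<subseteq> snd (I (q S))}"
      if "S \<subseteq> F" for S
      by (rule bspec[OF I, unfolded good_def]) (use that in simp)
    show ?thesis
    proof (rule that[of "\<lambda>S. fst (I (q S))" "\<lambda>S. snd (I (q S))"])
      fix S assume S: "S \<subseteq> F" "G \<inter> halfspaces w b S = {}"
      then show "fst (I (q S)) \<subseteq> S \<and> S \<subseteq> snd (I (q S)) \<and> snd (I (q S)) \<subseteq> F \<and> card (fst (I (q S))) \<le> DIM('z)"
        using I[OF S(1)] q[OF S(1)] by blast
      fix S' assume "fst (I (q S)) \<subseteq> S'" "S' \<subseteq> snd (I (q S))"
      then have S': "S' \<subseteq> F" "minimizes_on (Y S') (q S)" using I[OF S(1)] by blast+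
      then have eq: "q S' = q S" using minimizes_on_unique q by blast
      have "S \<in> \<T>" using S by (simp add: \<T>_def)
      then have "S' \<in> \<T>" using T_iff[OF S(1)] T_iff[OF S'(1)] eq by simp
      then show "G \<inter> halfspaces w b S' = {} \<and> fst (I (q S')) = fst (I (q S)) \<and> snd (I (q S')) = snd (I (q S))"
        using eq by (simp add: \<T>_def)
    qed
  qed
qed

section \<open>Counting sets in interval partitions\<close>

lemma newton_expansion:
  fixes f :: "nat \<Rightarrow> real"
  shows "\<exists>coef. \<forall>c\<le>M. f c = (\<Sum>m\<le>c. coef m * real (c choose m))"
proof (induction M)
  case 0
  show ?case by (intro exI[of _ f]) simp
next
  case (Suc M)
  then obtain coef where coef: "\<And>c. c \<le> M \<Longrightarrow> f c = (\<Sum>m\<le>c. coef m * real (c choose m))" by blast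
  let ?coef = "coef(Suc M := f (Suc M) - (\<Sum>m\<le>M. coef m * real (Suc M choose m)))"
  have "f c = (\<Sum>m\<le>c. ?coef m * real (c choose m))" if "c \<le> Suc M" for c
  proof (cases "c = Suc M")
    case True
    then show ?thesis by (simp del: binomial_Suc_Suc)
  next
    case False
    then have "f c = (\<Sum>m\<le>c. coef m * real (c choose m))" using that coef by simp
    also have "\<dots> = (\<Sum>m\<le>c. ?coef m * real (c choose m))"
      using False that by (intro sum.cong) auto
    finally show ?thesis .
  qed
  then show ?case by (intro exI[of _ ?coef]) blast
qed

text \<open>
  Consider index sets in a ground set of size \<open>M\<close>, partitioned into intervals with bottoms of size
  \<open>b \<le> d\<close> and tops of size \<open>c\<close>. The interval with these sizes contains
  \<open>(c - b) choose (N - b)\<close> sets of size \<open>N\<close>, and those count if \<open>c < c0\<close>. The weight below bounds this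
  contribution, and it is a linear combination over \<open>m\<close> of the numbers
  \<open>(c - b) choose (m - b)\<close> of sets of size \<open>m\<close> in the interval, with coefficients independent of \<open>b\<close> and
  \<open>c\<close>. Summing over all intervals therefore gives the same linear combination of the
  numbers \<open>M choose m\<close>, which is the weight at \<open>c = M\<close> and \<open>b = 0\<close>: a feasible solution of a dual linear
  program.
  
  As a function of \<open>c\<close>, the weight at \<open>b = 0\<close> is \<open>c choose N\<close> up to \<open>c0 - 1\<close>, continued by its Newton
  extrapolation of degree less than \<open>d\<close>; the weight at \<open>b\<close> is its \<open>b\<close>-th backward difference.
\<close>

definition dual_weight :: "nat \<Rightarrow> nat \<Rightarrow> nat \<Rightarrow> nat \<Rightarrow> nat \<Rightarrow> real" where
  "dual_weight d N c0 c b =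
    (if c < c0 then real ((c - b) choose (N - b))
     else (\<Sum>i<d - b. real ((c - c0 + i) choose i) * real ((c0 - 1 - b - i) choose (N - b - i))))"

lemma dual_weight_Suc:
  assumes "b < d" "d \<le> N" "b \<le> c"
  shows "dual_weight d N c0 (Suc c) b = dual_weight d N c0 c b + dual_weight d N c0 (Suc c) (Suc b)"
proof -
  obtain k where k: "d - b = Suc k" "d - Suc b = k" using assms(1) by (metis Suc_diff_Suc)
  consider "Suc c < c0" | "Suc c = c0" | "c0 \<le> c" by linarith
  then show ?thesis
  proof cases
    case 1
    have "Suc c - b = Suc (c - b)" "N - b = Suc (N - Suc b)" using assms by auto
    then show ?thesis using 1 by (simp add: dual_weight_def)
  next
    case 2
    have idx: "c - b - Suc i = c - Suc b - i" "N - b - Suc i = N - Suc b - i" for i by auto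
    have *: "dual_weight d N c0 (Suc c) b = (\<Sum>i<Suc k. real ((c - b - i) choose (N - b - i)))"
      using 2 by (auto simp: dual_weight_def k(1) simp del: sum.lessThan_Suc)
    show ?thesis
      unfolding * sum.lessThan_Suc_shift using 2[symmetric] by (simp add: dual_weight_def k(2) idx)
  next
    case 3
    let ?g = "\<lambda>i. real ((c0 - 1 - b - i) choose (N - b - i))"
    have idx: "c0 - 1 - b - Suc i = c0 - 1 - Suc b - i" "N - b - Suc i = N - Suc b - i" for i by auto
    have pascal: "real ((Suc c - c0 + Suc i) choose Suc i) =
        real ((c - c0 + Suc i) choose Suc i) + real ((Suc c - c0 + i) choose i)" for i
      using 3 by (simp add: Suc_diff_le)
    have "dual_weight d N c0 (Suc c) b =
        ?g 0 + (\<Sum>i<k. real ((Suc c - c0 + Suc i) choose Suc i) * ?g (Suc i))"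
      using 3 unfolding dual_weight_def k(1) sum.lessThan_Suc_shift by simp
    also have "\<dots> = (?g 0 + (\<Sum>i<k. real ((c - c0 + Suc i) choose Suc i) * ?g (Suc i))) +
        (\<Sum>i<k. real ((Suc c - c0 + i) choose i) * ?g (Suc i))"
      unfolding pascal by (simp only: distrib_right sum.distrib add.assoc)
    also have "?g 0 + (\<Sum>i<k. real ((c - c0 + Suc i) choose Suc i) * ?g (Suc i)) = dual_weight d N c0 c b"
      using 3 unfolding dual_weight_def k(1) sum.lessThan_Suc_shift by simp
    also have "(\<Sum>i<k. real ((Suc c - c0 + i) choose i) * ?g (Suc i)) = dual_weight d N c0 (Suc c) (Suc b)"
      using 3 unfolding dual_weight_def k(2) idx by simp
    finally show ?thesis .
  qed
qed

lemma dual_weight_dual: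
  assumes "d \<le> N" "0 < N"
  obtains coef where "\<And>b c. b \<le> d \<Longrightarrow> b \<le> c \<Longrightarrow> c \<le> M \<Longrightarrow>
    dual_weight d N c0 c b = (\<Sum>m\<in>{N..M}. coef m * real ((c - b) choose (m - b)))"
proof -
  let ?H = "dual_weight d N c0"
  obtain coef where coef: "\<And>c. c \<le> M \<Longrightarrow> ?H c 0 = (\<Sum>m\<le>c. coef m * real (c choose m))"
    using newton_expansion[of M "\<lambda>c. ?H c 0"] by blast
  have H0: "?H c 0 = 0" if "c < N" for c
  proof -
    have "(c0 - 1 - i) choose (N - i) = 0" if "c0 \<le> c" "i < d" for i
      using that \<open>c < N\<close> assms by (intro binomial_eq_0) linarith
    then have "(\<Sum>i<d. real ((c - c0 + i) choose i) * real ((c0 - 1 - i) choose (N - i))) = 0"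
      if "c0 \<le> c" using that by (intro sum.neutral) simp
    then show ?thesis using that by (auto simp: dual_weight_def)
  qed
  \<comment> \<open>Sizes \<open>m < N\<close> have coefficient 0; this keeps \<open>m - b\<close> from being truncated, and it
    dispenses with the empty index set.\<close>
  have coef0: "coef m = 0" if "m < N" "m \<le> M" for m
    using that
  proof (induction m rule: less_induct)
    case (less m)
    have "0 = (\<Sum>j\<le>m. coef j * real (m choose j))" using coef[of m] H0[of m] less.prems by simp
    also have "\<dots> = (\<Sum>j<m. coef j * real (m choose j)) + coef m"
      by (simp add: lessThan_Suc_atMost[symmetric])
    also have "(\<Sum>j<m. coef j * real (m choose j)) = 0"
      using less by (intro sum.neutral) auto
    finally show ?case by simp
  qed
  have "?H c b = (\<Sum>m\<in>{N..M}. coef m * real ((c - b) choose (m - b)))" if "b \<le> d" "b \<le> c" "c \<le> M" for b c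
    using that
  proof (induction b arbitrary: c)
    case 0
    have "?H c 0 = (\<Sum>m\<le>M. coef m * real (c choose m))"
      unfolding coef[OF 0(3)] using 0 by (intro sum.mono_neutral_left) auto
    also have "\<dots> = (\<Sum>m\<in>{N..M}. coef m * real (c choose m))"
      using coef0 by (intro sum.mono_neutral_right) auto
    finally show ?case by simp
  next
    case (Suc b)
    then obtain c' where c': "c = Suc c'" "b \<le> c'" by (metis Suc_le_D Suc_le_mono)
    have "?H c (Suc b) = ?H c b - ?H c' b"
      using dual_weight_Suc[of b d N c' c0] Suc.prems assms c' by simp
    also have "\<dots> = (\<Sum>m\<in>{N..M}. coef m * real ((c - b) choose (m - b)) - coef m * real ((c' - b) choose (m - b)))"
      using Suc c' by (simp add: sum_subtractf)
    also have "\<dots> = (\<Sum>m\<in>{N..M}. coef m * real ((c - Suc b) choose (m - Suc b)))"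
    proof (intro sum.cong refl)
      fix m assume "m \<in> {N..M}"
      then have "m - b = Suc (m - Suc b)" using Suc.prems assms by auto
      moreover have "c - b = Suc (c' - b)" "c - Suc b = c' - b" using c' by auto
      ultimately show "coef m * real ((c - b) choose (m - b)) - coef m * real ((c' - b) choose (m - b)) =
          coef m * real ((c - Suc b) choose (m - Suc b))"
        by (simp add: distrib_left)
    qed
    finally show ?case .
  qed
  then show ?thesis by (rule that)
qed

lemma card_sets_between:
  assumes "finite C" "B \<subseteq> C" "card B \<le> m"
  shows "card {S. B \<subseteq> S \<and> S \<subseteq> C \<and> card S = m} = (card C - card B) choose (m - card B)"
proof -
  have finB: "finite B" using assms finite_subset by blast
  have "bij_betw (\<lambda>S. S \<union> B) {S. S \<subseteq> C - B \<and> card S = m - card B} {S. B \<subseteq> S \<and> S \<subseteq> C \<and> card S = m}"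
  proof (rule bij_betw_byWitness[where f' = "\<lambda>S. S - B"])
    show "(\<lambda>S. S \<union> B) ` {S. S \<subseteq> C - B \<and> card S = m - card B} \<subseteq> {S. B \<subseteq> S \<and> S \<subseteq> C \<and> card S = m}"
    proof safe
      fix S assume S: "S \<subseteq> C - B" "card S = m - card B"
      have "card (S \<union> B) = card S + card B"
        using S assms finB by (intro card_Un_disjoint) (auto intro: finite_subset)
      then show "card (S \<union> B) = m" using S assms by simp
    qed (use assms in auto)
    show "(\<lambda>S. S - B) ` {S. B \<subseteq> S \<and> S \<subseteq> C \<and> card S = m} \<subseteq> {S. S \<subseteq> C - B \<and> card S = m - card B}"
      using finB by (auto simp: card_Diff_subset)
  qed auto
  from bij_betw_same_card[OF this]
  show ?thesis using assms finB by (simp add: n_subsets card_Diff_subset)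
qed

text \<open>
  An interval partition is presented by the maps \<open>B\<close> and \<open>C\<close> that send a nonempty set to the bottom and
  the top of its interval.
\<close>

theorem card_small_top_sets_le:
  fixes B C :: "'i set \<Rightarrow> 'i set"
  assumes J: "finite J" "card J = M" and "d \<le> N" "0 < N" "c0 \<le> M"
    and between: "\<And>S. S \<subseteq> J \<Longrightarrow> S \<noteq> {} \<Longrightarrow> B S \<subseteq> S \<and> S \<subseteq> C S \<and> C S \<subseteq> J \<and> card (B S) \<le> d"
    and const: "\<And>S S'. S \<subseteq> J \<Longrightarrow> S \<noteq> {} \<Longrightarrow> S' \<noteq> {} \<Longrightarrow> B S \<subseteq> S' \<Longrightarrow> S' \<subseteq> C S
        \<Longrightarrow> B S' = B S \<and> C S' = C S"
  shows "real (card {S. S \<subseteq> J \<and> card S = N \<and> card (C S) < c0}) \<le>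
    (\<Sum>i<d. real ((M - c0 + i) choose i) * real ((c0 - 1 - i) choose (N - i)))"
proof -
  define I where "I = (\<lambda>S. (B S, C S)) ` {S. S \<subseteq> J \<and> S \<noteq> {}}"
  have finI: "finite I" using J by (auto simp: I_def)
  have I: "B0 \<subseteq> C0" "C0 \<subseteq> J" "finite C0" "card B0 \<le> d" "card B0 \<le> card C0" "card C0 \<le> M"
    if BC_in: "(B0, C0) \<in> I" for B0 C0
  proof -
    obtain S where "S \<subseteq> J" "S \<noteq> {}" "B0 = B S" "C0 = C S" using BC_in by (auto simp: I_def)
    then show *: "B0 \<subseteq> C0" "C0 \<subseteq> J" "card B0 \<le> d" using between[of S] by auto
    show "finite C0" using * J finite_subset by blast
    then show "card B0 \<le> card C0" "card C0 \<le> M" using * J by (auto intro: card_mono)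
  qed
  have count: "real (card {S. S \<subseteq> J \<and> card S = m \<and> Q (C S)}) =
      (\<Sum>(B0, C0)\<in>I. if Q C0 then real ((card C0 - card B0) choose (m - card B0)) else 0)"
    if m: "N \<le> m" for m Q
  proof -
    let ?A = "{S. S \<subseteq> J \<and> card S = m \<and> Q (C S)}"
    have ne: "S \<noteq> {}" if "card S = m" for S :: "'i set" using that m assms by auto
    have finA: "finite ?A" using J by simp
    have "card ?A = (\<Sum>S\<in>?A. 1)" by simp
    also have "\<dots> = (\<Sum>y\<in>I. \<Sum>S\<in>{S \<in> ?A. (B S, C S) = y}. 1)"
      using finA finI ne by (intro sum.group[symmetric]) (auto simp: I_def)
    also have "\<dots> = (\<Sum>(B0, C0)\<in>I. if Q C0 then (card C0 - card B0) choose (m - card B0) else 0)"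
    proof (intro sum.cong refl)
      fix y assume y: "y \<in> I"
      obtain B0 C0 where BC: "y = (B0, C0)" by (cases y)
      obtain S0 where S0: "S0 \<subseteq> J" "S0 \<noteq> {}" "B0 = B S0" "C0 = C S0" using y BC by (auto simp: I_def)
      have "{S \<in> ?A. (B S, C S) = y} = (if Q C0 then {S. B0 \<subseteq> S \<and> S \<subseteq> C0 \<and> card S = m} else {})"
      proof -
        have iff: "(S \<subseteq> J \<and> B S = B0 \<and> C S = C0) \<longleftrightarrow> (B0 \<subseteq> S \<and> S \<subseteq> C0)" if "card S = m" for S
          using between[of S] const[OF S0(1,2), of S] between[OF S0(1,2)] ne[OF that] S0(3,4) by blast
        have "S \<in> {S \<in> ?A. (B S, C S) = y} \<longleftrightarrow>
            S \<in> (if Q C0 then {S. B0 \<subseteq> S \<and> S \<subseteq> C0 \<and> card S = m} else {})" for S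
          unfolding BC using iff[of S] by (cases "card S = m"; cases "Q C0") auto
        then show ?thesis by blast
      qed
      then show "(\<Sum>S\<in>{S \<in> ?A. (B S, C S) = y}. 1) =
          (case y of (B0, C0) \<Rightarrow> if Q C0 then (card C0 - card B0) choose (m - card B0) else 0)"
        using card_sets_between[of C0 B0 m] I[of B0 C0] y BC m assms by auto
    qed
    finally show ?thesis by (simp add: of_nat_sum split_def if_distrib cong: if_cong)
  qed
  obtain coef where coef: "\<And>b c. b \<le> d \<Longrightarrow> b \<le> c \<Longrightarrow> c \<le> M \<Longrightarrow>
      dual_weight d N c0 c b = (\<Sum>m\<in>{N..M}. coef m * real ((c - b) choose (m - b)))"
    using dual_weight_dual[OF assms(3,4)] by blast
  have "real (card {S. S \<subseteq> J \<and> card S = N \<and> card (C S) < c0}) =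
      (\<Sum>(B0, C0)\<in>I. if card C0 < c0 then real ((card C0 - card B0) choose (N - card B0)) else 0)"
    by (rule count) simp
  also have "\<dots> \<le> (\<Sum>(B0, C0)\<in>I. dual_weight d N c0 (card C0) (card B0))"
    by (intro sum_mono) (auto simp: dual_weight_def sum_nonneg)
  also have "\<dots> = (\<Sum>(B0, C0)\<in>I. \<Sum>m\<in>{N..M}. coef m * real ((card C0 - card B0) choose (m - card B0)))"
    using I coef by (intro sum.cong refl) auto
  also have "\<dots> = (\<Sum>m\<in>{N..M}. coef m * (\<Sum>(B0, C0)\<in>I. real ((card C0 - card B0) choose (m - card B0))))"
    unfolding split_def sum_distrib_left by (rule sum.swap)
  also have "\<dots> = (\<Sum>m\<in>{N..M}. coef m * real (card {S. S \<subseteq> J \<and> card S = m}))"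
    using count[of _ "\<lambda>_. True"] by (intro sum.cong refl) simp
  also have "\<dots> = (\<Sum>m\<in>{N..M}. coef m * real (M choose m))"
    using J by (simp add: n_subsets)
  also have "\<dots> = dual_weight d N c0 M 0" using coef[of 0 M] by simp
  also have "\<dots> = (\<Sum>i<d. real ((M - c0 + i) choose i) * real ((c0 - 1 - i) choose (N - i)))"
    using assms by (simp add: dual_weight_def)
  finally show ?thesis .
qed

lemma binomial_ratio_tendsto:
  fixes a n :: "nat \<Rightarrow> nat"
  assumes "(\<lambda>k. real (a k) / real (n k)) \<longlonglongrightarrow> x" "filterlim n at_top sequentially"
  shows "(\<lambda>k. real (a k choose i) / real (n k) ^ i) \<longlonglongrightarrow> x ^ i / fact i"
proof -
  have inv: "(\<lambda>k. real j / real (n k)) \<longlonglongrightarrow> 0" for j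
    using assms(2) by (intro tendsto_divide_0[OF tendsto_const] filterlim_at_top_imp_at_infinity
        filterlim_compose[OF filterlim_real_sequentially])
  have "(\<lambda>k. (\<Prod>j<i. real (a k) / real (n k) - real j / real (n k)) / fact i)
      \<longlonglongrightarrow> (\<Prod>j<i. x - 0) / fact i"
    by (intro tendsto_intros assms(1) inv) simp
  moreover have "real (a k choose i) / real (n k) ^ i =
      (\<Prod>j<i. real (a k) / real (n k) - real j / real (n k)) / fact i" for k
  proof -
    have "real (a k choose i) = (\<Prod>j<i. real (a k) - real j) / fact i"
      by (simp add: binomial_gbinomial gbinomial_prod_rev atLeast0LessThan)
    then show ?thesis
      by (simp add: prod_dividef flip: diff_divide_distrib)
  qed
  ultimately show ?thesis by simp
qed

text \<open>
  The counting bound for \<open>N\<close> out of \<open>N + K\<close> points, as a fraction of all subsamples of size \<open>N\<close>, tends to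
  the probability that a binomial variable with parameters \<open>N\<close> and \<open>\<rho>\<close> is less than \<open>d\<close>.
\<close>

lemma violation_fraction_tendsto:
  fixes \<rho> :: real
  assumes "0 < \<rho>" "\<rho> < 1" "d \<le> N"
  shows "(\<lambda>K. (\<Sum>i<d. real ((nat \<lfloor>\<rho> * real K\<rfloor> + i) choose i) *
              real ((N + K - nat \<lfloor>\<rho> * real K\<rfloor> - 1 - i) choose (N - i))) / real ((N + K) choose N))
    \<longlonglongrightarrow> (\<Sum>i<d. real (N choose i) * \<rho> ^ i * (1 - \<rho>) ^ (N - i))"
proof -
  define k where "k K = nat \<lfloor>\<rho> * real K\<rfloor>" for K
  have k_eq: "real (k K) = of_int \<lfloor>\<rho> * real K\<rfloor>" for K using assms by (simp add: k_def)
  have k_le: "k K \<le> K" for K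
  proof -
    have "\<rho> * real K \<le> real K" using assms by (simp add: mult_left_le_one_le)
    then show ?thesis unfolding k_def by linarith
  qed
  have k_lim: "(\<lambda>K. real (k K) / real K) \<longlonglongrightarrow> \<rho>"
    unfolding k_eq using assms by real_asymp
  have idlim: "filterlim (\<lambda>K::nat. K) at_top sequentially" by (rule filterlim_ident)
  have c: "(\<lambda>K. real j / real K) \<longlonglongrightarrow> 0" for j :: nat by real_asymp
  have one: "\<forall>\<^sub>F K in sequentially. real K / real K = 1"
    by (intro eventually_sequentiallyI[of 1]) simp
  have one_lim: "(\<lambda>K. real K / real K) \<longlonglongrightarrow> 1"
    by (rule Lim_transform_eventually[OF tendsto_const]) (use one in \<open>auto elim: eventually_mono\<close>)
  have A: "(\<lambda>K. real (k K + i) / real K) \<longlonglongrightarrow> \<rho>" for i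
    using tendsto_add[OF k_lim c[of i]] by (simp add: add_divide_distrib)
  have D: "(\<lambda>K. real (N + K) / real K) \<longlonglongrightarrow> 1"
    using tendsto_add[OF c[of N] one_lim] by (simp add: add_divide_distrib)
  have Bl: "(\<lambda>K. real (N + K - k K - 1 - i) / real K) \<longlonglongrightarrow> 1 - \<rho>" if "i < N" for i
  proof -
    have "(\<lambda>K. (real (N + K) / real K - real (k K) / real K) - real (1 + i) / real K) \<longlonglongrightarrow> (1 - \<rho>) - 0"
      by (intro tendsto_diff D k_lim c)
    moreover have "real (N + K - k K - 1 - i) = real (N + K) - real (k K) - real (1 + i)" for K
      using k_le[of K] that by (simp add: of_nat_diff)
    ultimately show ?thesis by (simp add: diff_divide_distrib)
  qed
  have "(\<lambda>K. (\<Sum>i<d. (real ((k K + i) choose i) / real K ^ i) *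
        (real ((N + K - k K - 1 - i) choose (N - i)) / real K ^ (N - i))) / (real ((N + K) choose N) / real K ^ N))
    \<longlonglongrightarrow> (\<Sum>i<d. (\<rho> ^ i / fact i) * ((1 - \<rho>) ^ (N - i) / fact (N - i))) / (1 ^ N / fact N)"
    using assms(3) by (intro tendsto_divide tendsto_sum tendsto_mult binomial_ratio_tendsto A Bl D idlim) auto
  moreover have "(\<Sum>i<d. (\<rho> ^ i / fact i) * ((1 - \<rho>) ^ (N - i) / fact (N - i))) / (1 ^ N / fact N) =
      (\<Sum>i<d. real (N choose i) * \<rho> ^ i * (1 - \<rho>) ^ (N - i))"
    unfolding sum_divide_distrib using assms(3)
    by (intro sum.cong refl) (simp add: binomial_fact field_simps)
  moreover have "\<forall>\<^sub>F K in sequentially. (\<Sum>i<d. (real ((k K + i) choose i) / real K ^ i) *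
        (real ((N + K - k K - 1 - i) choose (N - i)) / real K ^ (N - i))) / (real ((N + K) choose N) / real K ^ N)
      = (\<Sum>i<d. real ((k K + i) choose i) * real ((N + K - k K - 1 - i) choose (N - i))) / real ((N + K) choose N)"
  proof (intro eventually_sequentiallyI[of 1])
    fix K :: nat assume K: "1 \<le> K"
    have "(\<Sum>i<d. (real ((k K + i) choose i) / real K ^ i) *
        (real ((N + K - k K - 1 - i) choose (N - i)) / real K ^ (N - i))) =
      (\<Sum>i<d. real ((k K + i) choose i) * real ((N + K - k K - 1 - i) choose (N - i)) / real K ^ N)"
      using assms(3) by (intro sum.cong refl) (simp flip: power_add)
    then show "(\<Sum>i<d. (real ((k K + i) choose i) / real K ^ i) *
        (real ((N + K - k K - 1 - i) choose (N - i)) / real K ^ (N - i))) / (real ((N + K) choose N) / real K ^ N)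
      = (\<Sum>i<d. real ((k K + i) choose i) * real ((N + K - k K - 1 - i) choose (N - i))) / real ((N + K) choose N)"
      using K by (simp flip: sum_divide_distrib)
  qed
  ultimately show ?thesis unfolding k_def using Lim_transform_eventually by force
qed

section \<open>Optimizers of subsamples\<close>

text \<open>
  The point of \<open>F\<close> that is preferred to all others. It need not exist, and for a tie-break rule it is
  unique. Cost and tie-break are combined in the single relation \<open>prec\<close>.
\<close>

definition optimum :: "('z \<Rightarrow> 'z \<Rightarrow> bool) \<Rightarrow> 'z set \<Rightarrow> 'z \<Rightarrow> bool" where
  "optimum prec F p \<longleftrightarrow> p \<in> F \<and> (\<forall>q\<in>F. q \<noteq> p \<longrightarrow> prec p q)"

lemma optimum_unique:
  assumes "tie_break_rule prec" "optimum prec F p" "optimum prec F q"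
  shows "p = q"
proof (rule ccontr)
  assume "p \<noteq> q"
  then have "prec p q" "prec q p" using assms(2,3) by (auto simp: optimum_def)
  then show False using assms(1) unfolding tie_break_rule_def by (meson irreflpD transpD)
qed

lemma optimum_subset: "optimum prec F p \<Longrightarrow> p \<in> F' \<Longrightarrow> F' \<subseteq> F \<Longrightarrow> optimum prec F' p"
  by (auto simp: optimum_def)

lemma optimum_not_better:
  assumes "tie_break_rule prec" "optimum prec F p" "q \<in> F"
  shows "\<not> prec q p"
proof
  assume *: "prec q p"
  have irrefl: "\<not> prec p p" and trans: "prec p q \<Longrightarrow> prec q p \<Longrightarrow> prec p p"
    using assms(1) unfolding tie_break_rule_def by (meson irreflpD transpD)+
  then show False using * assms(2,3) by (cases "q = p") (auto simp: optimum_def)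
qed

lemma halfspaces_mono: "S \<subseteq> S' \<Longrightarrow> halfspaces w b S' \<subseteq> halfspaces w b S"
  by (auto simp: halfspaces_def)

text \<open>
  The points of \<open>D\<close> that are preferred to \<open>p\<close>. When \<open>D\<close> intersected with a polyhedron contains \<open>p\<close> and has
  an optimum, this optimum is \<open>p\<close> if and only if the polyhedron misses the region.
\<close>

abbreviation better_region :: "'z set \<Rightarrow> ('z \<Rightarrow> 'z \<Rightarrow> bool) \<Rightarrow> 'z \<Rightarrow> 'z set" where
  "better_region D prec p \<equiv> {q\<in>D. prec q p}"

lemma convex_better_region:
  "tie_break_rule prec \<Longrightarrow> convex D \<Longrightarrow> convex (better_region D prec p)"
  using convex_Int[of D "{q. prec q p}"] by (simp add: tie_break_rule_def Collect_conj_eq)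

lemma better_region_empty:
  assumes "tie_break_rule prec" "optimum prec (D \<inter> halfspaces w b S) p"
  shows "better_region D prec p \<inter> halfspaces w b S = {}"
  using optimum_not_better[OF assms] by blast

lemma optimum_eqI:
  assumes "p \<in> D \<inter> halfspaces w b S" "optimum prec (D \<inter> halfspaces w b S) p'"
    and "better_region D prec p \<inter> halfspaces w b S = {}"
  shows "p' = p"
  using assms by (auto simp: optimum_def)

lemma optimum_basis:
  fixes w :: "'i \<Rightarrow> 'z::euclidean_space"
  assumes "tie_break_rule prec" "convex D" "finite S" "optimum prec (D \<inter> halfspaces w b S) p"
  obtains B where "B \<subseteq> S" "card B \<le> DIM('z)" "better_region D prec p \<inter> halfspaces w b B = {}"
proof -
  have p: "p \<in> halfspaces w b S" using assms(4) by (simp add: optimum_def)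
  have e: "better_region D prec p \<inter> halfspaces w b S = {}"
    using assms(1,4) by (rule better_region_empty)
  show ?thesis
  proof (rule empty_intersections_interval_partition[OF assms(3) convex_better_region[OF assms(1,2)] p])
    fix B C :: "'i set \<Rightarrow> 'i set"
    assume *: "\<And>S'. S' \<subseteq> S \<Longrightarrow> better_region D prec p \<inter> halfspaces w b S' = {} \<Longrightarrow>
        B S' \<subseteq> S' \<and> S' \<subseteq> C S' \<and> C S' \<subseteq> S \<and> card (B S') \<le> DIM('z)"
      "\<And>S1 S'. S1 \<subseteq> S \<Longrightarrow> better_region D prec p \<inter> halfspaces w b S1 = {} \<Longrightarrow>
        B S1 \<subseteq> S' \<Longrightarrow> S' \<subseteq> C S1 \<Longrightarrow>
        better_region D prec p \<inter> halfspaces w b S' = {} \<and> B S' = B S1 \<and> C S' = C S1"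
    have BC: "B S \<subseteq> S" "S \<subseteq> C S" "card (B S) \<le> DIM('z)" using *(1)[OF order_refl e] by auto
    show thesis
      by (rule that[OF BC(1,3)]) (use *(2)[OF order_refl e order_refl] BC in blast)
  qed
qed

text \<open>
  Programs with more than \<open>N\<close> constraints inherit optimizers from those with at most \<open>N\<close>: among the
  optimizers for at most \<open>DIM('z)\<close> constraints, one that is maximal for \<open>prec\<close> satisfies all of them.
  If it violated a constraint, adding this constraint would give a strictly worse optimum, which is again
  determined by at most \<open>DIM('z)\<close> constraints.
\<close>

lemma optimum_exists:
  fixes w :: "'i \<Rightarrow> 'z::euclidean_space"
  assumes tb: "tie_break_rule prec" and D: "convex D" and N: "DIM('z) < N"
    and S: "finite S" "S \<noteq> {}"
    and small: "\<And>T. T \<subseteq> S \<Longrightarrow> T \<noteq> {} \<Longrightarrow> card T \<le> N \<Longrightarrow> \<exists>p. optimum prec (D \<inter> halfspaces w b T) p"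
  shows "\<exists>p. optimum prec (D \<inter> halfspaces w b S) p"
proof -
  define \<B> where "\<B> = {B. B \<subseteq> S \<and> B \<noteq> {} \<and> card B \<le> DIM('z)}"
  have "\<forall>T\<in>{T. T \<subseteq> S \<and> T \<noteq> {} \<and> card T \<le> N}. \<exists>p. optimum prec (D \<inter> halfspaces w b T) p"
    using small by blast
  from bchoice[OF this] obtain p where
    p: "\<And>T. T \<subseteq> S \<Longrightarrow> T \<noteq> {} \<Longrightarrow> card T \<le> N \<Longrightarrow> optimum prec (D \<inter> halfspaces w b T) (p T)"
    by blast
  have finB: "finite \<B>" using S by (simp add: \<B>_def)
  obtain i where "i \<in> S" using S by blast
  then have "{i} \<in> \<B>" by (simp add: \<B>_def Suc_leI)
  then have neB: "\<B> \<noteq> {}" by blast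
  have "asymp_on (p ` \<B>) prec" "transp_on (p ` \<B>) prec"
    using tb unfolding tie_break_rule_def
    by (auto simp: asymp_on_def transp_on_def irreflp_def transp_def) 
  then obtain m where m: "m \<in> p ` \<B>" "\<And>x. x \<in> p ` \<B> \<Longrightarrow> x \<noteq> m \<Longrightarrow> \<not> prec m x"
    using Finite_Set.bex_max_element[of "p ` \<B>" prec] finB neB by blast
  then obtain B where B: "B \<in> \<B>" "m = p B" by blast
  have optB: "optimum prec (D \<inter> halfspaces w b B) m"
    using B N p[of B] by (auto simp: \<B>_def)
  have "m \<in> halfspaces w b S"
  proof (rule ccontr)
    assume "m \<notin> halfspaces w b S"
    then obtain i where i: "i \<in> S" "\<not> 0 \<le> w i \<bullet> m + b i" by (auto simp: halfspaces_def)
    define T where "T = insert i B"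
    have T: "T \<subseteq> S" "T \<noteq> {}" "finite T" "card T \<le> N"
      using B(1) i N S finite_subset[of B S] card_insert_le_m1[of N B i] card_insert_if[of B i]
      by (auto simp: T_def \<B>_def)
    note optT = p[OF T(1,2,4)]
    have "p T \<in> D \<inter> halfspaces w b B" "p T \<noteq> m"
      using optT i(2) by (auto simp: optimum_def T_def halfspaces_def)
    then have prec: "prec m (p T)" using optB by (auto simp: optimum_def)
    obtain B' where B': "B' \<subseteq> T" "card B' \<le> DIM('z)" "better_region D prec (p T) \<inter> halfspaces w b B' = {}"
      using optimum_basis[OF tb D T(3) optT] by blast
    define B'' where "B'' = (if B' = {} then {i} else B')"
    have B'': "B'' \<in> \<B>" "B'' \<subseteq> T" "B' \<subseteq> B''"
      using B' T i by (auto simp: B''_def \<B>_def T_def Suc_leI)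
    have "p B'' = p T"
    proof (rule optimum_eqI)
      show "optimum prec (D \<inter> halfspaces w b B'') (p B'')"
        using B'' N p[of B''] by (auto simp: \<B>_def)
      show "p T \<in> D \<inter> halfspaces w b B''"
        using optT halfspaces_mono[OF B''(2)] by (auto simp: optimum_def)
      show "better_region D prec (p T) \<inter> halfspaces w b B'' = {}"
        using B'(3) halfspaces_mono[OF B''(3)] by blast
    qed
    then have "p T \<in> p ` \<B>" using B''(1) by (metis imageI)
    then show False using m(2) \<open>p T \<noteq> m\<close> prec by blast
  qed
  then have "optimum prec (D \<inter> halfspaces w b S) m"
    using optB B(1) halfspaces_mono[of B S w b]
    by (intro optimum_subset[OF optB]) (auto simp: optimum_def \<B>_def)
  then show ?thesis by blast
qed

text \<open>
  Among all subsamples of size \<open>N\<close> of a fixed sample of size \<open>M\<close>, few have an optimizer that violates more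
  than \<open>k\<close> of the \<open>M\<close> constraints. The subsamples with a given optimizer \<open>p\<close> are those whose constraints
  hold at \<open>p\<close> and whose polyhedron misses \<open>better_region D prec p\<close>, so they are partitioned into intervals.
  The top of each interval omits all constraints that \<open>p\<close> violates.
\<close>

theorem card_violating_subsamples_le:
  fixes w :: "'i \<Rightarrow> 'z::euclidean_space" and opt :: "'i set \<Rightarrow> 'z"
  assumes tb: "tie_break_rule prec" and D: "convex D"
    and J: "finite J" "card J = M" and N: "DIM('z) \<le> N" "0 < N" and "k \<le> M"
    and opt: "\<And>S. S \<subseteq> J \<Longrightarrow> S \<noteq> {} \<Longrightarrow> optimum prec (D \<inter> halfspaces w b S) (opt S)"
  shows "real (card {S. S \<subseteq> J \<and> card S = N \<and> k < card {i\<in>J. w i \<bullet> opt S + b i < 0}}) \<le>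
    (\<Sum>i<DIM('z). real ((k + i) choose i) * real ((M - k - 1 - i) choose (N - i)))"
proof -
  define F where "F p = {i\<in>J. 0 \<le> w i \<bullet> p + b i}" for p
  define part where "part p BC \<longleftrightarrow>
      (\<forall>S. S \<subseteq> F p \<longrightarrow> better_region D prec p \<inter> halfspaces w b S = {} \<longrightarrow>
        (fst BC S \<subseteq> S \<and> S \<subseteq> snd BC S \<and> snd BC S \<subseteq> F p \<and> card (fst BC S) \<le> DIM('z)) \<and>
        (\<forall>S'. fst BC S \<subseteq> S' \<longrightarrow> S' \<subseteq> snd BC S \<longrightarrow>
          better_region D prec p \<inter> halfspaces w b S' = {} \<and> fst BC S' = fst BC S \<and> snd BC S' = snd BC S))"
    for p and BC :: "('i set \<Rightarrow> 'i set) \<times> ('i set \<Rightarrow> 'i set)"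
  have "\<exists>BC. part p BC" for p
  proof -
    have fin: "finite (F p)" using J by (simp add: F_def)
    have p: "p \<in> halfspaces w b (F p)" by (simp add: F_def halfspaces_def)
    show ?thesis
    proof (rule empty_intersections_interval_partition[OF fin convex_better_region[OF tb D] p])
      fix B C :: "'i set \<Rightarrow> 'i set"
      assume *: "\<And>S. S \<subseteq> F p \<Longrightarrow> better_region D prec p \<inter> halfspaces w b S = {} \<Longrightarrow>
           B S \<subseteq> S \<and> S \<subseteq> C S \<and> C S \<subseteq> F p \<and> card (B S) \<le> DIM('z)"
        "\<And>S S'. S \<subseteq> F p \<Longrightarrow> better_region D prec p \<inter> halfspaces w b S = {} \<Longrightarrow> B S \<subseteq> S' \<Longrightarrow> S' \<subseteq> C S \<Longrightarrow>
           better_region D prec p \<inter> halfspaces w b S' = {} \<and> B S' = B S \<and> C S' = C S"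
      have "part p (B, C)"
        unfolding part_def fst_conv snd_conv
      proof (intro allI impI, rule conjI)
        fix S assume S: "S \<subseteq> F p" "better_region D prec p \<inter> halfspaces w b S = {}"
        show "B S \<subseteq> S \<and> S \<subseteq> C S \<and> C S \<subseteq> F p \<and> card (B S) \<le> DIM('z)" by (rule *(1)[OF S])
        show "\<forall>S'. B S \<subseteq> S' \<longrightarrow> S' \<subseteq> C S \<longrightarrow>
            better_region D prec p \<inter> halfspaces w b S' = {} \<and> B S' = B S \<and> C S' = C S"
          by (intro allI impI *(2)[OF S])
      qed
      then show ?thesis ..
    qed
  qed
  then obtain BC where "\<And>p. part p (BC p)" by metis
  note part = this[unfolded part_def, rule_format]
  note BC = conjunct1[OF part] and BC' = conjunct2[OF part, rule_format]
  define B where "B S = fst (BC (opt S)) S" for S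
  define C where "C S = snd (BC (opt S)) S" for S
  have sub: "S \<subseteq> F (opt S)" and empty: "better_region D prec (opt S) \<inter> halfspaces w b S = {}"
    if S: "S \<subseteq> J" "S \<noteq> {}" for S
    using opt[OF S] S better_region_empty[OF tb opt[OF S]]
    by (auto simp: F_def optimum_def halfspaces_def)
  have top: "C S \<subseteq> F (opt S)" if "S \<subseteq> J" "S \<noteq> {}" for S
    unfolding C_def using BC[OF sub[OF that] empty[OF that]] by blast
  have "card {S. S \<subseteq> J \<and> card S = N \<and> k < card {i\<in>J. w i \<bullet> opt S + b i < 0}} \<le>
      card {S. S \<subseteq> J \<and> card S = N \<and> card (C S) < M - k}"
  proof (intro card_mono subsetI CollectI)
    fix S assume "S \<in> {S. S \<subseteq> J \<and> card S = N \<and> k < card {i\<in>J. w i \<bullet> opt S + b i < 0}}"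
    then have S: "S \<subseteq> J" "card S = N" "k < card {i\<in>J. w i \<bullet> opt S + b i < 0}" by auto
    then have ne: "S \<noteq> {}" using N by auto
    have "card (C S) \<le> card (F (opt S))"
      using J top[OF S(1) ne] by (intro card_mono) (auto simp: F_def)
    moreover have "card (F (opt S)) + card {i\<in>J. w i \<bullet> opt S + b i < 0} = M"
    proof -
      have "J = F (opt S) \<union> {i\<in>J. w i \<bullet> opt S + b i < 0}" by (auto simp: F_def)
      then have "M = card (F (opt S) \<union> {i\<in>J. w i \<bullet> opt S + b i < 0})" using J(2) by simp
      also have "\<dots> = card (F (opt S)) + card {i\<in>J. w i \<bullet> opt S + b i < 0}"
        using J(1) by (intro card_Un_disjoint) (auto simp: F_def)
      finally show ?thesis by simp
    qed
    ultimately show "S \<subseteq> J \<and> card S = N \<and> card (C S) < M - k" using S by linarith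
  qed (use J in simp)
  also have "real (card {S. S \<subseteq> J \<and> card S = N \<and> card (C S) < M - k}) \<le>
      (\<Sum>i<DIM('z). real ((M - (M - k) + i) choose i) * real ((M - k - 1 - i) choose (N - i)))"
  proof (rule card_small_top_sets_le[OF J N])
    fix S assume S: "S \<subseteq> J" "S \<noteq> {}"
    have "F (opt S) \<subseteq> J" by (auto simp: F_def)
    then show "B S \<subseteq> S \<and> S \<subseteq> C S \<and> C S \<subseteq> J \<and> card (B S) \<le> DIM('z)"
      using BC[OF sub[OF S] empty[OF S]] by (auto simp: B_def C_def)
    fix S' assume S': "S' \<noteq> {}" "B S \<subseteq> S'" "S' \<subseteq> C S"
    have *: "better_region D prec (opt S) \<inter> halfspaces w b S' = {} \<and>
        fst (BC (opt S)) S' = fst (BC (opt S)) S \<and> snd (BC (opt S)) S' = snd (BC (opt S)) S"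
      using S' by (intro BC'[OF sub[OF S] empty[OF S]]) (auto simp: B_def C_def)
    have sub': "S' \<subseteq> F (opt S)" using S'(3) top[OF S] by blast
    have "opt S' = opt S"
    proof (rule optimum_eqI)
      show "optimum prec (D \<inter> halfspaces w b S') (opt S')"
        using S'(1) sub' by (intro opt) (auto simp: F_def)
      show "opt S \<in> D \<inter> halfspaces w b S'"
        using opt[OF S] sub' by (auto simp: optimum_def F_def halfspaces_def)
    qed (use * in blast)
    then show "B S' = B S \<and> C S' = C S" using * by (simp add: B_def C_def)
  qed simp
  finally show ?thesis using \<open>k \<le> M\<close> by simp
qed

section \<open>The scenario bound\<close>

lemma product_space_frequency_bound:
  assumes "prob_space Q" and U: "U \<in> sets Q" and L: "finite L" "L \<noteq> {}"
    and "\<rho>' \<le> \<rho>" "\<rho> \<le> measure Q U"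
  shows "measure (PiM L (\<lambda>_. Q)) {y \<in> space (PiM L (\<lambda>_. Q)). (\<Sum>l\<in>L. indicator U (y l)) \<le> \<rho>' * real (card L)}
    \<le> exp (- 2 * real (card L) * (\<rho> - \<rho>')\<^sup>2)"
proof -
  let ?P = "PiM L (\<lambda>_. Q)" and ?X = "\<lambda>l y. indicator U (y l) :: real"
  interpret Q: prob_space Q by fact
  interpret P: prob_space ?P by (intro prob_space_PiM) (rule assms(1))
  have X: "?X l \<in> borel_measurable ?P" if "l \<in> L" for l
    using measurable_component_singleton[OF that, of "\<lambda>_. Q"] U by measurable
  have coord: "(\<lambda>y. y l) \<in> ?P \<rightarrow>\<^sub>M Q" if "l \<in> L" for l
    using that by (rule measurable_component_singleton)
  have marginal: "distr ?P Q (\<lambda>y. y l) = Q" if "l \<in> L" for l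
    using distr_PiM_component[of L "\<lambda>_. Q" l] assms(1) that by simp
  have "P.indep_vars (\<lambda>_. Q) (\<lambda>l y. y l) L"
  proof (rule P.indep_vars_iff_distr_eq_PiM'[THEN iffD2, OF L(2)])
    have "distr ?P (PiM L (\<lambda>_. Q)) (\<lambda>x. \<lambda>i\<in>L. x i) = distr ?P ?P (\<lambda>x. x)"
      by (intro distr_cong refl) (auto simp: space_PiM)
    also have "\<dots> = ?P" by (rule distr_id)
    also have "\<dots> = (\<Pi>\<^sub>M i\<in>L. distr ?P Q (\<lambda>x. x i))"
      by (rule PiM_cong[OF refl]) (simp only: marginal)
    finally show "distr ?P (PiM L (\<lambda>_. Q)) (\<lambda>x. \<lambda>i\<in>L. x i) = (\<Pi>\<^sub>M i\<in>L. distr ?P Q (\<lambda>x. x i))" .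
  qed (rule coord)
  then have indep: "P.indep_vars (\<lambda>_. borel) ?X L"
    by (rule P.indep_vars_compose2[where Y = "\<lambda>_. indicator U"]) (rule borel_measurable_indicator[OF U])
  have exp_X: "P.expectation (?X l) = measure Q U" if "l \<in> L" for l
  proof -
    have "P.expectation (?X l) = (\<integral>w. indicator U w \<partial>distr ?P Q (\<lambda>y. y l))"
      using U by (intro integral_distr[symmetric] coord[OF that]) auto
    also have "distr ?P Q (\<lambda>y. y l) = Q"
      using that by (rule marginal)
    finally show ?thesis using U by simp
  qed
  have mu: "(\<Sum>l\<in>L. P.expectation (?X l)) = real (card L) * measure Q U"
    using exp_X by simp
  interpret H: Hoeffding_ineq ?P L ?X "\<lambda>_. 0" "\<lambda>_. 1" "real (card L) * measure Q U"
  proof unfold_locales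
    show "real (card L) * measure Q U \<equiv> (\<Sum>l\<in>L. P.expectation (?X l))"
      using mu by (intro eq_reflection) simp
  qed (use L indep in \<open>auto simp: indicator_def\<close>)
  define e where "e = real (card L) * (measure Q U - \<rho>')"
  have card: "real (card L) > 0" using L by (simp add: card_gt_0_iff)
  have e: "e \<ge> 0" using assms card by (simp add: e_def)
  have "P.prob {y \<in> space ?P. (\<Sum>l\<in>L. ?X l y) \<le> \<rho>' * real (card L)} =
      P.prob {y \<in> space ?P. (\<Sum>l\<in>L. ?X l y) \<le> real (card L) * measure Q U - e}"
    by (simp add: e_def algebra_simps)
  also have "\<dots> \<le> exp (- 2 * e\<^sup>2 / (\<Sum>l\<in>L. (1 - 0)\<^sup>2))"
    using e card by (intro H.Hoeffding_ineq_le) auto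
  also have "- 2 * e\<^sup>2 / (\<Sum>l\<in>L. (1 - 0)\<^sup>2) = - 2 * real (card L) * (measure Q U - \<rho>')\<^sup>2"
    using card by (simp add: e_def power2_eq_square)
  also have "exp \<dots> \<le> exp (- 2 * real (card L) * (\<rho> - \<rho>')\<^sup>2)"
  proof -
    have "(\<rho> - \<rho>')\<^sup>2 \<le> (measure Q U - \<rho>')\<^sup>2" using assms by (intro power_mono) auto
    then show ?thesis using card by (simp add: mult_left_mono)
  qed
  finally show ?thesis .
qed

text \<open>
  A program with the deterministic constraint set \<open>D\<close> and the random half-spaces \<open>{p. 0 \<le> a w \<bullet> p}\<close>, of
  which \<open>N\<close> independent ones are sampled from \<open>Q\<close>. An optimizer is assumed for exactly \<open>N\<close>
  constraints only; as samples may repeat, this covers smaller numbers too.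
\<close>

locale scenario_program = prob_space Q
  for Q :: "'w measure" and a :: "'w \<Rightarrow> 'z::euclidean_space"
    and prec :: "'z \<Rightarrow> 'z \<Rightarrow> bool" and D :: "'z set"
    and N :: nat and sel :: "(nat \<Rightarrow> 'w) \<Rightarrow> 'z" +
  assumes a [measurable]: "a \<in> borel_measurable Q"
    and sel [measurable]: "sel \<in> borel_measurable (PiM {1..N} (\<lambda>_. Q))"
    and prec: "tie_break_rule prec" and D: "convex D" and N: "DIM('z) < N"
    and sel_optimum: "\<And>s. s \<in> space (PiM {1..N} (\<lambda>_. Q)) \<Longrightarrow>
      optimum prec (D \<inter> halfspaces (\<lambda>l. a (s l)) (\<lambda>_. 0) {1..N}) (sel s)"
begin

abbreviation sample_space :: "nat set \<Rightarrow> (nat \<Rightarrow> 'w) measure" where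
  "sample_space J \<equiv> PiM J (\<lambda>_. Q)"

lemma sel_optimum_reindex:
  assumes x: "x \<in> space (sample_space J)" and \<tau>: "\<tau> ` {1..N} = T" "T \<subseteq> J"
  shows "optimum prec (D \<inter> halfspaces (\<lambda>l. a (x l)) (\<lambda>_. 0) T) (sel (\<lambda>l\<in>{1..N}. x (\<tau> l)))"
proof -
  have "(\<lambda>l\<in>{1..N}. x (\<tau> l)) \<in> space (sample_space {1..N})"
    using x \<tau> by (auto simp: space_PiM PiE_iff)
  from sel_optimum[OF this] show ?thesis
    unfolding \<tau>(1)[symmetric] by (simp add: halfspaces_def)
qed

text \<open>
  The optimizer of the first \<open>N\<close> points of a sample indexed by \<open>J\<close> violates more than \<open>k\<close> of its constraints.
\<close>

definition many_violated :: "nat \<Rightarrow> nat set \<Rightarrow> (nat \<Rightarrow> 'w) \<Rightarrow> bool" where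
  "many_violated k J x \<longleftrightarrow> k < card {l\<in>J. a (x l) \<bullet> sel (restrict x {1..N}) < 0}"

lemma many_violated_conv:
  assumes "finite J"
  shows "many_violated k J x \<longleftrightarrow>
    real k < (\<Sum>l\<in>J. indicator {w. a w \<bullet> sel (restrict x {1..N}) < 0} (x l))"
proof -
  have "(\<Sum>l\<in>J. indicator {w. a w \<bullet> sel (restrict x {1..N}) < 0} (x l)) =
      real (card {l\<in>J. a (x l) \<bullet> sel (restrict x {1..N}) < 0})"
    using assms by (simp add: indicator_def sum.If_cases Int_def)
  then show ?thesis by (simp add: many_violated_def)
qed

lemma measurable_many_violated:
  assumes "{1..N} \<subseteq> J" "finite J"
  shows "Measurable.pred (sample_space J) (many_violated k J)"
proof -
  have [measurable]: "(\<lambda>x. restrict x {1..N}) \<in> sample_space J \<rightarrow>\<^sub>M sample_space {1..N}"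
    using assms(1) by (rule measurable_restrict_subset)
  have [measurable]: "(\<lambda>x. a (x l)) \<in> borel_measurable (sample_space J)" if "l \<in> J" for l
    using measurable_compose[OF measurable_component_singleton[OF that, of "\<lambda>_. Q"] a] .
  have "{x \<in> space (sample_space J). a (x l) \<bullet> sel (restrict x {1..N}) < 0} \<in> sets (sample_space J)"
    if "l \<in> J" for l using that by measurable
  then have "(\<lambda>x. indicator {w. a w \<bullet> sel (restrict x {1..N}) < 0} (x l) :: real) \<in> borel_measurable (sample_space J)"
    if "l \<in> J" for l using that
    by (subst measurable_cong[where g = "indicator {x \<in> space (sample_space J). a (x l) \<bullet> sel (restrict x {1..N}) < 0}"])
      (auto simp: indicator_def)
  then show ?thesis
    unfolding many_violated_conv[OF assms(2)] by measurable
qed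

text \<open>
  By exchangeability, the optimizers of all subsamples of size \<open>N\<close> violate more than \<open>k\<close> constraints
  with the same probability, so that the counting bound applies to the expected number of such subsamples.
\<close>

lemma many_violated_prob_le:
  assumes "k \<le> N + K"
  shows "real ((N + K) choose N) *
      measure (sample_space {1..N + K}) {x \<in> space (sample_space {1..N + K}). many_violated k {1..N + K} x}
    \<le> (\<Sum>i<DIM('z). real ((k + i) choose i) * real ((N + K - k - 1 - i) choose (N - i)))"
proof -
  let ?J = "{1..N + K}"
  let ?P = "sample_space ?J"
  let ?E = "{x \<in> space ?P. many_violated k ?J x}"
  interpret P: prob_space ?P by (intro prob_space_PiM prob_space_axioms)
  define \<I> where "\<I> = {I. I \<subseteq> ?J \<and> card I = N}"
  have fin: "finite \<I>" by (simp add: \<I>_def)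
  have card_I: "card \<I> = (N + K) choose N" unfolding \<I>_def by (simp add: n_subsets)
  have "\<exists>\<pi>. bij_betw \<pi> ?J ?J \<and> \<pi> ` {1..N} = I" if I: "I \<in> \<I>" for I
  proof -
    have finI: "finite I" "I \<subseteq> ?J" "card I = N" using I by (auto simp: \<I>_def intro: finite_subset)
    obtain f where f: "bij_betw f {1..N} I"
      using finite_same_card_bij[of "{1..N}" I] finI by auto
    obtain g where g: "bij_betw g (?J - {1..N}) (?J - I)"
      using finite_same_card_bij[of "?J - {1..N}" "?J - I"] finI by (auto simp: card_Diff_subset)
    let ?\<pi> = "\<lambda>l. if l \<in> {1..N} then f l else g l"
    have "bij_betw ?\<pi> ({1..N} \<union> (?J - {1..N})) (I \<union> (?J - I))"
      using f g by (rule bij_betw_disjoint_Un) auto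
    moreover have "{1..N} \<union> (?J - {1..N}) = ?J" "I \<union> (?J - I) = ?J" using finI by auto
    moreover have "?\<pi> ` {1..N} = I" using f by (auto simp: bij_betw_def)
    ultimately show ?thesis by (intro exI[of _ ?\<pi>]) simp
  qed
  then have "\<forall>I\<in>\<I>. \<exists>\<pi>. bij_betw \<pi> ?J ?J \<and> \<pi> ` {1..N} = I" by blast
  from bchoice[OF this] obtain \<pi> where
    "\<forall>I\<in>\<I>. bij_betw (\<pi> I) ?J ?J \<and> \<pi> I ` {1..N} = I" ..
  then have \<pi>: "bij_betw (\<pi> I) ?J ?J" "\<pi> I ` {1..N} = I" if "I \<in> \<I>" for I
    using that by auto
  have meas_E: "?E \<in> sets ?P" using measurable_many_violated[of ?J k] by simp
  define \<Phi> where "\<Phi> I x = (\<lambda>l\<in>?J. x (\<pi> I l))" for I and x :: "nat \<Rightarrow> 'w"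
  have \<Phi>: "\<Phi> I \<in> ?P \<rightarrow>\<^sub>M ?P" "distr ?P ?P (\<Phi> I) = ?P" if "I \<in> \<I>" for I
  proof -
    have "\<pi> I ` ?J \<subseteq> ?J" "inj_on (\<pi> I) ?J" using \<pi>(1)[OF that] by (auto simp: bij_betw_def)
    then show "\<Phi> I \<in> ?P \<rightarrow>\<^sub>M ?P" unfolding \<Phi>_def
      by (intro measurable_restrict measurable_component_singleton) blast
    show "distr ?P ?P (\<Phi> I) = ?P"
      unfolding \<Phi>_def using distr_PiM_reindex[of ?J "\<lambda>_. Q" "\<pi> I" ?J] \<open>\<pi> I ` ?J \<subseteq> ?J\<close> \<open>inj_on (\<pi> I) ?J\<close>
        prob_space_axioms by auto
  qed
  have same: "measure ?P (\<Phi> I -` ?E \<inter> space ?P) = measure ?P ?E" if "I \<in> \<I>" for I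
    using measure_distr[OF \<Phi>(1)[OF that] meas_E] \<Phi>(2)[OF that] by simp
  have pointwise: "(\<Sum>I\<in>\<I>. indicator (\<Phi> I -` ?E \<inter> space ?P) x) \<le>
      (\<Sum>i<DIM('z). real ((k + i) choose i) * real ((N + K - k - 1 - i) choose (N - i)))"
    if x: "x \<in> space ?P" for x
  proof -
    let ?w = "\<lambda>l. a (x l)"
    have "\<exists>p. optimum prec (D \<inter> halfspaces ?w (\<lambda>_. 0) S) p" if S: "S \<subseteq> ?J" "S \<noteq> {}" for S
    proof (rule optimum_exists[OF prec D N])
      show "finite S" using S(1) by (rule finite_subset) simp
      show "S \<noteq> {}" by fact
      fix T assume T: "T \<subseteq> S" "T \<noteq> {}" "card T \<le> N"
      have finT: "finite T" using T(1) \<open>finite S\<close> by (rule finite_subset)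
      obtain \<tau> where "\<tau> ` {1..N} = T"
      proof -
        obtain f where f: "bij_betw f {1..card T} T"
          using finite_same_card_bij[of "{1..card T}" T] finT by auto
        obtain t where t: "t \<in> T" using T(2) by blast
        have "(\<lambda>l. if l \<in> {1..card T} then f l else t) ` {1..N} = T"
          using f t T(3) by (fastforce simp: bij_betw_def image_iff)
        then show ?thesis by (rule that)
      qed
      then show "\<exists>p. optimum prec (D \<inter> halfspaces ?w (\<lambda>_. 0) T) p"
        using sel_optimum_reindex[OF x] T(1) S(1) by blast
    qed
    then obtain p where p: "\<And>S. S \<subseteq> ?J \<Longrightarrow> S \<noteq> {} \<Longrightarrow> optimum prec (D \<inter> halfspaces ?w (\<lambda>_. 0) S) (p S)"
      by metis
    have p_eq: "p I = sel (restrict (\<Phi> I x) {1..N})" if I: "I \<in> \<I>" for I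
    proof (rule optimum_unique[OF prec p])
      show "I \<subseteq> ?J" "I \<noteq> {}" using I N by (auto simp: \<I>_def)
      then show "optimum prec (D \<inter> halfspaces ?w (\<lambda>_. 0) I) (sel (restrict (\<Phi> I x) {1..N}))"
        using sel_optimum_reindex[OF x \<pi>(2)[OF I]]
        by (simp add: \<Phi>_def restrict_restrict Int_absorb1)
    qed
    have "(\<Phi> I x \<in> ?E) \<longleftrightarrow> k < card {l\<in>?J. ?w l \<bullet> p I + 0 < 0}" if I: "I \<in> \<I>" for I
    proof -
      have "\<Phi> I x \<in> space ?P" using measurable_space[OF \<Phi>(1)[OF I] x] .
      moreover have "bij_betw (\<pi> I) {l\<in>?J. a (\<Phi> I x l) \<bullet> p I < 0} {l\<in>?J. ?w l \<bullet> p I < 0}"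
      proof -
        have inj: "inj_on (\<pi> I) ?J" and img: "\<pi> I ` ?J = ?J" using \<pi>(1)[OF I] by (auto simp: bij_betw_def)
        have "\<pi> I ` {l\<in>?J. ?w (\<pi> I l) \<bullet> p I < 0} = {l\<in>\<pi> I ` ?J. ?w l \<bullet> p I < 0}" by blast
        moreover have "{l\<in>?J. a (\<Phi> I x l) \<bullet> p I < 0} = {l\<in>?J. ?w (\<pi> I l) \<bullet> p I < 0}"
          by (auto simp: \<Phi>_def)
        ultimately show ?thesis using inj img by (auto simp: bij_betw_def intro: inj_on_subset)
      qed
      ultimately show ?thesis
        using bij_betw_same_card p_eq[OF I] by (fastforce simp: many_violated_def)
    qed
    then have "(\<Sum>I\<in>\<I>. indicator (\<Phi> I -` ?E \<inter> space ?P) x) =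
        real (card {I\<in>\<I>. k < card {l\<in>?J. ?w l \<bullet> p I + 0 < 0}})"
      using fin x by (simp add: indicator_def sum.If_cases Int_def cong: conj_cong)
    also have "{I\<in>\<I>. k < card {l\<in>?J. ?w l \<bullet> p I + 0 < 0}} =
        {S. S \<subseteq> ?J \<and> card S = N \<and> k < card {l\<in>?J. ?w l \<bullet> p S + 0 < 0}}"
      by (auto simp: \<I>_def)
    also have "real (card \<dots>) \<le> (\<Sum>i<DIM('z). real ((k + i) choose i) * real ((N + K - k - 1 - i) choose (N - i)))"
      using N assms by (intro card_violating_subsamples_le[OF prec D _ _ _ _ _ p]) auto
    finally show ?thesis .
  qed
  have meas_I: "\<Phi> I -` ?E \<inter> space ?P \<in> sets ?P" if "I \<in> \<I>" for I
    using measurable_sets[OF \<Phi>(1)[OF that] meas_E] .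
  have int_I: "integrable ?P (indicator (\<Phi> I -` ?E \<inter> space ?P) :: _ \<Rightarrow> real)" if "I \<in> \<I>" for I
    by (rule integrable_real_indicator[OF meas_I[OF that]]) (simp only: P.emeasure_eq_measure ennreal_less_top infinity_ennreal_def)
  have "real ((N + K) choose N) * measure ?P ?E = (\<Sum>I\<in>\<I>. measure ?P (\<Phi> I -` ?E \<inter> space ?P))"
    using same by (simp add: card_I)
  also have "\<dots> = (\<Sum>I\<in>\<I>. P.expectation (indicator (\<Phi> I -` ?E \<inter> space ?P)))"
    using meas_I by (intro sum.cong refl) (simp add: Int_absorb2 sets.sets_into_space)
  also have "\<dots> = P.expectation (\<lambda>x. \<Sum>I\<in>\<I>. indicator (\<Phi> I -` ?E \<inter> space ?P) x)"
    by (rule Bochner_Integration.integral_sum[OF int_I, symmetric])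
  also have "\<dots> \<le> P.expectation (\<lambda>_. \<Sum>i<DIM('z). real ((k + i) choose i) * real ((N + K - k - 1 - i) choose (N - i)))"
  proof (intro integral_mono pointwise)
    show "integrable ?P (\<lambda>x. \<Sum>I\<in>\<I>. indicator (\<Phi> I -` ?E \<inter> space ?P) x :: real)"
      by (rule Bochner_Integration.integrable_sum[OF int_I])
  qed (rule P.integrable_const)
  also have "\<dots> = (\<Sum>i<DIM('z). real ((k + i) choose i) * real ((N + K - k - 1 - i) choose (N - i)))"
    unfolding lebesgue_integral_const P.prob_space by simp
  finally show ?thesis .
qed

text \<open>
  The probability that a fresh constraint excludes \<open>p\<close>.
\<close>

definition violation :: "'z \<Rightarrow> real" where
  "violation p = measure Q {w \<in> space Q. a w \<bullet> p < 0}"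

lemma measurable_violation: "(\<lambda>s. violation (sel s)) \<in> borel_measurable (sample_space {1..N})"
proof -
  have "{z \<in> space (sample_space {1..N} \<Otimes>\<^sub>M Q). a (snd z) \<bullet> sel (fst z) < 0} \<in> sets (sample_space {1..N} \<Otimes>\<^sub>M Q)"
    by measurable
  from measurable_emeasure_Pair[OF this]
  have "(\<lambda>s. enn2real (emeasure Q (Pair s -` {z \<in> space (sample_space {1..N} \<Otimes>\<^sub>M Q). a (snd z) \<bullet> sel (fst z) < 0})))
      \<in> borel_measurable (sample_space {1..N})" by measurable
  then show ?thesis
    by (rule measurable_cong[THEN iffD1, rotated])
      (auto simp: violation_def measure_def space_pair_measure intro!: arg_cong[of _ _ "\<lambda>A. enn2real (emeasure Q A)"])
qed

text \<open>
  If the violation probability of the optimizer exceeds \<open>\<rho>\<close>, then by Hoeffding's inequality it violates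
  more than \<open>\<rho>' * K\<close> of \<open>K\<close> fresh constraints, except with a probability that is exponentially
  small in \<open>K\<close> when \<open>\<rho>' < \<rho>\<close>.
\<close>

lemma many_violated_prob_ge:
  fixes \<rho> \<rho>' :: real
  assumes "0 < \<rho>'" "\<rho>' \<le> \<rho>" "0 < K"
  shows "measure (sample_space {1..N}) {s \<in> space (sample_space {1..N}). \<rho> < violation (sel s)} *
      (1 - exp (- 2 * real K * (\<rho> - \<rho>')\<^sup>2)) \<le>
    measure (sample_space {1..N + K})
      {x \<in> space (sample_space {1..N + K}). many_violated (nat \<lfloor>\<rho>' * real K\<rfloor>) {1..N + K} x}"
proof -
  let ?k = "nat \<lfloor>\<rho>' * real K\<rfloor>"
  let ?I = "{1..N}" and ?L = "{Suc N..N + K}" and ?J = "{1..N + K}"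
  let ?E = "{x \<in> space (sample_space ?J). many_violated ?k ?J x}"
  let ?G = "{s \<in> space (sample_space ?I). \<rho> < violation (sel s)}"
  let ?q = "1 - exp (- 2 * real K * (\<rho> - \<rho>')\<^sup>2)"
  have IL: "?I \<inter> ?L = {}" "?I \<union> ?L = ?J" by auto
  interpret PI: prob_space "sample_space ?I" by (intro prob_space_PiM prob_space_axioms)
  interpret PL: prob_space "sample_space ?L" by (intro prob_space_PiM prob_space_axioms)
  interpret PJ: prob_space "sample_space ?J" by (intro prob_space_PiM prob_space_axioms)
  interpret pp: product_sigma_finite "\<lambda>_. Q" by unfold_locales
  have E: "?E \<in> sets (sample_space ?J)" using measurable_many_violated[of ?J ?k] by simp
  have G: "?G \<in> sets (sample_space ?I)" using measurable_violation by measurable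
  have mrg: "merge ?I ?L \<in> sample_space ?I \<Otimes>\<^sub>M sample_space ?L \<rightarrow>\<^sub>M sample_space ?J"
    using measurable_merge[of ?I ?L "\<lambda>_. Q"] unfolding IL(2) .
  let ?E' = "merge ?I ?L -` ?E \<inter> space (sample_space ?I \<Otimes>\<^sub>M sample_space ?L)"
  have E': "?E' \<in> sets (sample_space ?I \<Otimes>\<^sub>M sample_space ?L)" using measurable_sets[OF mrg E] .
  have q: "0 \<le> ?q" by simp
  have fiber: "ennreal ?q \<le> emeasure (sample_space ?L) (Pair s -` ?E')" if s: "s \<in> ?G" for s
  proof -
    let ?U = "{w \<in> space Q. a w \<bullet> sel s < 0}"
    let ?A = "{y \<in> space (sample_space ?L). (\<Sum>l\<in>?L. indicator ?U (y l)) \<le> \<rho>' * real (card ?L)}"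
    have U: "?U \<in> sets Q" by measurable
    have "measure (sample_space ?L) ?A \<le> exp (- 2 * real (card ?L) * (\<rho> - \<rho>')\<^sup>2)"
      using s assms by (intro product_space_frequency_bound prob_space_axioms U) (auto simp: violation_def)
    then have "?q \<le> 1 - measure (sample_space ?L) ?A" by simp
    also have "\<dots> = measure (sample_space ?L) (space (sample_space ?L) - ?A)"
    proof (rule PL.prob_compl[symmetric])
      have "(\<lambda>y. indicator ?U (y l) :: real) \<in> borel_measurable (sample_space ?L)" if "l \<in> ?L" for l
        using measurable_compose[OF measurable_component_singleton[OF that, of "\<lambda>_. Q"]
            borel_measurable_indicator[OF U]] .
      then show "?A \<in> sets (sample_space ?L)" by measurable
    qed
    also have "\<dots> \<le> measure (sample_space ?L) (Pair s -` ?E')"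
    proof (rule PL.finite_measure_mono)
      show "Pair s -` ?E' \<in> sets (sample_space ?L)" using E' by (rule sets_Pair1)
      show "space (sample_space ?L) - ?A \<subseteq> Pair s -` ?E'"
      proof
        fix y assume y: "y \<in> space (sample_space ?L) - ?A"
        have sy: "(s, y) \<in> space (sample_space ?I \<Otimes>\<^sub>M sample_space ?L)"
          using s y by (simp add: space_pair_measure)
        let ?x = "merge ?I ?L (s, y)"
        have x: "?x \<in> space (sample_space ?J)" using measurable_space[OF mrg sy] .
        have "s \<in> extensional ?I" using s by (auto simp: space_PiM PiE_def)
        then have res: "restrict ?x ?I = s" using IL(1) by (simp add: restrict_merge extensional_restrict)
        have "real ?k \<le> \<rho>' * real K" using assms by (simp add: of_nat_nat)
        also have "\<dots> < (\<Sum>l\<in>?L. indicator ?U (y l))" using y by (auto simp: not_le)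
        also have "\<dots> \<le> (\<Sum>l\<in>?J. indicator {w. a w \<bullet> sel (restrict ?x ?I) < 0} (?x l))"
        proof -
          have "(\<Sum>l\<in>?L. indicator ?U (y l)) \<le> (\<Sum>l\<in>?L. indicator {w. a w \<bullet> sel (restrict ?x ?I) < 0} (?x l) :: real)"
            unfolding res by (intro sum_mono) (auto simp: indicator_def merge_def)
          also have "\<dots> \<le> (\<Sum>l\<in>?J. indicator {w. a w \<bullet> sel (restrict ?x ?I) < 0} (?x l))"
            by (intro sum_mono2) auto
          finally show ?thesis .
        qed
        finally have "many_violated ?k ?J ?x" by (simp add: many_violated_conv)
        then show "y \<in> Pair s -` ?E'" using x sy by simp
      qed
    qed
    finally show ?thesis by (simp add: PL.emeasure_eq_measure ennreal_leI)
  qed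
  have "ennreal (measure (sample_space ?I) ?G * ?q) = (\<integral>\<^sup>+s. ennreal ?q * indicator ?G s \<partial>sample_space ?I)"
    unfolding nn_integral_cmult_indicator[OF G] PI.emeasure_eq_measure
    using q by (simp add: ennreal_mult' mult.commute)
  also have "\<dots> \<le> (\<integral>\<^sup>+s. emeasure (sample_space ?L) (Pair s -` ?E') \<partial>sample_space ?I)"
    using fiber by (intro nn_integral_mono) (auto simp: indicator_def)
  also have "\<dots> = emeasure (sample_space ?I \<Otimes>\<^sub>M sample_space ?L) ?E'"
    using PL.emeasure_pair_measure_alt[OF E'] by simp
  also have "\<dots> = emeasure (distr (sample_space ?I \<Otimes>\<^sub>M sample_space ?L) (sample_space ?J) (merge ?I ?L)) ?E"
    by (rule emeasure_distr[OF mrg E, symmetric])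
  also have "\<dots> = emeasure (sample_space ?J) ?E"
    using pp.distr_merge[OF IL(1)] unfolding IL(2) by simp
  finally show ?thesis
    unfolding PJ.emeasure_eq_measure by (subst (asm) ennreal_le_iff) auto
qed

text \<open>
  The Campi--Garatti bound: the right-hand side is the probability that a binomial variable with
  parameters \<open>N\<close> and \<open>\<rho>\<close> is less than the dimension. Degenerate programs are included.
\<close>

theorem violation_prob_le:
  assumes \<rho>: "0 < \<rho>" "\<rho> < 1"
  shows "measure (sample_space {1..N}) {s \<in> space (sample_space {1..N}). \<rho> < violation (sel s)} \<le>
    (\<Sum>i<DIM('z). real (N choose i) * \<rho> ^ i * (1 - \<rho>) ^ (N - i))"
proof -
  let ?p = "measure (sample_space {1..N}) {s \<in> space (sample_space {1..N}). \<rho> < violation (sel s)}"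
  let ?tail = "\<lambda>\<rho>. \<Sum>i<DIM('z). real (N choose i) * \<rho> ^ i * (1 - \<rho>) ^ (N - i)"
  \<comment> \<open>Let \<open>K\<close> tend to infinity with a threshold \<open>\<rho>'\<close> below \<open>\<rho>\<close>, then let \<open>\<rho>'\<close> tend to \<open>\<rho>\<close>.\<close>
  have smaller: "?p \<le> ?tail \<rho>'" if \<rho>': "0 < \<rho>'" "\<rho>' < \<rho>" for \<rho>'
  proof (rule LIMSEQ_le)
    let ?k = "\<lambda>K. nat \<lfloor>\<rho>' * real K\<rfloor>"
    have "(\<lambda>K. exp (- 2 * real K * (\<rho> - \<rho>')\<^sup>2)) \<longlonglongrightarrow> 0"
    proof -
      have "0 < (\<rho> - \<rho>')\<^sup>2" using \<rho>' by simp
      then show ?thesis by real_asymp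
    qed
    then show "(\<lambda>K. ?p * (1 - exp (- 2 * real K * (\<rho> - \<rho>')\<^sup>2))) \<longlonglongrightarrow> ?p"
      using tendsto_mult[OF tendsto_const tendsto_diff[OF tendsto_const], of _ 0 sequentially ?p 1] by simp
    show "(\<lambda>K. (\<Sum>i<DIM('z). real ((?k K + i) choose i) * real ((N + K - ?k K - 1 - i) choose (N - i)))
        / real ((N + K) choose N)) \<longlonglongrightarrow> ?tail \<rho>'"
      using \<rho> \<rho>' N by (intro violation_fraction_tendsto) auto
    have "?p * (1 - exp (- 2 * real K * (\<rho> - \<rho>')\<^sup>2)) \<le>
        (\<Sum>i<DIM('z). real ((?k K + i) choose i) * real ((N + K - ?k K - 1 - i) choose (N - i)))
        / real ((N + K) choose N)" if K: "1 \<le> K" for K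
    proof -
      let ?e = "measure (sample_space {1..N + K})
          {x \<in> space (sample_space {1..N + K}). many_violated (?k K) {1..N + K} x}"
      have "\<rho>' * real K \<le> real K" using \<rho> \<rho>' by (simp add: mult_left_le_one_le)
      then have "?k K \<le> N + K" by linarith
      note many_violated_prob_le[OF this]
      moreover have "0 < real ((N + K) choose N)" by simp
      ultimately have "?e \<le> (\<Sum>i<DIM('z). real ((?k K + i) choose i) * real ((N + K - ?k K - 1 - i) choose (N - i)))
        / real ((N + K) choose N)" by (simp add: pos_le_divide_eq mult.commute)
      moreover have "?p * (1 - exp (- 2 * real K * (\<rho> - \<rho>')\<^sup>2)) \<le> ?e"
        using \<rho>' K by (intro many_violated_prob_ge) auto
      ultimately show ?thesis by linarith
    qed
    then show "\<exists>K0. \<forall>K\<ge>K0. ?p * (1 - exp (- 2 * real K * (\<rho> - \<rho>')\<^sup>2)) \<le>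
        (\<Sum>i<DIM('z). real ((?k K + i) choose i) * real ((N + K - ?k K - 1 - i) choose (N - i)))
        / real ((N + K) choose N)" by blast
  qed
  have "(?tail \<longlongrightarrow> ?tail \<rho>) (at_left \<rho>)" by (intro tendsto_intros)
  moreover have "\<forall>\<^sub>F \<rho>' in at_left \<rho>. ?p \<le> ?tail \<rho>'"
    unfolding eventually_at_left_field using smaller \<rho>(1) by blast
  ultimately show ?thesis by (rule tendsto_lowerbound) simp
qed

end

section \<open>Lipschitz functions and Markov decision processes\<close>

text \<open>
  One constant serves as a bound and as a Lipschitz constant.
\<close>

lemma LipE:
  fixes \<rho> :: "'s \<Rightarrow> 's \<Rightarrow> real"
  assumes "u \<in> Lip \<rho> S" "\<And>z w. 0 \<le> \<rho> z w"
  obtains B where "B \<ge> 0" "\<And>z. z \<in> S \<Longrightarrow> \<bar>u z\<bar> \<le> B" "\<And>z w. z \<in> S \<Longrightarrow> w \<in> S \<Longrightarrow> \<bar>u z - u w\<bar> \<le> B * \<rho> z w"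
proof -
  obtain B L where BL: "\<forall>z\<in>S. \<bar>u z\<bar> \<le> B" "\<forall>z\<in>S. \<forall>w\<in>S. \<bar>u z - u w\<bar> \<le> L * \<rho> z w"
    using assms(1) by (auto simp: Lip_def)
  have "L * \<rho> z w \<le> max 0 (max B L) * \<rho> z w" for z w
    using assms(2) by (intro mult_right_mono) auto
  then have "\<bar>u z - u w\<bar> \<le> max 0 (max B L) * \<rho> z w" if "z \<in> S" "w \<in> S" for z w
    using BL(2) that by (meson order_trans)
  moreover have "\<bar>u z\<bar> \<le> max 0 (max B L)" if "z \<in> S" for z
    using BL(1) that by (simp add: le_max_iff_disj)
  ultimately show ?thesis by (intro that[of "max 0 (max B L)"]) auto
qed

lemma lip_seminorm_bound:
  fixes \<rho> :: "'s \<Rightarrow> 's \<Rightarrow> real"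
  assumes "u \<in> Lip \<rho> S" and \<rho>: "\<And>z w. 0 \<le> \<rho> z w" "\<And>z w. \<rho> z w = 0 \<longleftrightarrow> z = w"
    and "z \<in> S" "w \<in> S"
  shows "\<bar>u z - u w\<bar> \<le> lip_seminorm \<rho> S u * \<rho> z w"
proof (cases "z = w")
  case False
  obtain B where B: "B \<ge> 0" "\<And>z. z \<in> S \<Longrightarrow> \<bar>u z\<bar> \<le> B"
      "\<And>z w. z \<in> S \<Longrightarrow> w \<in> S \<Longrightarrow> \<bar>u z - u w\<bar> \<le> B * \<rho> z w"
    using LipE[OF assms(1) \<rho>(1)] by blast
  have pos: "z \<noteq> w \<Longrightarrow> 0 < \<rho> z w" for z w using \<rho>[of z w] by linarith
  have "bdd_above (insert 0 {\<bar>u z - u w\<bar> / \<rho> z w | z w. z \<in> S \<and> w \<in> S \<and> z \<noteq> w})"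
    using B pos by (intro bdd_aboveI[of _ B]) (auto simp: pos_divide_le_eq)
  then have "\<bar>u z - u w\<bar> / \<rho> z w \<le> lip_seminorm \<rho> S u"
    unfolding lip_seminorm_def using False assms(4,5) by (intro cSup_upper) auto
  then show ?thesis using pos[OF False] by (simp add: pos_divide_le_eq)
next
  case True
  moreover have "\<rho> z w = 0" using True \<rho>(2) by blast
  ultimately show ?thesis by simp
qed

lemma sum_dist_nonneg: "0 \<le> sum_dist z w"
  by (simp add: sum_dist_def)

lemma sum_dist_eq_0: "sum_dist z w = 0 \<longleftrightarrow> z = w"
  by (cases z; cases w) (auto simp: sum_dist_def add_nonneg_eq_0_iff)

lemma sum_dist_le: "sum_dist z w \<le> 2 * dist z w"
  using dist_fst_le[of z w] dist_snd_le[of z w] by (simp add: sum_dist_def)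

lemma Lip_continuous_on:
  fixes u :: "'s::metric_space \<Rightarrow> real"
  assumes "u \<in> Lip \<rho> S" and \<rho>: "\<And>z w. 0 \<le> \<rho> z w" "\<And>z w. \<rho> z w \<le> 2 * dist z w"
  shows "continuous_on S u"
proof -
  obtain B where B: "B \<ge> 0" "\<And>z w. z \<in> S \<Longrightarrow> w \<in> S \<Longrightarrow> \<bar>u z - u w\<bar> \<le> B * \<rho> z w"
    by (rule LipE[OF assms(1,2)]) (rule that)
  have "(2 * B)-lipschitz_on S u"
  proof (rule lipschitz_onI)
    fix x y assume "x \<in> S" "y \<in> S"
    then have "dist (u x) (u y) \<le> B * \<rho> x y" using B by (simp add: dist_real_def)
    also have "\<dots> \<le> B * (2 * dist x y)" using B \<rho> by (intro mult_left_mono) auto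
    finally show "dist (u x) (u y) \<le> 2 * B * dist x y" by simp
  qed (use B in simp)
  then show ?thesis by (rule lipschitz_on_continuous_on)
qed

lemma Lip_lincomb:
  fixes f :: "'n::finite \<Rightarrow> 's \<Rightarrow> real"
  assumes "\<And>i. f i \<in> Lip \<rho> S" and \<rho>: "\<And>z w. 0 \<le> \<rho> z w"
  shows "lincomb f \<alpha> \<in> Lip \<rho> S"
proof -
  have "\<exists>B. \<forall>z\<in>S. \<forall>w\<in>S. \<bar>f i z\<bar> \<le> B \<and> \<bar>f i z - f i w\<bar> \<le> B * \<rho> z w" for i
    using LipE[OF assms] by metis
  then obtain B where B: "\<And>i z. z \<in> S \<Longrightarrow> \<bar>f i z\<bar> \<le> B i"
      "\<And>i z w. z \<in> S \<Longrightarrow> w \<in> S \<Longrightarrow> \<bar>f i z - f i w\<bar> \<le> B i * \<rho> z w"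
    by metis
  have "\<bar>lincomb f \<alpha> z\<bar> \<le> (\<Sum>i\<in>UNIV. \<bar>\<alpha> $ i\<bar> * B i)" if "z \<in> S" for z
    unfolding lincomb_def using B that
    by (intro order_trans[OF sum_abs] sum_mono) (auto simp: abs_mult intro!: mult_left_mono)
  moreover have "\<bar>lincomb f \<alpha> z - lincomb f \<alpha> w\<bar> \<le> (\<Sum>i\<in>UNIV. \<bar>\<alpha> $ i\<bar> * B i) * \<rho> z w"
    if "z \<in> S" "w \<in> S" for z w
  proof -
    have "lincomb f \<alpha> z - lincomb f \<alpha> w = (\<Sum>i\<in>UNIV. \<alpha> $ i * (f i z - f i w))"
      by (simp add: lincomb_def sum_subtractf right_diff_distrib)
    also have "\<bar>\<dots>\<bar> \<le> (\<Sum>i\<in>UNIV. \<bar>\<alpha> $ i\<bar> * (B i * \<rho> z w))"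
      using B that by (intro order_trans[OF sum_abs] sum_mono) (auto simp: abs_mult intro!: mult_left_mono)
    finally show ?thesis by (simp add: sum_distrib_right mult.assoc)
  qed
  ultimately show ?thesis by (auto simp: Lip_def)
qed

lemma lincomb_lipschitz_bound:
  fixes f :: "'n::finite \<Rightarrow> 's \<Rightarrow> real"
  assumes "\<And>i. \<bar>f i z - f i w\<bar> \<le> L" "l1_norm \<alpha> \<le> \<theta>" "0 \<le> L"
  shows "\<bar>lincomb f \<alpha> z - lincomb f \<alpha> w\<bar> \<le> \<theta> * L"
proof -
  have "lincomb f \<alpha> z - lincomb f \<alpha> w = (\<Sum>i\<in>UNIV. \<alpha> $ i * (f i z - f i w))"
    by (simp add: lincomb_def sum_subtractf right_diff_distrib)
  also have "\<bar>\<dots>\<bar> \<le> (\<Sum>i\<in>UNIV. \<bar>\<alpha> $ i\<bar> * L)"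
    using assms by (intro order_trans[OF sum_abs] sum_mono) (auto simp: abs_mult intro!: mult_left_mono)
  also have "\<dots> \<le> \<theta> * L" using assms by (simp add: l1_norm_def sum_distrib_right[symmetric] mult_right_mono)
  finally show ?thesis .
qed

lemma convex_l1_ball: "convex {\<alpha> :: real ^ 'n::finite. l1_norm \<alpha> \<le> \<theta>}"
proof (rule convexI)
  fix \<alpha> \<beta> :: "real ^ 'n" and u v :: real
  assume *: "\<alpha> \<in> {\<alpha>. l1_norm \<alpha> \<le> \<theta>}" "\<beta> \<in> {\<alpha>. l1_norm \<alpha> \<le> \<theta>}" "0 \<le> u" "0 \<le> v" "u + v = 1"
  have "l1_norm (u *\<^sub>R \<alpha> + v *\<^sub>R \<beta>) \<le> (\<Sum>i\<in>UNIV. u * \<bar>\<alpha> $ i\<bar> + v * \<bar>\<beta> $ i\<bar>)"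
    unfolding l1_norm_def using *(3,4)
    by (intro sum_mono) (auto intro!: order_trans[OF abs_triangle_ineq] simp: abs_mult)
  also have "\<dots> = u * l1_norm \<alpha> + v * l1_norm \<beta>"
    by (simp add: l1_norm_def sum.distrib sum_distrib_left)
  also have "\<dots> \<le> \<theta>" using * by (intro convex_bound_le) auto
  finally show "u *\<^sub>R \<alpha> + v *\<^sub>R \<beta> \<in> {\<alpha>. l1_norm \<alpha> \<le> \<theta>}" by simp
qed

lemma lincomb_add_scaleR: "lincomb f (u *\<^sub>R \<alpha> + v *\<^sub>R \<beta>) z = u * lincomb f \<alpha> z + v * lincomb f \<beta> z"
  by (simp add: lincomb_def sum.distrib sum_distrib_left algebra_simps)

lemma continuous_on_lincomb:
  "(\<And>i. continuous_on S (f i)) \<Longrightarrow> continuous_on S (lincomb f \<alpha>)"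
  unfolding lincomb_def[abs_def] by (intro continuous_intros)

locale lipschitz_mdp =
  fixes X :: "'x::euclidean_space set" and A :: "'a::euclidean_space set"
    and P :: "'x \<times> 'a \<Rightarrow> 'x measure" and \<gamma> :: real and \<nu>\<^sub>0 :: "'x measure"
    and \<pi>\<^sub>E :: "nat \<Rightarrow> (nat \<Rightarrow> 'x \<times> 'a) \<Rightarrow> 'x \<Rightarrow> 'a measure" and L\<^sub>P :: real
  assumes gamma: "0 < \<gamma>" "\<gamma> < 1"
    and kernel: "stochastic_kernel X A P"
    and init: "initial_distribution X \<nu>\<^sub>0"
    and expert: "policy X A \<pi>\<^sub>E"
    and model: "lipschitz_control_model X A P L\<^sub>P"
begin

abbreviation occ :: "('x \<times> 'a) measure" where
  "occ \<equiv> occupancy_measure X A P \<gamma> \<nu>\<^sub>0 \<pi>\<^sub>E"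

lemma compact_sets: "compact X" "compact A" "compact (X \<times> A)"
  using model by (auto simp: lipschitz_control_model_def compact_Times)

lemma borel_sets: "X \<in> sets borel" "A \<in> sets borel"
  using compact_sets by (auto intro: borel_compact)

lemma sets_occ [measurable_cong]: "sets occ = sets (borel_on (X \<times> A))"
proof -
  have "sets (borel_on (X \<times> A)) \<subseteq> Pow (X \<times> A)"
    using sets.space_closed[of "borel_on (X \<times> A)"] by (simp add: space_restrict_space)
  then show ?thesis
    unfolding occupancy_measure_def using sets.sigma_sets_eq[of "borel_on (X \<times> A)"]
    by (simp add: sets_measure_of space_restrict_space)
qed

lemma space_occ: "space occ = X \<times> A"
  using sets_eq_imp_space_eq[OF sets_occ] by (simp add: space_restrict_space)

lemma finite_measure_occ: "finite_measure occ"
proof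
  interpret IT: Ionescu_Tulcea "step_kernel X A P \<nu>\<^sub>0 \<pi>\<^sub>E" "\<lambda>_. borel_on (X \<times> A)"
    using borel_sets kernel init expert by (rule Ionescu_Tulcea_step_kernel)
  let ?T = "trajectory_law X A P \<nu>\<^sub>0 \<pi>\<^sub>E"
  have "distr IT.PF.lim (PiM {} (\<lambda>_. borel_on (X \<times> A))) (\<lambda>x. restrict x {}) = IT.CI {}"
    by (rule IT.distr_lim) simp
  then have prob: "prob_space (distr IT.PF.lim (PiM {} (\<lambda>_. borel_on (X \<times> A))) (\<lambda>x. restrict x {}))"
    using IT.PF.prob_space_P[of "{}"] by simp
  have meas: "(\<lambda>x. restrict x {}) \<in> IT.PF.lim \<rightarrow>\<^sub>M PiM {} (\<lambda>_. borel_on (X \<times> A))"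
    by (auto simp: measurable_cong_sets[OF IT.PF.sets_lim refl] intro!: measurable_restrict)
  have "prob_space ?T"
    unfolding trajectory_law_def by (rule prob_space_distrD[OF meas prob])
  then interpret T: prob_space ?T .
  have "emeasure occ (space occ) = (\<Sum>t. ennreal (\<gamma> ^ t) * emeasure ?T {\<omega> \<in> space ?T. \<omega> t \<in> space occ})"
    by (rule emeasure_occupancy_measure[OF borel_sets kernel init expert])
      (simp add: sets_occ[symmetric])
  also have "\<dots> \<le> (\<Sum>t. ennreal (\<gamma> ^ t))"
  proof (intro suminf_le summableI)
    fix t
    let ?S = "{\<omega> \<in> space ?T. \<omega> t \<in> space occ}"
    have "ennreal (\<gamma> ^ t) * emeasure ?T ?S \<le> ennreal (\<gamma> ^ t) * 1"
      by (intro mult_left_mono T.measure_le_1) simp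
    then show "ennreal (\<gamma> ^ t) * emeasure ?T ?S \<le> ennreal (\<gamma> ^ t)" by simp
  qed
  also have "\<dots> = ennreal (\<Sum>t. \<gamma> ^ t)"
    using gamma by (intro suminf_ennreal2) (auto intro: summable_geometric)
  also have "\<dots> < \<infinity>" by simp
  finally show "emeasure occ (space occ) \<noteq> \<infinity>" by simp
qed

lemma continuous_on_kernel_op: "continuous_on X u \<Longrightarrow> continuous_on (X \<times> A) (kernel_op P u)"
  using model by (auto simp: lipschitz_control_model_def)

lemma continuous_on_T_adj:
  assumes "continuous_on X u"
  shows "continuous_on (X \<times> A) (T_adj P \<gamma> u)"
proof -
  have "continuous_on (X \<times> A) (\<lambda>z. u (fst z))"
    by (rule continuous_on_compose2[OF assms continuous_on_fst[OF continuous_on_id]]) auto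
  then show ?thesis
    unfolding T_adj_def[abs_def] by (intro continuous_intros continuous_on_kernel_op assms)
qed

lemma transition:
  assumes "z \<in> X \<times> A"
  shows "prob_space (P z)" "sets (P z) = sets (borel_on X)" "space (P z) = X"
proof -
  have "P z \<in> space (prob_algebra (borel_on X))"
    using kernel assms by (intro measurable_space[of P "borel_on (X \<times> A)"])
      (simp_all add: stochastic_kernel_def space_restrict_space)
  then show "prob_space (P z)" and sets: "sets (P z) = sets (borel_on X)"
    by (auto simp: space_prob_algebra)
  show "space (P z) = X" using sets_eq_imp_space_eq[OF sets] by (simp add: space_restrict_space)
qed

lemma integrable_transition:
  assumes "z \<in> X \<times> A" "continuous_on X u"
  shows "integrable (P z) (u :: 'x \<Rightarrow> real)"
proof -
  interpret prob_space "P z" by (rule transition[OF assms(1)])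
  obtain B where B: "\<And>x. x \<in> X \<Longrightarrow> norm (u x) \<le> B"
    using compact_imp_bounded[OF compact_continuous_image[OF assms(2) compact_sets(1)]]
    by (auto simp: bounded_iff)
  have "u \<in> borel_measurable (P z)"
    using borel_measurable_continuous_on_restrict[OF assms(2)]
    by (simp add: measurable_cong_sets[OF transition(2)[OF assms(1)] refl])
  then show ?thesis
    using B transition(3)[OF assms(1)] by (intro integrable_const_bound[of _ B]) auto
qed

lemma integrable_occ:
  assumes "continuous_on (X \<times> A) f"
  shows "integrable occ (f :: _ \<Rightarrow> real)"
proof -
  interpret finite_measure occ by (rule finite_measure_occ)
  obtain B where B: "\<And>x. x \<in> X \<times> A \<Longrightarrow> norm (f x) \<le> B"
    using compact_imp_bounded[OF compact_continuous_image[OF assms compact_sets(3)]]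
    by (auto simp: bounded_iff)
  have "f \<in> borel_measurable occ"
    using borel_measurable_continuous_on_restrict[OF assms]
    by (simp add: measurable_cong_sets[OF sets_occ refl])
  then show ?thesis
    using B by (intro integrable_const_bound[of _ B]) (auto simp: space_occ)
qed

lemma set_integrable_lborel:
  assumes "continuous_on (X \<times> A) f"
  shows "set_integrable lborel (X \<times> A) (f :: _ \<Rightarrow> real)"
  unfolding set_integrable_def using borel_integrable_compact[OF compact_sets(3) assms] by simp

lemma kernel_op_lincomb:
  assumes "z \<in> X \<times> A" "\<And>j. continuous_on X (us j)"
  shows "kernel_op P (lincomb us \<beta>) z = (\<Sum>j\<in>UNIV. \<beta> $ j * kernel_op P (us j) z)"
  unfolding kernel_op_def lincomb_def
  by (subst Bochner_Integration.integral_sum)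
    (auto intro!: integrable_mult_right integrable_transition assms)

lemma T_adj_lincomb:
  assumes "z \<in> X \<times> A" "\<And>j. continuous_on X (us j)"
  shows "T_adj P \<gamma> (lincomb us \<beta>) z = (\<Sum>j\<in>UNIV. \<beta> $ j * T_adj P \<gamma> (us j) z)"
  unfolding T_adj_def kernel_op_lincomb[OF assms]
  by (simp add: lincomb_def sum_subtractf sum_distrib_left algebra_simps)

lemma T_adj_abs_le:
  assumes z: "z \<in> X \<times> A" and u: "continuous_on X u" "\<And>x. x \<in> X \<Longrightarrow> \<bar>u x\<bar> \<le> B"
  shows "\<bar>T_adj P \<gamma> u z\<bar> \<le> 2 * B"
proof -
  interpret prob_space "P z" by (rule transition[OF z])
  have "\<bar>kernel_op P u z\<bar> \<le> (\<integral>y. \<bar>u y\<bar> \<partial>P z)"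
    unfolding kernel_op_def by (rule integral_abs_bound)
  also have "\<dots> \<le> (\<integral>y. B \<partial>P z)"
    using u transition(3)[OF z]
    by (intro integral_mono integrable_abs integrable_transition[OF z]) auto
  also have "\<dots> = B" by (simp add: prob_space)
  finally have "\<bar>kernel_op P u z\<bar> \<le> B" .
  moreover have "\<bar>\<gamma> * kernel_op P u z\<bar> \<le> \<bar>kernel_op P u z\<bar>"
    using gamma by (simp add: abs_mult mult_left_le_one_le)
  moreover have "\<bar>u (fst z)\<bar> \<le> B" using z u by auto
  ultimately show ?thesis unfolding T_adj_def by linarith
qed

end

section \<open>The sampled inverse program\<close>

text \<open>
  Minimizing a linear cost and breaking ties by \<open>better\<close> is itself a tie-break rule.
\<close>

lemma tie_break_rule_lex:
  fixes \<phi> :: "'z::real_vector \<Rightarrow> real"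
  assumes \<phi>: "linear \<phi>" and better: "tie_break_rule better"
  shows "tie_break_rule (\<lambda>q p. \<phi> q < \<phi> p \<or> \<phi> q = \<phi> p \<and> better q p)"
  unfolding tie_break_rule_def
proof (intro conjI allI)
  have irrefl: "\<And>p. \<not> better p p" and trans: "\<And>p q r. better p q \<Longrightarrow> better q r \<Longrightarrow> better p r"
    and convex: "\<And>p. convex {q. better q p}"
    using better unfolding tie_break_rule_def by (auto dest: irreflpD transpD)
  show "irreflp (\<lambda>q p. \<phi> q < \<phi> p \<or> \<phi> q = \<phi> p \<and> better q p)"
    using irrefl by (auto simp: irreflp_def)
  show "transp (\<lambda>q p. \<phi> q < \<phi> p \<or> \<phi> q = \<phi> p \<and> better q p)"
    using trans by (auto intro!: transpI)
  fix p
  show "convex {q. \<phi> q < \<phi> p \<or> \<phi> q = \<phi> p \<and> better q p}" (is "convex ?S")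
  proof (rule convexI)
    fix x y and u v :: real
    assume xy: "x \<in> ?S" "y \<in> ?S" and uv: "0 \<le> u" "0 \<le> v" "u + v = 1"
    have lin: "\<phi> (u *\<^sub>R x + v *\<^sub>R y) = u * \<phi> x + v * \<phi> y"
      using \<phi> by (simp add: linear_add linear_scale)
    consider "u = 0" | "v = 0" | "u > 0" "v > 0" using uv by linarith
    then show "u *\<^sub>R x + v *\<^sub>R y \<in> ?S"
    proof cases
      case 3
      show ?thesis
      proof (cases "\<phi> x = \<phi> p \<and> \<phi> y = \<phi> p")
        case True
        then have "better (u *\<^sub>R x + v *\<^sub>R y) p"
          using convexD[OF convex[of p], of x y u v] xy uv by auto
        moreover have "\<phi> (u *\<^sub>R x + v *\<^sub>R y) = (u + v) * \<phi> p"
          using True by (simp add: lin distrib_right)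
        ultimately show ?thesis using uv by simp
      next
        case False
        have "u * \<phi> x + v * \<phi> y < u * \<phi> p + v * \<phi> p"
        proof (cases "\<phi> x < \<phi> p")
          case True
          then show ?thesis using 3 xy by (intro add_less_le_mono) auto
        next
          case F: False
          then show ?thesis using False 3 xy by (intro add_le_less_mono) auto
        qed
        then show ?thesis using uv by (simp add: lin flip: distrib_right)
      qed
    qed (use xy uv in auto)
  qed
qed

locale inverse_program = lipschitz_mdp X A P \<gamma> \<nu>\<^sub>0 \<pi>\<^sub>E L\<^sub>P
  for X :: "'x::euclidean_space set" and A :: "'a::euclidean_space set"
    and P :: "'x \<times> 'a \<Rightarrow> 'x measure" and \<gamma> :: real and \<nu>\<^sub>0 :: "'x measure"
    and \<pi>\<^sub>E :: "nat \<Rightarrow> (nat \<Rightarrow> 'x \<times> 'a) \<Rightarrow> 'x \<Rightarrow> 'a measure" and L\<^sub>P :: real +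
  fixes cs :: "'nc::finite \<Rightarrow> 'x \<times> 'a \<Rightarrow> real" and us :: "'nu::finite \<Rightarrow> 'x \<Rightarrow> real"
  assumes cs_Lip: "\<And>i. cs i \<in> Lip sum_dist (X \<times> A)" and us_Lip: "\<And>j. us j \<in> Lip dist X"
begin

lemma continuous_on_cs: "continuous_on (X \<times> A) (cs i)"
  using cs_Lip by (rule Lip_continuous_on) (simp_all add: sum_dist_nonneg sum_dist_le)

lemma continuous_on_us: "continuous_on X (us j)"
  using us_Lip by (rule Lip_continuous_on) simp_all

text \<open>
  The function \<open>c - T\<^sub>\<gamma>\<^sup>* u\<close> for the cost and the value function with coefficients \<open>\<alpha>\<close> and \<open>\<beta>\<close>.
\<close>

definition residual :: "real ^ 'nc \<Rightarrow> real ^ 'nu \<Rightarrow> 'x \<times> 'a \<Rightarrow> real" where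
  "residual \<alpha> \<beta> z = lincomb cs \<alpha> z - T_adj P \<gamma> (lincomb us \<beta>) z"

lemma continuous_on_residual: "continuous_on (X \<times> A) (residual \<alpha> \<beta>)"
  unfolding residual_def[abs_def]
  by (intro continuous_intros continuous_on_lincomb continuous_on_T_adj continuous_on_cs continuous_on_us)

lemma residual_conv:
  "z \<in> X \<times> A \<Longrightarrow> residual \<alpha> \<beta> z = lincomb cs \<alpha> z - lincomb (\<lambda>j. T_adj P \<gamma> (us j)) \<beta> z"
  unfolding residual_def lincomb_def[of "\<lambda>j. T_adj P \<gamma> (us j)"]
  by (simp add: T_adj_lincomb continuous_on_us)

lemma residual_add_scaleR:
  "z \<in> X \<times> A \<Longrightarrow> residual (u *\<^sub>R \<alpha> + v *\<^sub>R \<alpha>') (u *\<^sub>R \<beta> + v *\<^sub>R \<beta>') z = u * residual \<alpha> \<beta> z + v * residual \<alpha>' \<beta>' z"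
  by (simp add: residual_conv lincomb_add_scaleR algebra_simps)

text \<open>
  In the decision variables \<open>(\<alpha>, \<beta>, e)\<close>, the constraint sampled at \<open>z\<close> is the half-space
  \<open>0 \<le> normal z \<bullet> (\<alpha>, \<beta>, e)\<close>.
\<close>

definition normal :: "'x \<times> 'a \<Rightarrow> (real ^ 'nc) \<times> (real ^ 'nu) \<times> real" where
  "normal z = ((\<chi> i. cs i z), (\<chi> j. - T_adj P \<gamma> (us j) z), 1)"

lemma normal_inner: "z \<in> X \<times> A \<Longrightarrow> normal z \<bullet> (\<alpha>, \<beta>, e) = residual \<alpha> \<beta> z + e"
  by (simp add: normal_def residual_conv inner_vec_def lincomb_def sum_negf mult.commute)

lemma continuous_on_normal: "continuous_on (X \<times> A) normal"
  unfolding normal_def[abs_def]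
  by (intro continuous_intros continuous_on_cs continuous_on_T_adj continuous_on_us)

text \<open>
  The constraints of the sampled program that do not depend on the sample.
\<close>

definition program_domain :: "real \<Rightarrow> ((real ^ 'nc) \<times> (real ^ 'nu) \<times> real) set" where
  "program_domain \<theta> = {(\<alpha>, \<beta>, e). l1_norm \<alpha> \<le> \<theta> \<and> l1_norm \<beta> \<le> \<theta> \<and> 0 \<le> e \<and>
     (\<integral>z. residual \<alpha> \<beta> z \<partial>occ) \<le> e \<and> (LINT z:X \<times> A|lborel. residual \<alpha> \<beta> z) = 1}"

lemma convex_program_domain: "convex (program_domain \<theta>)"
proof (rule convexI)
  fix p q and u v :: real
  assume pq: "p \<in> program_domain \<theta>" "q \<in> program_domain \<theta>" and uv: "0 \<le> u" "0 \<le> v" "u + v = 1"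
  obtain \<alpha> \<beta> e \<alpha>' \<beta>' e' where eq: "p = (\<alpha>, \<beta>, e)" "q = (\<alpha>', \<beta>', e')" by (cases p; cases q) auto
  let ?r = "residual (u *\<^sub>R \<alpha> + v *\<^sub>R \<alpha>') (u *\<^sub>R \<beta> + v *\<^sub>R \<beta>')"
  have l1: "l1_norm (u *\<^sub>R \<alpha> + v *\<^sub>R \<alpha>') \<le> \<theta>" "l1_norm (u *\<^sub>R \<beta> + v *\<^sub>R \<beta>') \<le> \<theta>"
    using convexD[OF convex_l1_ball[of \<theta>], of \<alpha> \<alpha>' u v] convexD[OF convex_l1_ball[of \<theta>], of \<beta> \<beta>' u v] pq uv
    by (auto simp: program_domain_def eq)
  have "(\<integral>z. ?r z \<partial>occ) = (\<integral>z. u * residual \<alpha> \<beta> z + v * residual \<alpha>' \<beta>' z \<partial>occ)"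
    by (intro Bochner_Integration.integral_cong refl) (simp add: space_occ residual_add_scaleR)
  also have "\<dots> = u * (\<integral>z. residual \<alpha> \<beta> z \<partial>occ) + v * (\<integral>z. residual \<alpha>' \<beta>' z \<partial>occ)"
    by (simp add: integrable_occ continuous_on_residual)
  also have "\<dots> \<le> u * e + v * e'"
    using pq uv by (intro add_mono mult_left_mono) (auto simp: program_domain_def eq)
  finally have occ: "(\<integral>z. ?r z \<partial>occ) \<le> u * e + v * e'" .
  have "(LINT z:X \<times> A|lborel. ?r z) = (LINT z:X \<times> A|lborel. u * residual \<alpha> \<beta> z + v * residual \<alpha>' \<beta>' z)"
    using borel_compact[OF compact_sets(3)]
    by (intro set_lebesgue_integral_cong) (auto simp: residual_add_scaleR)
  also have "\<dots> = u * (LINT z:X \<times> A|lborel. residual \<alpha> \<beta> z) + v * (LINT z:X \<times> A|lborel. residual \<alpha>' \<beta>' z)"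
    by (subst set_integral_add(2))
      (auto intro!: set_integrable_lborel continuous_intros continuous_on_residual)
  also have "\<dots> = 1" using pq uv by (simp add: program_domain_def eq)
  finally have "(LINT z:X \<times> A|lborel. ?r z) = 1" .
  then show "u *\<^sub>R p + v *\<^sub>R q \<in> program_domain \<theta>"
    using l1 occ uv pq by (simp add: program_domain_def eq)
qed

lemma sip_feasible_eq:
  assumes "\<And>l. l \<in> {1..N} \<Longrightarrow> s l \<in> X \<times> A"
  shows "sip_feasible X A P \<gamma> \<nu>\<^sub>0 \<pi>\<^sub>E cs us \<theta> N s =
    program_domain \<theta> \<inter> halfspaces (\<lambda>l. normal (s l)) (\<lambda>_. 0) {1..N}"
proof -
  have "(\<forall>l\<in>{1..N}. - e \<le> residual \<alpha> \<beta> (s l)) \<longleftrightarrow> (\<alpha>, \<beta>, e) \<in> halfspaces (\<lambda>l. normal (s l)) (\<lambda>_. 0) {1..N}"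
    for \<alpha> \<beta> e
    unfolding halfspaces_def mem_Collect_eq
  proof (intro ball_cong refl)
    fix l assume "l \<in> {1..N}"
    then show "(- e \<le> residual \<alpha> \<beta> (s l)) = (0 \<le> normal (s l) \<bullet> (\<alpha>, \<beta>, e) + 0)"
      using normal_inner[OF assms, of l \<alpha> \<beta> e] by auto
  qed
  then show ?thesis
    by (auto simp: sip_feasible_def program_domain_def Let_def residual_def[symmetric])
qed

lemma residual_lipschitz:
  assumes Lc: "\<And>i. lip_seminorm sum_dist (X \<times> A) (cs i) \<le> L\<^sub>c" "0 < L\<^sub>c"
    and Lu: "\<And>j. lip_seminorm dist X (us j) \<le> L\<^sub>u" "0 < L\<^sub>u"
    and l1: "l1_norm \<alpha> \<le> \<theta>" "l1_norm \<beta> \<le> \<theta>" and z: "z \<in> X \<times> A" "w \<in> X \<times> A"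
  shows "\<bar>residual \<alpha> \<beta> z - residual \<alpha> \<beta> w\<bar> \<le> (\<theta> * L\<^sub>c + \<theta> * (L\<^sub>u * L\<^sub>P + L\<^sub>u)) * sum_dist z w"
proof -
  note nn = sum_dist_nonneg[of z w]
  have LP: "0 < L\<^sub>P" using model by (simp add: lipschitz_control_model_def)
  have c: "\<bar>cs i z - cs i w\<bar> \<le> L\<^sub>c * sum_dist z w" for i
  proof -
    have "\<bar>cs i z - cs i w\<bar> \<le> lip_seminorm sum_dist (X \<times> A) (cs i) * sum_dist z w"
      using cs_Lip z by (intro lip_seminorm_bound) (auto simp: sum_dist_nonneg sum_dist_eq_0)
    also have "\<dots> \<le> L\<^sub>c * sum_dist z w" using Lc nn by (intro mult_right_mono) auto
    finally show ?thesis .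
  qed
  have t: "\<bar>T_adj P \<gamma> (us j) z - T_adj P \<gamma> (us j) w\<bar> \<le> (L\<^sub>u * L\<^sub>P + L\<^sub>u) * sum_dist z w" for j
  proof -
    have "\<bar>us j (fst z) - us j (fst w)\<bar> \<le> lip_seminorm dist X (us j) * dist (fst z) (fst w)"
      using us_Lip z by (intro lip_seminorm_bound) auto
    also have "\<dots> \<le> L\<^sub>u * sum_dist z w"
      using Lu by (intro mult_mono) (auto simp: sum_dist_def)
    finally have 1: "\<bar>us j (fst z) - us j (fst w)\<bar> \<le> L\<^sub>u * sum_dist z w" .
    have "\<bar>kernel_op P (us j) z - kernel_op P (us j) w\<bar> \<le> L\<^sub>P * lip_seminorm dist X (us j) * sum_dist z w"
      using model us_Lip z by (auto simp: lipschitz_control_model_def)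
    also have "\<dots> \<le> L\<^sub>P * L\<^sub>u * sum_dist z w"
      using Lu LP nn by (intro mult_right_mono mult_left_mono) auto
    finally have "\<bar>kernel_op P (us j) z - kernel_op P (us j) w\<bar> \<le> L\<^sub>P * L\<^sub>u * sum_dist z w" .
    then have "\<gamma> * \<bar>kernel_op P (us j) z - kernel_op P (us j) w\<bar> \<le> 1 * (L\<^sub>P * L\<^sub>u * sum_dist z w)"
      using gamma by (intro mult_mono) auto
    then have 2: "\<bar>\<gamma> * kernel_op P (us j) z - \<gamma> * kernel_op P (us j) w\<bar> \<le> L\<^sub>P * L\<^sub>u * sum_dist z w"
      using gamma by (simp add: abs_mult flip: right_diff_distrib)
    have "\<bar>T_adj P \<gamma> (us j) z - T_adj P \<gamma> (us j) w\<bar> \<le>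
        \<bar>us j (fst z) - us j (fst w)\<bar> + \<bar>\<gamma> * kernel_op P (us j) z - \<gamma> * kernel_op P (us j) w\<bar>"
      unfolding T_adj_def by linarith
    also have "\<dots> \<le> L\<^sub>u * sum_dist z w + L\<^sub>P * L\<^sub>u * sum_dist z w" using 1 2 by (rule add_mono)
    finally show ?thesis by (simp add: algebra_simps)
  qed
  have "\<bar>lincomb cs \<alpha> z - lincomb cs \<alpha> w\<bar> \<le> \<theta> * (L\<^sub>c * sum_dist z w)"
    using c l1(1) Lc nn by (intro lincomb_lipschitz_bound) auto
  moreover have "\<bar>lincomb (\<lambda>j. T_adj P \<gamma> (us j)) \<beta> z - lincomb (\<lambda>j. T_adj P \<gamma> (us j)) \<beta> w\<bar>
      \<le> \<theta> * ((L\<^sub>u * L\<^sub>P + L\<^sub>u) * sum_dist z w)"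
    using t l1(2) Lu LP nn by (intro lincomb_lipschitz_bound) auto
  ultimately have "\<bar>residual \<alpha> \<beta> z - residual \<alpha> \<beta> w\<bar> \<le>
      \<theta> * (L\<^sub>c * sum_dist z w) + \<theta> * ((L\<^sub>u * L\<^sub>P + L\<^sub>u) * sum_dist z w)"
    unfolding residual_conv[OF z(1)] residual_conv[OF z(2)] by linarith
  then show ?thesis by (simp add: algebra_simps)
qed

text \<open>
  The pairs of cost coefficients and tolerance for which inverse feasibility is witnessed by a value
  function with bound and Lipschitz constant \<open>n\<close>. These sets are closed by the Arzela--Ascoli theorem, and
  their union over \<open>n\<close> is the set of all pairs with inverse feasibility. Hence that set is Borel, as is
  required for the measurability of the event whose probability is to be bounded.
\<close>

definition certified :: "nat \<Rightarrow> ((real ^ 'nc) \<times> real) set" where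
  "certified n = {(\<alpha>, e). \<exists>u. (\<forall>x\<in>X. \<bar>u x\<bar> \<le> real n) \<and> (\<forall>x\<in>X. \<forall>y\<in>X. \<bar>u x - u y\<bar> \<le> real n * dist x y) \<and>
     (\<integral>z. lincomb cs \<alpha> z - T_adj P \<gamma> u z \<partial>occ) \<le> e \<and>
     (\<forall>z\<in>X \<times> A. - e \<le> lincomb cs \<alpha> z - T_adj P \<gamma> u z)}"

lemma inverse_feasibility_iff_certified:
  "lincomb cs \<alpha> \<in> inverse_feasibility_set X A P \<gamma> \<nu>\<^sub>0 \<pi>\<^sub>E e \<longleftrightarrow> (\<exists>n. (\<alpha>, e) \<in> certified n)"
proof
  assume "lincomb cs \<alpha> \<in> inverse_feasibility_set X A P \<gamma> \<nu>\<^sub>0 \<pi>\<^sub>E e"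
  then obtain u where u: "u \<in> Lip dist X" "(\<integral>z. lincomb cs \<alpha> z - T_adj P \<gamma> u z \<partial>occ) \<le> e"
      "\<forall>z\<in>X \<times> A. - e \<le> lincomb cs \<alpha> z - T_adj P \<gamma> u z"
    unfolding inverse_feasibility_set_def by blast
  obtain B where B: "\<And>z. z \<in> X \<Longrightarrow> \<bar>u z\<bar> \<le> B" "\<And>z w. z \<in> X \<Longrightarrow> w \<in> X \<Longrightarrow> \<bar>u z - u w\<bar> \<le> B * dist z w"
    by (rule LipE[OF u(1)]) (auto intro: that)
  obtain n where n: "B \<le> real n" using real_arch_simple by blast
  have "B * dist x y \<le> real n * dist x y" for x y :: 'x using n by (intro mult_right_mono) auto
  then have "\<forall>x\<in>X. \<forall>y\<in>X. \<bar>u x - u y\<bar> \<le> real n * dist x y" using B(2) by (meson order_trans)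
  moreover have "\<forall>x\<in>X. \<bar>u x\<bar> \<le> real n" using B(1) n by (meson order_trans)
  ultimately have "(\<alpha>, e) \<in> certified n"
    unfolding certified_def using u(2,3) by blast
  then show "\<exists>n. (\<alpha>, e) \<in> certified n" ..
next
  assume "\<exists>n. (\<alpha>, e) \<in> certified n"
  moreover have "lincomb cs \<alpha> \<in> Lip sum_dist (X \<times> A)"
    using cs_Lip by (rule Lip_lincomb) (rule sum_dist_nonneg)
  ultimately show "lincomb cs \<alpha> \<in> inverse_feasibility_set X A P \<gamma> \<nu>\<^sub>0 \<pi>\<^sub>E e"
    unfolding inverse_feasibility_set_def certified_def Lip_def[of dist] by blast
qed

lemma closed_certified: "closed (certified n)"
  unfolding closed_sequential_limits
proof (intro allI impI, elim conjE)
  fix x :: "nat \<Rightarrow> (real ^ 'nc) \<times> real" and l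
  assume mem: "\<forall>k. x k \<in> certified n" and lim: "x \<longlonglongrightarrow> l"
  define ok where "ok k u \<longleftrightarrow>
      (\<forall>y\<in>X. \<bar>u y\<bar> \<le> real n) \<and> (\<forall>y\<in>X. \<forall>y'\<in>X. \<bar>u y - u y'\<bar> \<le> real n * dist y y') \<and>
      (\<integral>z. lincomb cs (fst (x k)) z - T_adj P \<gamma> u z \<partial>occ) \<le> snd (x k) \<and>
      (\<forall>z\<in>X \<times> A. - snd (x k) \<le> lincomb cs (fst (x k)) z - T_adj P \<gamma> u z)" for k u
  have "\<forall>k. \<exists>u. ok k u"
    using mem by (simp add: certified_def case_prod_beta ok_def)
  from choice[OF this] obtain u where "\<forall>k. ok k (u k)" ..
  then have u: "\<And>k y. y \<in> X \<Longrightarrow> \<bar>u k y\<bar> \<le> real n"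
       "\<And>k y y'. y \<in> X \<Longrightarrow> y' \<in> X \<Longrightarrow> \<bar>u k y - u k y'\<bar> \<le> real n * dist y y'"
    and int: "\<And>k. (\<integral>z. lincomb cs (fst (x k)) z - T_adj P \<gamma> (u k) z \<partial>occ) \<le> snd (x k)"
    and low: "\<And>k z. z \<in> X \<times> A \<Longrightarrow> - snd (x k) \<le> lincomb cs (fst (x k)) z - T_adj P \<gamma> (u k) z"
    unfolding ok_def by blast+
  have cont_u: "continuous_on X (u k)" for k
    by (rule lipschitz_on_continuous_on[of "real n"], rule lipschitz_onI)
      (use u(2) in \<open>auto simp: dist_real_def\<close>)
  obtain g r where g: "continuous_on X g" and r: "strict_mono (r :: nat \<Rightarrow> nat)"
    and unif: "\<And>e. 0 < e \<Longrightarrow> \<exists>N. \<forall>k y. k \<ge> N \<and> y \<in> X \<longrightarrow> norm (u (r k) y - g y) < e"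
  proof (rule Arzela_Ascoli[OF compact_sets(1), of u "real n"])
    show "norm (u k y) \<le> real n" if "y \<in> X" for k y using u(1)[OF that] by simp
    show "\<exists>d>0. \<forall>k y'. y' \<in> X \<and> norm (y - y') < d \<longrightarrow> norm (u k y - u k y') < e"
      if "y \<in> X" "0 < e" for y e
    proof (intro exI[of _ "e / (real n + 1)"] conjI allI impI)
      show "0 < e / (real n + 1)" using that by simp
      fix k y' assume y': "y' \<in> X \<and> norm (y - y') < e / (real n + 1)"
      have "norm (u k y - u k y') \<le> real n * norm (y - y')"
        using u(2)[of y y' k] y' that by (simp add: dist_norm)
      also have "\<dots> \<le> (real n + 1) * norm (y - y')" by (intro mult_right_mono) auto
      also have "\<dots> < e" using y' by (simp add: pos_less_divide_eq mult.commute)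
      finally show "norm (u k y - u k y') < e" .
    qed
  qed (rule that)
  have ulim: "(\<lambda>k. u (r k) y) \<longlonglongrightarrow> g y" if "y \<in> X" for y
    unfolding LIMSEQ_iff using unif that by blast
  have alim: "(\<lambda>k. fst (x (r k))) \<longlonglongrightarrow> fst l" and elim: "(\<lambda>k. snd (x (r k))) \<longlonglongrightarrow> snd l"
    using LIMSEQ_subseq_LIMSEQ[OF lim r] by (auto simp: o_def intro: tendsto_fst tendsto_snd)
  have g_bound: "\<bar>g y\<bar> \<le> real n" if "y \<in> X" for y
    by (rule LIMSEQ_le_const2[OF tendsto_rabs[OF ulim[OF that]]]) (use u(1)[OF that] in auto)
  have g_lip: "\<bar>g y - g y'\<bar> \<le> real n * dist y y'" if "y \<in> X" "y' \<in> X" for y y'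
    by (rule LIMSEQ_le_const2[OF tendsto_rabs[OF tendsto_diff[OF ulim[OF that(1)] ulim[OF that(2)]]]])
      (use u(2)[OF that] in auto)
  have Tlim: "(\<lambda>k. T_adj P \<gamma> (u (r k)) z) \<longlonglongrightarrow> T_adj P \<gamma> g z" if z: "z \<in> X \<times> A" for z
  proof -
    interpret Pz: prob_space "P z" by (rule transition[OF z])
    have "(\<lambda>k. kernel_op P (u (r k)) z) \<longlonglongrightarrow> kernel_op P g z"
      unfolding kernel_op_def
    proof (rule integral_dominated_convergence[where w = "\<lambda>_. real n"])
      show "g \<in> borel_measurable (P z)" "u (r k) \<in> borel_measurable (P z)" for k
        using integrable_transition[OF z] g cont_u by blast+
    qed (use ulim u(1) transition(3)[OF z] in auto)
    moreover have "fst z \<in> X" using z by auto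
    ultimately show ?thesis
      unfolding T_adj_def by (intro tendsto_intros ulim)
  qed
  have clim: "(\<lambda>k. lincomb cs (fst (x (r k))) z) \<longlonglongrightarrow> lincomb cs (fst l) z" for z
    unfolding lincomb_def by (intro tendsto_intros alim)
  have hlim: "(\<lambda>k. lincomb cs (fst (x (r k))) z - T_adj P \<gamma> (u (r k)) z)
      \<longlonglongrightarrow> lincomb cs (fst l) z - T_adj P \<gamma> g z" if "z \<in> X \<times> A" for z
    by (intro tendsto_diff clim Tlim that)
  have cont_h: "continuous_on (X \<times> A) (\<lambda>z. lincomb cs \<alpha> z - T_adj P \<gamma> v z)" if "continuous_on X v" for \<alpha> v
    by (intro continuous_intros continuous_on_lincomb continuous_on_T_adj continuous_on_cs that)
  interpret occ: finite_measure occ by (rule finite_measure_occ)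
  obtain K where K: "\<And>k. norm (fst (x (r k))) \<le> K"
    using convergent_imp_Bseq[OF convergentI[OF alim]] by (auto simp: Bseq_def)
  have "\<exists>B. \<forall>z\<in>X \<times> A. \<bar>cs i z\<bar> \<le> B" for i using cs_Lip[of i] by (auto simp: Lip_def)
  then obtain B where B: "\<And>i z. z \<in> X \<times> A \<Longrightarrow> \<bar>cs i z\<bar> \<le> B i" by metis
  have bound: "\<bar>lincomb cs (fst (x (r k))) z - T_adj P \<gamma> (u (r k)) z\<bar> \<le> (\<Sum>i\<in>UNIV. K * B i) + 2 * real n"
    if z: "z \<in> X \<times> A" for k z
  proof -
    have "\<bar>lincomb cs (fst (x (r k))) z\<bar> \<le> (\<Sum>i\<in>UNIV. K * B i)"
      unfolding lincomb_def
    proof (intro order_trans[OF sum_abs] sum_mono)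
      fix i
      have "\<bar>fst (x (r k)) $ i\<bar> \<le> K" using component_le_norm_cart K order_trans by blast
      then show "\<bar>fst (x (r k)) $ i * cs i z\<bar> \<le> K * B i"
        unfolding abs_mult using B[OF z, of i] by (intro mult_mono) auto
    qed
    moreover have "\<bar>T_adj P \<gamma> (u (r k)) z\<bar> \<le> 2 * real n"
      by (rule T_adj_abs_le[OF z cont_u u(1)])
    ultimately show ?thesis by linarith
  qed
  have "(\<lambda>k. \<integral>z. lincomb cs (fst (x (r k))) z - T_adj P \<gamma> (u (r k)) z \<partial>occ)
      \<longlonglongrightarrow> (\<integral>z. lincomb cs (fst l) z - T_adj P \<gamma> g z \<partial>occ)"
  proof (rule integral_dominated_convergence[where w = "\<lambda>_. (\<Sum>i\<in>UNIV. K * B i) + 2 * real n"])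
    show "(\<lambda>z. lincomb cs (fst l) z - T_adj P \<gamma> g z) \<in> borel_measurable occ"
      by (rule borel_measurable_integrable[OF integrable_occ[OF cont_h[OF g]]])
    show "(\<lambda>z. lincomb cs (fst (x (r k))) z - T_adj P \<gamma> (u (r k)) z) \<in> borel_measurable occ" for k
      by (rule borel_measurable_integrable[OF integrable_occ[OF cont_h[OF cont_u]]])
    show "AE z in occ. (\<lambda>k. lincomb cs (fst (x (r k))) z - T_adj P \<gamma> (u (r k)) z)
        \<longlonglongrightarrow> lincomb cs (fst l) z - T_adj P \<gamma> g z"
      by (rule AE_I2) (simp only: space_occ hlim)
    show "AE z in occ. norm (lincomb cs (fst (x (r k))) z - T_adj P \<gamma> (u (r k)) z)
        \<le> (\<Sum>i\<in>UNIV. K * B i) + 2 * real n" for k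
      by (rule AE_I2) (simp only: space_occ real_norm_def bound)
  qed (rule occ.integrable_const)
  then have int_l: "(\<integral>z. lincomb cs (fst l) z - T_adj P \<gamma> g z \<partial>occ) \<le> snd l"
    by (rule LIMSEQ_le[OF _ elim]) (use int in blast)
  have low_l: "- snd l \<le> lincomb cs (fst l) z - T_adj P \<gamma> g z" if z: "z \<in> X \<times> A" for z
    by (rule LIMSEQ_le[OF tendsto_minus[OF elim] hlim[OF z]]) (use low[OF z] in blast)
  show "l \<in> certified n"
    unfolding certified_def case_prod_beta mem_Collect_eq
    using g_bound g_lip int_l low_l by (intro exI[of _ g]) auto
qed

end

text \<open>
  The probability that a binomial variable with parameters \<open>N\<close> and \<open>q\<close> is at most \<open>n\<close>.
\<close>

definition binomial_tail :: "nat \<Rightarrow> real \<Rightarrow> nat \<Rightarrow> real" where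
  "binomial_tail n q N = (\<Sum>i=0..n. real (N choose i) * q ^ i * (1 - q) ^ (N - i))"

lemma binomial_tail_Suc_le:
  assumes "0 \<le> q" "q \<le> 1"
  shows "binomial_tail n q (Suc N) \<le> binomial_tail n q N"
proof -
  let ?t = "\<lambda>N i. real (N choose i) * q ^ i * (1 - q) ^ (N - i)"
  have nn: "0 \<le> ?t N i" for i using assms by simp
  have step: "?t (Suc N) (Suc i) = (1 - q) * ?t N (Suc i) + q * ?t N i" for i
  proof (cases "i < N")
    case True
    then have "N - i = Suc (N - Suc i)" by simp
    then show ?thesis by (simp add: algebra_simps)
  qed (simp add: binomial_eq_0)
  have split: "(\<Sum>i=0..n. f i) = f 0 + (\<Sum>i<n. f (Suc i))" for f :: "nat \<Rightarrow> real"
    by (simp add: atLeast0AtMost lessThan_Suc_atMost[symmetric] sum.lessThan_Suc_shift del: sum.lessThan_Suc)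
  have "binomial_tail n q (Suc N) = (1 - q) * (?t N 0 + (\<Sum>i<n. ?t N (Suc i))) + q * (\<Sum>i<n. ?t N i)"
    unfolding binomial_tail_def split step by (simp add: sum.distrib sum_distrib_left distrib_left)
  also have "?t N 0 + (\<Sum>i<n. ?t N (Suc i)) = binomial_tail n q N"
    unfolding binomial_tail_def split ..
  also have "(\<Sum>i<n. ?t N i) \<le> binomial_tail n q N"
    unfolding binomial_tail_def using nn by (intro sum_mono2) auto
  then have "(1 - q) * binomial_tail n q N + q * (\<Sum>i<n. ?t N i) \<le>
      (1 - q) * binomial_tail n q N + q * binomial_tail n q N"
    using assms by (intro add_left_mono mult_left_mono) auto
  finally show ?thesis by (simp add: algebra_simps)
qed

lemma binomial_tail_tendsto_0:
  assumes "0 < q" "q < 1"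
  shows "binomial_tail n q \<longlonglongrightarrow> 0"
proof -
  have "(\<lambda>N. real (N choose i) * q ^ i * (1 - q) ^ (N - i)) \<longlonglongrightarrow> 0" for i
  proof (rule tendsto_sandwich)
    show "\<forall>\<^sub>F N in sequentially. 0 \<le> real (N choose i) * q ^ i * (1 - q) ^ (N - i)"
      using assms by (intro always_eventually) simp
    show "\<forall>\<^sub>F N in sequentially. real (N choose i) * q ^ i * (1 - q) ^ (N - i) \<le>
        real N ^ i * (1 - q) ^ N * inverse ((1 - q) ^ i)"
    proof (intro always_eventually allI)
      fix N
      show "real (N choose i) * q ^ i * (1 - q) ^ (N - i) \<le> real N ^ i * (1 - q) ^ N * inverse ((1 - q) ^ i)"
      proof (cases "i \<le> N")
        case True
        have "real (N choose i) \<le> real N ^ i"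
          using binomial_le_pow[OF True] by (metis of_nat_le_iff of_nat_power)
        then have "real (N choose i) * q ^ i \<le> real N ^ i * 1"
          using assms by (intro mult_mono power_le_one) auto
        then have "real (N choose i) * q ^ i * (1 - q) ^ (N - i) \<le> real N ^ i * (1 - q) ^ (N - i)"
          using assms by (intro mult_right_mono) auto
        also have "real N ^ i * (1 - q) ^ (N - i) = real N ^ i * (1 - q) ^ N * inverse ((1 - q) ^ i)"
          using assms True by (simp add: power_diff divide_inverse)
        finally show ?thesis .
      qed (use assms in \<open>simp add: binomial_eq_0\<close>)
    qed
    show "(\<lambda>N. real N ^ i * (1 - q) ^ N * inverse ((1 - q) ^ i)) \<longlonglongrightarrow> 0"
      using assms by real_asymp
  qed auto
  then have "(\<lambda>N. \<Sum>i=0..n. real (N choose i) * q ^ i * (1 - q) ^ (N - i)) \<longlonglongrightarrow> (\<Sum>i=0..n. 0)"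
    by (intro tendsto_sum)
  then show ?thesis by (simp add: binomial_tail_def[abs_def])
qed

text \<open>
  Since the tail decreases to 0 in \<open>N\<close>, the minimum in the definition of the sample size is attained, and
  every larger \<open>N\<close> works as well. Moreover \<open>N > n\<close>, because the tail is 1 for \<open>N \<le> n\<close>.
\<close>

lemma sample_size_spec:
  assumes q: "0 < q" "q < 1" and \<delta>: "0 < \<delta>" "\<delta> < 1" and N: "sample_size n q \<delta> \<le> N"
  shows "binomial_tail n q N \<le> \<delta>" "n < N"
proof -
  have eq: "sample_size n q \<delta> = (LEAST N. binomial_tail n q N \<le> \<delta>)"
    by (simp add: sample_size_def binomial_tail_def)
  have "\<exists>N. binomial_tail n q N \<le> \<delta>"
    using order_tendstoD(2)[OF binomial_tail_tendsto_0[OF q] \<delta>(1), of n]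
    by (auto simp: eventually_sequentially intro: less_imp_le)
  then have "binomial_tail n q (sample_size n q \<delta>) \<le> \<delta>"
    unfolding eq by (rule LeastI_ex)
  moreover have "binomial_tail n q N \<le> binomial_tail n q (sample_size n q \<delta>)"
    using q by (intro lift_Suc_antimono_le[of "binomial_tail n q", OF _ N] binomial_tail_Suc_le) auto
  ultimately show le: "binomial_tail n q N \<le> \<delta>" by linarith
  show "n < N"
  proof (rule ccontr)
    assume "\<not> n < N"
    then have "binomial_tail n q N = (\<Sum>i\<le>N. real (N choose i) * q ^ i * (1 - q) ^ (N - i))"
      unfolding binomial_tail_def by (intro sum.mono_neutral_right) (auto simp: binomial_eq_0)
    also have "\<dots> = 1" using binomial_ring[of q "1 - q" N] by simp
    finally show False using le \<delta> by simp
  qed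
qed

section \<open>From the sample to the whole space\<close>

theorem theorem4p1:
  fixes X :: "'x::euclidean_space set" and A :: "'a::euclidean_space set"
    and P :: "'x \<times> 'a \<Rightarrow> 'x measure" and \<gamma> :: real and \<nu>\<^sub>0 :: "'x measure"
    and \<pi>\<^sub>E :: "nat \<Rightarrow> (nat \<Rightarrow> 'x \<times> 'a) \<Rightarrow> 'x \<Rightarrow> 'a measure"
    and cs :: "'nc::finite \<Rightarrow> 'x \<times> 'a \<Rightarrow> real" and us :: "'nu::finite \<Rightarrow> 'x \<Rightarrow> real"
    and Q :: "('x \<times> 'a) measure" and g :: "real \<Rightarrow> real"
    and sel :: "(nat \<Rightarrow> 'x \<times> 'a) \<Rightarrow> (real ^ 'nc) \<times> (real ^ 'nu) \<times> real"
    and L\<^sub>P L\<^sub>c L\<^sub>u \<theta> \<epsilon> \<delta> :: real and N :: nat and u1 :: 'nu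
  defines "L\<^sub>\<Lambda> \<equiv> \<theta> * sqrt (real CARD('nc)) * L\<^sub>c
                 + \<theta> * sqrt (real CARD('nu)) * (L\<^sub>u * L\<^sub>P + L\<^sub>u)"
  assumes eps: "\<epsilon> \<in> {0<..<1}" and delta: "\<delta> \<in> {0<..<1}" and gamma: "\<gamma> \<in> {0<..<1}"
    and kernel: "stochastic_kernel X A P"
    and init: "initial_distribution X \<nu>\<^sub>0"
    and expert: "policy X A \<pi>\<^sub>E"
    and model: "lipschitz_control_model X A P L\<^sub>P"
    and cs: "\<And>i. cs i \<in> Lip sum_dist (X \<times> A)" "lin_indep_on (X \<times> A) cs"
            "L\<^sub>c > 0" "\<And>i. lip_seminorm sum_dist (X \<times> A) (cs i) \<le> L\<^sub>c"
    and us: "\<And>j. us j \<in> Lip dist X" "lin_indep_on X us"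
            "L\<^sub>u > 0" "\<And>j. lip_seminorm dist X (us j) \<le> L\<^sub>u"
    and sampling: "sampling_distribution X A Q g"
    and optimizer: "unique_optimizer_map sel (\<Pi>\<^sub>M l\<in>{1..N}. Q)
                      (sip_optimal X A P \<gamma> \<nu>\<^sub>0 \<pi>\<^sub>E cs us \<theta> N)"
    and one: "\<And>x. x \<in> X \<Longrightarrow> us u1 x = 1"
    and theta: "\<theta> > 0" "\<theta> > 1 / ((1 - \<gamma>) * measure lborel (X \<times> A))"
    and N: "N \<ge> sample_size (CARD('nc) + CARD('nu) + 1) (g (\<epsilon> / L\<^sub>\<Lambda>)) \<delta>"
  shows "measure (\<Pi>\<^sub>M l\<in>{1..N}. Q)
           {s \<in> space (\<Pi>\<^sub>M l\<in>{1..N}. Q).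
              case sel s of (\<alpha>, \<beta>, e) \<Rightarrow>
                lincomb cs \<alpha> \<in> inverse_feasibility_set X A P \<gamma> \<nu>\<^sub>0 \<pi>\<^sub>E (e + \<epsilon>)} \<ge> 1 - \<delta>"
proof -
  interpret inverse_program X A P \<gamma> \<nu>\<^sub>0 \<pi>\<^sub>E L\<^sub>P cs us
    using gamma kernel init expert model cs(1) us(1) by unfold_locales auto
  interpret Q: prob_space Q using sampling by (simp add: sampling_distribution_def)
  let ?d = "CARD('nc) + CARD('nu) + 1"
  let ?S = "\<Pi>\<^sub>M l\<in>{1..N}. Q"
  interpret S: prob_space ?S by (intro prob_space_PiM Q.prob_space_axioms)
  have sets_Q: "sets Q = sets (borel_on (X \<times> A))" using sampling by (simp add: sampling_distribution_def)
  have space_Q: "space Q = X \<times> A"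
    using sets_eq_imp_space_eq[OF sets_Q] by (simp add: space_restrict_space)
  have LP: "0 < L\<^sub>P" using model by (simp add: lipschitz_control_model_def)
  have L_pos: "0 < L\<^sub>\<Lambda>"
    unfolding L\<^sub>\<Lambda>_def using theta(1) cs(3) us(3) LP by (intro add_pos_pos mult_pos_pos) auto
  define r where "r = \<epsilon> / L\<^sub>\<Lambda>"
  define \<rho> where "\<rho> = g r"
  have r: "0 < r" using eps L_pos by (simp add: r_def)
  \<comment> \<open>Every ball of radius \<open>r\<close> carries more mass than \<open>\<rho>\<close>, so it contains a point whose
    constraint holds whenever the violation probability is at most \<open>\<rho>\<close>.\<close>
  have ball: "\<rho> < measure Q {w \<in> X \<times> A. sum_dist z w < r}" if "z \<in> X \<times> A" for z
    using sampling that r unfolding sampling_distribution_def \<rho>_def by blast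
  have rho: "0 < \<rho>" "\<rho> < 1"
  proof -
    have "g 0 < g r" "0 \<le> g 0"
      using sampling r by (auto simp: sampling_distribution_def strict_mono_on_def)
    then show "0 < \<rho>" by (simp add: \<rho>_def)
    obtain z where "z \<in> X \<times> A" using Q.not_empty space_Q by auto
    from ball[OF this] show "\<rho> < 1" using Q.prob_le_1 by (meson less_le_trans)
  qed
  have size: "binomial_tail ?d \<rho> N \<le> \<delta>" "?d < N"
    using sample_size_spec[of \<rho> \<delta> ?d N] rho delta N by (auto simp: \<rho>_def r_def)
  have dim: "DIM((real ^ 'nc) \<times> (real ^ 'nu) \<times> real) = ?d" by simp
  have in_XA: "s l \<in> X \<times> A" if "s \<in> space ?S" "l \<in> {1..N}" for s l
    using that space_Q by (auto simp: space_PiM PiE_iff)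
  obtain better where better: "tie_break_rule better"
    and sel_best: "\<And>s. s \<in> space ?S \<Longrightarrow> sel s \<in> sip_optimal X A P \<gamma> \<nu>\<^sub>0 \<pi>\<^sub>E cs us \<theta> N s"
      "\<And>s p. s \<in> space ?S \<Longrightarrow> p \<in> sip_optimal X A P \<gamma> \<nu>\<^sub>0 \<pi>\<^sub>E cs us \<theta> N s \<Longrightarrow> p \<noteq> sel s \<Longrightarrow> better (sel s) p"
    using optimizer unfolding unique_optimizer_map_def by blast
  define prec where "prec q p \<longleftrightarrow> snd (snd q) < snd (snd p) \<or> snd (snd q) = snd (snd p) \<and> better q p"
    for q p :: "(real ^ 'nc) \<times> (real ^ 'nu) \<times> real"
  have prec: "tie_break_rule prec"
    unfolding prec_def[abs_def] by (rule tie_break_rule_lex[OF _ better]) (auto intro!: linearI)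
  have opt: "optimum prec (program_domain \<theta> \<inter> halfspaces (\<lambda>l. normal (s l)) (\<lambda>_. 0) {1..N}) (sel s)"
    if s: "s \<in> space ?S" for s
  proof -
    let ?F = "sip_feasible X A P \<gamma> \<nu>\<^sub>0 \<pi>\<^sub>E cs us \<theta> N s"
    have best: "sel s \<in> ?F" "\<And>q. q \<in> ?F \<Longrightarrow> snd (snd (sel s)) \<le> snd (snd q)"
      using sel_best(1)[OF s] by (auto simp: sip_optimal_def)
    have "prec (sel s) q" if q: "q \<in> ?F" "q \<noteq> sel s" for q
    proof (cases "snd (snd (sel s)) < snd (snd q)")
      case False
      then have e: "snd (snd (sel s)) = snd (snd q)" using best(2)[OF q(1)] by linarith
      then have "q \<in> sip_optimal X A P \<gamma> \<nu>\<^sub>0 \<pi>\<^sub>E cs us \<theta> N s"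
        using q(1) best(2) by (auto simp: sip_optimal_def)
      then show ?thesis using sel_best(2)[OF s _ q(2)] e by (simp add: prec_def)
    qed (simp add: prec_def)
    then have "optimum prec ?F (sel s)" using best(1) by (simp add: optimum_def)
    then show ?thesis using sip_feasible_eq[of N s \<theta>] in_XA[OF s] by simp
  qed
  have sel_meas: "sel \<in> borel_measurable ?S" using optimizer by (simp add: unique_optimizer_map_def)
  interpret scenario_program Q normal prec "program_domain \<theta>" N sel
  proof unfold_locales
    show "normal \<in> borel_measurable Q"
      using borel_measurable_continuous_on_restrict[OF continuous_on_normal]
      by (simp add: measurable_cong_sets[OF sets_Q refl])
    show "DIM((real ^ 'nc) \<times> (real ^ 'nu) \<times> real) < N" using size(2) dim by simp
  qed (fact sel_meas prec convex_program_domain opt)+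
  let ?good = "{s \<in> space ?S. case sel s of (\<alpha>, \<beta>, e) \<Rightarrow>
      lincomb cs \<alpha> \<in> inverse_feasibility_set X A P \<gamma> \<nu>\<^sub>0 \<pi>\<^sub>E (e + \<epsilon>)}"
  let ?bad = "{s \<in> space ?S. \<rho> < violation (sel s)}"
  have good_sets: "?good \<in> sets ?S"
  proof -
    let ?f = "\<lambda>p :: (real ^ 'nc) \<times> (real ^ 'nu) \<times> real. (fst p, snd (snd p) + \<epsilon>)"
    have good_eq: "?good = sel -` (\<Union>n. ?f -` certified n) \<inter> space ?S"
      by (auto simp: inverse_feasibility_iff_certified split_beta)
    have "closed (?f -` certified n)" for n
      by (intro continuous_closed_vimage closed_certified continuous_intros)
    then have "(\<Union>n. ?f -` certified n) \<in> sets borel" by (intro sets.countable_UN) auto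
    from measurable_sets[OF sel_meas this] show ?thesis unfolding good_eq .
  qed
  have bad_sets: "?bad \<in> sets ?S" using measurable_violation by measurable
  \<comment> \<open>The extracted value function itself witnesses inverse feasibility.\<close>
  have "space ?S - ?bad \<subseteq> ?good"
  proof
    fix s assume "s \<in> space ?S - ?bad"
    then have s: "s \<in> space ?S" and small: "violation (sel s) \<le> \<rho>" by auto
    obtain \<alpha> \<beta> e where sel_eq: "sel s = (\<alpha>, \<beta>, e)" by (cases "sel s")
    have dom: "(\<alpha>, \<beta>, e) \<in> program_domain \<theta>" using opt[OF s] by (simp add: optimum_def sel_eq)
    have everywhere: "- (e + \<epsilon>) \<le> residual \<alpha> \<beta> z" if z: "z \<in> X \<times> A" for z
    proof -
      have "\<not> {w \<in> X \<times> A. sum_dist z w < r} \<subseteq> {w \<in> space Q. normal w \<bullet> sel s < 0}"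
      proof
        assume sub: "{w \<in> X \<times> A. sum_dist z w < r} \<subseteq> {w \<in> space Q. normal w \<bullet> sel s < 0}"
        have "measure Q {w \<in> X \<times> A. sum_dist z w < r} \<le> violation (sel s)"
          unfolding violation_def using sub by (intro Q.finite_measure_mono) measurable
        then show False using ball[OF z] small by linarith
      qed
      then obtain w where w: "w \<in> X \<times> A" "sum_dist z w < r" "\<not> normal w \<bullet> sel s < 0"
        using space_Q by blast
      \<comment> \<open>The residual even has the smaller Lipschitz constant without the square roots.\<close>
      have "\<theta> * L\<^sub>c \<le> \<theta> * sqrt (real CARD('nc)) * L\<^sub>c"
        using theta(1) cs(3) by (simp add: mult_le_cancel_right1 mult_le_cancel_left1 Suc_leI)
      moreover have "\<theta> * (L\<^sub>u * L\<^sub>P + L\<^sub>u) \<le> \<theta> * sqrt (real CARD('nu)) * (L\<^sub>u * L\<^sub>P + L\<^sub>u)"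
      proof -
        have "0 \<le> L\<^sub>u * L\<^sub>P + L\<^sub>u" using us(3) LP by simp
        moreover have "\<theta> * 1 \<le> \<theta> * sqrt (real CARD('nu))"
          using theta(1) by (intro mult_left_mono) (auto simp: Suc_leI)
        ultimately show ?thesis by (metis mult.right_neutral mult_right_mono)
      qed
      ultimately have const: "\<theta> * L\<^sub>c + \<theta> * (L\<^sub>u * L\<^sub>P + L\<^sub>u) \<le> L\<^sub>\<Lambda>" unfolding L\<^sub>\<Lambda>_def by linarith
      have "\<bar>residual \<alpha> \<beta> z - residual \<alpha> \<beta> w\<bar> \<le> (\<theta> * L\<^sub>c + \<theta> * (L\<^sub>u * L\<^sub>P + L\<^sub>u)) * sum_dist z w"
        using dom by (intro residual_lipschitz cs us z w(1)) (auto simp: program_domain_def)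
      also have "\<dots> \<le> L\<^sub>\<Lambda> * r"
        using const w(2) L_pos by (intro mult_mono) (auto simp: sum_dist_nonneg)
      also have "\<dots> = \<epsilon>" using L_pos by (simp add: r_def)
      finally have "residual \<alpha> \<beta> w - \<epsilon> \<le> residual \<alpha> \<beta> z" by linarith
      moreover have "- e \<le> residual \<alpha> \<beta> w" using w(3) normal_inner[OF w(1), of \<alpha> \<beta> e] by (simp add: sel_eq)
      ultimately show ?thesis by linarith
    qed
    have "lincomb cs \<alpha> \<in> inverse_feasibility_set X A P \<gamma> \<nu>\<^sub>0 \<pi>\<^sub>E (e + \<epsilon>)"
      unfolding inverse_feasibility_set_def
    proof (intro CollectI conjI bexI[of _ "lincomb us \<beta>"] ballI)
      show "lincomb cs \<alpha> \<in> Lip sum_dist (X \<times> A)"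
        using cs(1) by (rule Lip_lincomb) (rule sum_dist_nonneg)
      show "lincomb us \<beta> \<in> Lip dist X" using us(1) by (rule Lip_lincomb) simp
      show "(\<integral>z. lincomb cs \<alpha> z - T_adj P \<gamma> (lincomb us \<beta>) z \<partial>occ) \<le> e + \<epsilon>"
        using dom eps by (simp add: program_domain_def residual_def)
      show "- (e + \<epsilon>) \<le> lincomb cs \<alpha> z - T_adj P \<gamma> (lincomb us \<beta>) z" if "z \<in> X \<times> A" for z
        using everywhere[OF that] by (simp add: residual_def)
    qed
    then show "s \<in> ?good" using s by (simp add: sel_eq)
  qed
  then have "measure ?S (space ?S - ?bad) \<le> measure ?S ?good"
    by (rule S.finite_measure_mono[OF _ good_sets])
  moreover have "measure ?S (space ?S - ?bad) = 1 - measure ?S ?bad"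
    by (rule S.prob_compl[OF bad_sets])
  moreover have "measure ?S ?bad \<le> (\<Sum>i<?d. real (N choose i) * \<rho> ^ i * (1 - \<rho>) ^ (N - i))"
    using violation_prob_le[OF rho] unfolding dim .
  moreover have "(\<Sum>i<?d. real (N choose i) * \<rho> ^ i * (1 - \<rho>) ^ (N - i)) \<le> binomial_tail ?d \<rho> N"
    unfolding binomial_tail_def using rho by (intro sum_mono2) auto
  ultimately show "measure ?S ?good \<ge> 1 - \<delta>" using size(1) by linarith
qed

end
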